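(* Let $I\subset\mathbb R$ be a finite closed interval and let $T_a:[0,1]\to[0,1]$, $a\in I$, be a one-parameter family of mixing piecewise expanding unimodal maps (in the sense of the context) with turning points $c(a)$. Suppose that for some $j_0\ge3$, $$|D_aT_a^{j_0}(c(a))|>\frac{\sup_{a\in I}\sup_{x\in[0,1]}|\partial_aT_a(x)|}{\inf_{a\in I}\inf_{x\in[0,1]}|\partial_xT_a(x)|-1}$$ for all but finitely many $a\in I$ (in particular, the set of $a\in I$ at which $a\mapsto T_a^{j_0}(c(a))$ is not differentiable is finite). Then the turning point $c(a)$ is typical for the unique absolutely continuous invariant probability measure of $T_a$, for Lebesgue almost every $a\in I$.
   Context: $C^{1,1}(L)$ means $C^1$ with derivative Lipschitz with constant at most $L$; $\mathrm{Lip}(L)$ means Lipschitz with constant at most $L$. A map $T:[0,1]\to[0,1]$ is a piecewise expanding unimodal map if it is continuous and there is a turning point $c\in(0,1)$ such that $T|_{[0,c]}$ and $T|_{[c,1]}$ are $C^{1,1}(L)$, $\inf_{x\in[0,c]}T'(x)>1$, $\sup_{x\in[c,1]}T'(x)<-1$, $T(c)=1$ and $T^2(c)=0$. Such a map has a unique absolutely continuous invariant probability measure $\mu$. It is called mixing if it is topologically mixing on $[0,1]$ (this implies $\mathrm{supp}(\mu)=[0,1]$). One-parameter family of piecewise expanding unimodal maps: each $T_a$, $a\in I$, is a piecewise expanding unimodal map with turning point $c(a)$, with the same constant $L$ for all $a$, and: there are constants $1<\lambda\le\Lambda<\infty$ with $\lambda\le|\partial_xT_a(x)|\le\Lambda$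 for all $a\in I$ and $x\neq c(a)$; the map $a\mapsto c(a)$ is $\mathrm{Lip}(L)$ on $I$ and there is $\delta_0>0$ with $c(a)\ge\delta_0$ and $1-c(a)\ge\delta_0$ for all $a\in I$; for each $x\in[0,1]$ the map $a\mapsto T_a(x)$ is $\mathrm{Lip}(L)$ on $I$; and if $x\in[0,1]$ and $J\subset I$ is an interval with $x\ne c(a)$ for all $a\in J$, then $a\mapsto T_a(x)$ is $C^1(J)$ and $a\mapsto\partial_xT_a(x)$ is $\mathrm{Lip}(L)$ on $J$. Infima and suprema of derivatives are taken over the points where the derivative exists. A point $x$ is typical for a $T_a$-invariant probability measure $\mu_a$ if $\frac1n\sum_{i=0}^{n-1}\delta_{T_a^i(x)}\to\mu_a$ weak-$*$ as $n\to\infty$. *)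

theory Defs
  imports "HOL-Probability.Probability"
begin

text \<open>
  Maps of the unit interval are functions \<open>real \<Rightarrow> real\<close>; only their values on \<open>{0..1}\<close>
  matter. Derivatives are taken within the relevant domain, hence they are one-sided at end points.
  \<open>vector_derivative f (at x within S)\<close> is the ordinary derivative of \<open>f|S\<close> at \<open>x\<close> when it exists
  (\<open>deriv\<close> is not usable here since it is always two-sided).
\<close>

text \<open>\<open>C1_differentiable_on\<close> from the library asks for two-sided derivatives at end points, too.\<close>

definition C1_on :: "real set \<Rightarrow> (real \<Rightarrow> real) \<Rightarrow> bool" where
  "C1_on S f \<longleftrightarrow>
     (\<exists>f'. (\<forall>x\<in>S. (f has_real_derivative f' x) (at x within S)) \<and> continuous_on S f')"

definition C11_on :: "real \<Rightarrow> real set \<Rightarrow> (real \<Rightarrow> real) \<Rightarrow> bool" where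
  "C11_on L S f \<longleftrightarrow>
     (\<exists>f'. (\<forall>x\<in>S. (f has_real_derivative f' x) (at x within S)) \<and> L-lipschitz_on S f')"

definition pe_unimodal :: "real \<Rightarrow> (real \<Rightarrow> real) \<Rightarrow> real \<Rightarrow> bool" where
  "pe_unimodal L T c \<longleftrightarrow>
     T ` {0..1} \<subseteq> {0..1} \<and> continuous_on {0..1} T \<and> 0 < c \<and> c < 1 \<and>
     C11_on L {0..c} T \<and> C11_on L {c..1} T \<and>
     (INF x\<in>{0..c}. vector_derivative T (at x within {0..c})) > 1 \<and>
     (SUP x\<in>{c..1}. vector_derivative T (at x within {c..1})) < -1 \<and>
     T c = 1 \<and> T (T c) = 0"

definition topologically_mixing :: "(real \<Rightarrow> real) \<Rightarrow> bool" where
  "topologically_mixing T \<longleftrightarrow>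
     (\<forall>U V. openin (top_of_set {0..1}) U \<and> openin (top_of_set {0..1}) V \<and> U \<noteq> {} \<and> V \<noteq> {} \<longrightarrow>
        (\<exists>N. \<forall>n\<ge>N. (T ^^ n) ` U \<inter> V \<noteq> {}))"

definition pe_unimodal_family ::
    "real \<Rightarrow> real set \<Rightarrow> (real \<Rightarrow> real \<Rightarrow> real) \<Rightarrow> (real \<Rightarrow> real) \<Rightarrow> bool" where
  "pe_unimodal_family L I T c \<longleftrightarrow>
     (\<forall>a\<in>I. pe_unimodal L (T a) (c a)) \<and>
     (\<exists>l u. 1 < l \<and> l \<le> u \<and>
        (\<forall>a\<in>I. \<forall>x\<in>{0..1}. x \<noteq> c a \<longrightarrow>
           l \<le> \<bar>vector_derivative (T a) (at x within {0..1})\<bar> \<and>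
           \<bar>vector_derivative (T a) (at x within {0..1})\<bar> \<le> u)) \<and>
     L-lipschitz_on I c \<and>
     (\<exists>\<delta>>0. \<forall>a\<in>I. c a \<ge> \<delta> \<and> 1 - c a \<ge> \<delta>) \<and>
     (\<forall>x\<in>{0..1}. L-lipschitz_on I (\<lambda>a. T a x)) \<and>
     (\<forall>x\<in>{0..1}. \<forall>J. J \<subseteq> I \<and> is_interval J \<and> (\<forall>a\<in>J. x \<noteq> c a) \<longrightarrow>
        C1_on J (\<lambda>a. T a x) \<and>
        L-lipschitz_on J (\<lambda>a. vector_derivative (T a) (at x within {0..1})))"

text \<open>
  The iterated supremum of \<open>\<bar>\<partial>\<^sub>a T\<^sub>a(x)\<bar>\<close> and the iterated infimum of \<open>\<bar>\<partial>\<^sub>x T\<^sub>a(x)\<bar>\<close>, over the points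
  where the derivatives exist. For a family as above on a nondegenerate interval, the sets involved
  are nonempty and bounded, so that the real-valued \<open>Sup\<close> and \<open>Inf\<close> have their usual meaning.
\<close>

definition sup_param_deriv :: "real set \<Rightarrow> (real \<Rightarrow> real \<Rightarrow> real) \<Rightarrow> real" where
  "sup_param_deriv I T =
     (SUP a\<in>I. SUP x\<in>{x\<in>{0..1}. (\<lambda>b. T b x) differentiable (at a within I)}.
        \<bar>vector_derivative (\<lambda>b. T b x) (at a within I)\<bar>)"

definition inf_space_deriv :: "real set \<Rightarrow> (real \<Rightarrow> real \<Rightarrow> real) \<Rightarrow> real" where
  "inf_space_deriv I T =
     (INF a\<in>I. INF x\<in>{x\<in>{0..1}. (T a) differentiable (at x within {0..1})}.
        \<bar>vector_derivative (T a) (at x within {0..1})\<bar>)"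

definition lebesgue01 :: "real measure" where
  "lebesgue01 = restrict_space lborel {0..1}"

definition invariant_prob :: "(real \<Rightarrow> real) \<Rightarrow> real measure \<Rightarrow> bool" where
  "invariant_prob T \<mu> \<longleftrightarrow>
     prob_space \<mu> \<and> sets \<mu> = sets lebesgue01 \<and> T \<in> measurable \<mu> \<mu> \<and> distr \<mu> \<mu> T = \<mu>"

definition acip :: "(real \<Rightarrow> real) \<Rightarrow> real measure \<Rightarrow> bool" where
  "acip T \<mu> \<longleftrightarrow> invariant_prob T \<mu> \<and> absolutely_continuous lebesgue01 \<mu>"

text \<open>
  The measure \<open>(1/n) \<Sum>i<n. \<delta>\<^bsub>T^i x\<^esub>\<close>, as the push-forward of the uniform distribution on
  \<open>{..<n}\<close> under \<open>i \<mapsto> T^i x\<close> (meaningful for \<open>n > 0\<close>).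
\<close>

definition empirical_measure :: "(real \<Rightarrow> real) \<Rightarrow> real \<Rightarrow> nat \<Rightarrow> real measure" where
  "empirical_measure T x n = distr (uniform_count_measure {..<n}) lebesgue01 (\<lambda>i. (T ^^ i) x)"

definition weak_star_conv :: "(nat \<Rightarrow> real measure) \<Rightarrow> real measure \<Rightarrow> bool" where
  "weak_star_conv \<nu> \<mu> \<longleftrightarrow>
     (\<forall>f :: real \<Rightarrow> real. continuous_on {0..1} f \<longrightarrow>
        (\<lambda>n. \<integral>x. f x \<partial>(\<nu> n)) \<longlonglongrightarrow> (\<integral>x. f x \<partial>\<mu>))"

definition typical :: "(real \<Rightarrow> real) \<Rightarrow> real measure \<Rightarrow> real \<Rightarrow> bool" where
  "typical T \<mu> x \<longleftrightarrow> weak_star_conv (empirical_measure T x) \<mu>"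

end

theory Submission
  imports Defs
begin

text \<open>
  Write \<open>x\<^sub>j(a) = T\<^sub>a\<^sup>j(c(a))\<close>. The hypothesis makes \<open>x\<^sub>j\<close> expand parameter intervals from some
  time on. Near almost every parameter \<open>a\<^sub>0\<close>, where the turning point is not periodic, a short image
  of a parameter interval is cut by the turning point at most once within a long time \<open>N\<close>, so
  expansion beats cutting: an interval splits into pieces \<open>\<omega>\<close>, mapped injectively by \<open>x\<^sub>n\<close> with
  bounded distortion, such that \<open>\<Sum> |\<omega>| / |x\<^sub>n(\<omega>)|\<close> is halved every \<open>N\<close> steps up to a multiple of
  the length of the interval. Hence the exponential moments of the numbers of visits to an interval
  \<open>B\<close> along an arithmetic progression of times grow at most like \<open>(1 + C|B|)\<^sup>k\<close>, and by Borel--Cantelli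
  the frequency of visits to \<open>B\<close> is at most \<open>C'|B|\<close> for almost every parameter. Every weak limit of
  the empirical measures is then an absolutely continuous invariant measure. Such a measure is unique:
  the same splitting, applied to the points of the interval under a single map, shows that an
  invariant set of positive measure contains an interval up to a null set, and mixing excludes two
  such sets that are disjoint.
\<close>

section \<open>Expanding curves in parameter space\<close>

text \<open>\<open>K / (lam - 1)\<close> is the fixed point of
  \<open>s \<mapsto> lam * s - K\<close>, the worst case for the slope of a curve under one step: a
  slope above it never falls back, and this is what the hypothesis provides. The obstacle is that
  \<open>lam\<close> may be below 2, so that one cut per step would outweigh the expansion. The
  remedy is an order of choices. The distortion constant depends on slope bounds of the initial
  curve but not on the length of the parameter interval. So first \<open>N\<close> is chosen with
  \<open>lam ^ N\<close> beating that constant and the two pieces of a single cut, and only then the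
  interval is shrunk until the turning points of its maps keep away from themselves for
  \<open>N\<close> steps. Parameters with a periodic turning point escape this treatment, and they
  turn out to be countable. The sum of \<open>|\<omega>| / |x_n(\<omega>)|\<close> is the right
  quantity because, times \<open>|B|\<close> and up to distortion, it bounds the measure of the
  parameters with \<open>x_n\<close> in \<open>B\<close>. A bound on it thus makes visits to
  \<open>B\<close> as rare as the length of \<open>B\<close> demands.\<close>

locale expanding_family =
  fixes p q :: real and T :: "real \<Rightarrow> real \<Rightarrow> real" and c :: "real \<Rightarrow> real"
    and lam Lam K H :: real
  assumes p_less_q: "p < q"
    and lam: "1 < lam" and Lam: "0 \<le> Lam" and K: "0 \<le> K" and H: "0 \<le> H"
    and T_range: "a \<in> {p..q} \<Longrightarrow> x \<in> {0..1} \<Longrightarrow> T a x \<in> {0..1}"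
    and c_range: "a \<in> {p..q} \<Longrightarrow> c a \<in> {0..1}"
    and T_expand: "a \<in> {p..q} \<Longrightarrow> x \<in> {0..1} \<Longrightarrow> y \<in> {0..1} \<Longrightarrow>
        (x \<le> c a \<and> y \<le> c a) \<or> (c a \<le> x \<and> c a \<le> y) \<Longrightarrow> lam * \<bar>x - y\<bar> \<le> \<bar>T a x - T a y\<bar>"
    and T_lip: "a \<in> {p..q} \<Longrightarrow> x \<in> {0..1} \<Longrightarrow> y \<in> {0..1} \<Longrightarrow> \<bar>T a x - T a y\<bar> \<le> Lam * \<bar>x - y\<bar>"
    and T_param_lip: "a \<in> {p..q} \<Longrightarrow> b \<in> {p..q} \<Longrightarrow> x \<in> {0..1} \<Longrightarrow> \<bar>T a x - T b x\<bar> \<le> K * \<bar>a - b\<bar>"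
    and c_lip: "a \<in> {p..q} \<Longrightarrow> b \<in> {p..q} \<Longrightarrow> \<bar>c a - c b\<bar> \<le> K / lam * \<bar>a - b\<bar>"
    and T_distortion: "a \<in> {p..q} \<Longrightarrow> b \<in> {p..q} \<Longrightarrow>
        x \<in> {0..1} \<Longrightarrow> y \<in> {0..1} \<Longrightarrow> x' \<in> {0..1} \<Longrightarrow> y' \<in> {0..1} \<Longrightarrow>
        (x \<le> c a \<and> y \<le> c a \<and> x' \<le> c b \<and> y' \<le> c b) \<or>
        (c a \<le> x \<and> c a \<le> y \<and> c b \<le> x' \<and> c b \<le> y') \<Longrightarrow>
        \<bar>a - b\<bar> \<le> w \<Longrightarrow> \<bar>x - x'\<bar> \<le> w \<Longrightarrow> \<bar>x - y'\<bar> \<le> w \<Longrightarrow> \<bar>y - x'\<bar> \<le> w \<Longrightarrow> \<bar>y - y'\<bar> \<le> w \<Longrightarrow>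
        \<bar>T a x - T a y\<bar> * \<bar>x' - y'\<bar> \<le> (1 + H * w) * (\<bar>T b x' - T b y'\<bar> * \<bar>x - y\<bar>)"
begin

text \<open>The turning points differ for the two parameters, but one of them has both points on one
  side.\<close>

lemma pick_param:
  "x \<le> c a \<Longrightarrow> y \<le> c b \<Longrightarrow> \<exists>\<alpha>\<in>{a, b}. x \<le> c \<alpha> \<and> y \<le> c \<alpha>"
  "c a \<le> x \<Longrightarrow> c b \<le> y \<Longrightarrow> \<exists>\<alpha>\<in>{a, b}. c \<alpha> \<le> x \<and> c \<alpha> \<le> y"
  by (metis insertCI linear order_trans)+

lemma two_point_compare:
  assumes "a \<in> {p..q}" "b \<in> {p..q}" "x \<in> {0..1}" "y \<in> {0..1}" "\<alpha> = a \<or> \<alpha> = b"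
  shows "\<bar>T a x - T b y\<bar> \<le> \<bar>T \<alpha> x - T \<alpha> y\<bar> + K * \<bar>a - b\<bar>"
    and "\<bar>T \<alpha> x - T \<alpha> y\<bar> - K * \<bar>a - b\<bar> \<le> \<bar>T a x - T b y\<bar>"
proof -
  note l = T_param_lip[OF assms(1,2,3)] T_param_lip[OF assms(1,2,4)]
  from assms(5) have "\<bar>\<bar>T a x - T b y\<bar> - \<bar>T \<alpha> x - T \<alpha> y\<bar>\<bar> \<le> K * \<bar>a - b\<bar>"
  proof
    assume "\<alpha> = a" thus ?thesis using l by (simp only: ; linarith)
  next
    assume "\<alpha> = b" thus ?thesis using l by (simp only: ; linarith)
  qed
  thus "\<bar>T a x - T b y\<bar> \<le> \<bar>T \<alpha> x - T \<alpha> y\<bar> + K * \<bar>a - b\<bar>"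
    "\<bar>T \<alpha> x - T \<alpha> y\<bar> - K * \<bar>a - b\<bar> \<le> \<bar>T a x - T b y\<bar>" by linarith+
qed

lemma two_point_growth:
  assumes "a \<in> {p..q}" "b \<in> {p..q}" "x \<in> {0..1}" "y \<in> {0..1}"
    "(x \<le> c a \<and> y \<le> c b) \<or> (c a \<le> x \<and> c b \<le> y)"
  shows "lam * \<bar>x - y\<bar> - K * \<bar>a - b\<bar> \<le> \<bar>T a x - T b y\<bar>"
proof -
  obtain \<alpha> where al: "\<alpha> \<in> {a, b}"
    "(x \<le> c \<alpha> \<and> y \<le> c \<alpha>) \<or> (c \<alpha> \<le> x \<and> c \<alpha> \<le> y)"
    using pick_param[of x a y b] pick_param(2)[of a x b y] assms(5) by metis
  have "\<alpha> \<in> {p..q}" "\<alpha> = a \<or> \<alpha> = b" using al assms by auto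
  from T_expand[OF this(1) assms(3,4) al(2)] two_point_compare(2)[OF assms(1-4) this(2)]
  show ?thesis by linarith
qed

lemma two_point_upper:
  assumes "a \<in> {p..q}" "b \<in> {p..q}" "x \<in> {0..1}" "y \<in> {0..1}"
  shows "\<bar>T a x - T b y\<bar> \<le> Lam * \<bar>x - y\<bar> + K * \<bar>a - b\<bar>"
  using two_point_compare(1)[OF assms disjI1[OF refl]] T_lip[OF assms(1,3,4)] by linarith

lemma continuous_c: "continuous_on {p..q} c"
proof -
  have "(K / lam)-lipschitz_on {p..q} c"
    using c_lip K lam by (intro lipschitz_onI) (auto simp: dist_real_def)
  thus ?thesis by (rule lipschitz_on_continuous_on)
qed

lemma continuous_step:
  assumes "continuous_on {p..q} f" "\<And>a. a \<in> {p..q} \<Longrightarrow> f a \<in> {0..1}"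
  shows "continuous_on {p..q} (\<lambda>a. T a (f a))"
  unfolding continuous_on_def
proof
  fix a assume a: "a \<in> {p..q}"
  have "(f \<longlongrightarrow> f a) (at a within {p..q})" using assms(1) a by (simp add: continuous_on_def)
  hence "((\<lambda>b. Lam * \<bar>f b - f a\<bar> + K * \<bar>b - a\<bar>) \<longlongrightarrow> Lam * \<bar>f a - f a\<bar> + K * \<bar>a - a\<bar>) (at a within {p..q})"
    by (intro tendsto_intros)
  hence lim: "((\<lambda>b. Lam * \<bar>f b - f a\<bar> + K * \<bar>b - a\<bar>) \<longlongrightarrow> 0) (at a within {p..q})" by simp
  have "norm (T b (f b) - T a (f a)) \<le> Lam * \<bar>f b - f a\<bar> + K * \<bar>b - a\<bar>" if "b \<in> {p..q}" for b
    using two_point_upper[OF that a assms(2)[OF that] assms(2)[OF a]] by simp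
  hence "\<forall>\<^sub>F b in at a within {p..q}. norm (T b (f b) - T a (f a)) \<le> Lam * \<bar>f b - f a\<bar> + K * \<bar>b - a\<bar>"
    unfolding eventually_at_filter by (intro always_eventually) blast
  from Lim_null_comparison[OF this lim]
  have "((\<lambda>b. T b (f b) - T a (f a)) \<longlongrightarrow> 0) (at a within {p..q})" .
  thus "((\<lambda>a. T a (f a)) \<longlongrightarrow> T a (f a)) (at a within {p..q})" by (rule Lim_null[THEN iffD2])
qed

end

text \<open>The starting curve is left open to fit both uses: \<open>X 0\<close> is
  \<open>orb j0\<close> near a given parameter, or the identity on the unit interval for a single
  map, with \<open>K = 0\<close> and \<open>s0 = Q0 = 1\<close>. Two-sided bounds on difference
  quotients replace a derivative.\<close>

locale expanding_curve = expanding_family +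
  fixes X :: "nat \<Rightarrow> real \<Rightarrow> real" and s0 Q0 :: real
  assumes s0: "K / (lam - 1) < s0"
    and X0_range: "a \<in> {p..q} \<Longrightarrow> X 0 a \<in> {0..1}"
    and X_Suc: "X (Suc n) a = T a (X n a)"
    and X0_lower: "a \<in> {p..q} \<Longrightarrow> b \<in> {p..q} \<Longrightarrow> s0 * \<bar>a - b\<bar> \<le> \<bar>X 0 a - X 0 b\<bar>"
    and X0_upper: "a \<in> {p..q} \<Longrightarrow> b \<in> {p..q} \<Longrightarrow> \<bar>X 0 a - X 0 b\<bar> \<le> Q0 * \<bar>a - b\<bar>"
begin

text \<open>The excess of the slope over the fixed point \<open>K / (lam - 1)\<close> is multiplied
  by at least \<open>lam\<close> in each step; \<open>growth_const\<close> is the smallest share of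
  the slope that this excess can be.\<close>

definition growth_const :: real where "growth_const = 1 - K / (lam - 1) / s0"

text \<open>\<open>Q0 / s0\<close> compares difference quotients of \<open>X 0\<close>. The exponent
  sums two geometric series of ratio \<open>1 / lam\<close>: the errors from switching parameters,
  small at late times, and the variation of the slope of the map over the image, small well before
  the final time. Neither the final time nor the interval occurs.\<close>

definition dist_const :: real where
  "dist_const = Q0 / s0 * exp ((2 * K / (growth_const * s0) + H * (1 + 1 / s0) / growth_const) / (1 - 1 / lam))"

text \<open>On a branch the curves \<open>X 0, \<dots>, X (n - 1)\<close> do not cross the turning point, so that \<open>X n\<close>
  is injective there; its length divided by that of its image measures the inverse slope.\<close>

definition branch :: "nat \<Rightarrow> real \<Rightarrow> real \<Rightarrow> bool" where
  "branch n u v \<longleftrightarrow> p \<le> u \<and> u < v \<and> v \<le> q \<and>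
     (\<forall>k<n. (\<forall>a\<in>{u..v}. X k a \<le> c a) \<or> (\<forall>a\<in>{u..v}. c a \<le> X k a))"

definition inv_slope :: "nat \<Rightarrow> real \<Rightarrow> real \<Rightarrow> real" where
  "inv_slope n u v = (v - u) / \<bar>X n v - X n u\<bar>"

lemma s0_pos: "0 < s0"
proof -
  have "0 \<le> K / (lam - 1)" using K lam by simp
  thus ?thesis using s0 by simp
qed

lemma growth_const_pos: "0 < growth_const" and growth_const_le1: "growth_const \<le> 1"
  using s0 s0_pos K lam by (auto simp: growth_const_def field_simps)

lemma K_le: "K \<le> (lam - 1) * s0"
  using s0 lam by (auto simp: field_simps)

lemma X_range: "a \<in> {p..q} \<Longrightarrow> X n a \<in> {0..1}"
  by (induction n) (simp_all only: X0_range X_Suc T_range)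

lemma branch_in: "branch n u v \<Longrightarrow> a \<in> {u..v} \<Longrightarrow> a \<in> {p..q}"
  by (auto simp: branch_def)

lemma branch_mono: "branch n u v \<Longrightarrow> m \<le> n \<Longrightarrow> branch m u v"
  by (auto simp: branch_def)

lemma branch_sub: "branch n u v \<Longrightarrow> u \<le> u' \<Longrightarrow> u' < v' \<Longrightarrow> v' \<le> v \<Longrightarrow> branch n u' v'"
  unfolding branch_def by (smt (verit) atLeastAtMost_iff)

lemma growth1:
  assumes "a \<in> {p..q}" "b \<in> {p..q}"
    "(X k a \<le> c a \<and> X k b \<le> c b) \<or> (c a \<le> X k a \<and> c b \<le> X k b)"
  shows "lam * \<bar>X k a - X k b\<bar> - K * \<bar>a - b\<bar> \<le> \<bar>X (Suc k) a - X (Suc k) b\<bar>"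
  using two_point_growth[OF assms(1,2) X_range[OF assms(1)] X_range[OF assms(2)] assms(3)]
  by (simp add: X_Suc)

lemma branch_side:
  assumes "branch n u v" "k < n" "a \<in> {u..v}" "b \<in> {u..v}"
  shows "(X k a \<le> c a \<and> X k b \<le> c b) \<or> (c a \<le> X k a \<and> c b \<le> X k b)"
  using assms unfolding branch_def by blast

lemma slope_lower:
  assumes "branch n u v" "a \<in> {u..v}" "b \<in> {u..v}"
  shows "s0 * \<bar>a - b\<bar> \<le> \<bar>X n a - X n b\<bar>"
  using assms(1)
proof (induction n)
  case 0 show ?case using X0_lower branch_in[OF assms(1)] assms by blast
next
  case (Suc n)
  have IH: "s0 * \<bar>a - b\<bar> \<le> \<bar>X n a - X n b\<bar>" using Suc branch_mono by simp
  have ab: "a \<in> {p..q}" "b \<in> {p..q}" using branch_in[OF assms(1)] assms by blast+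
  have "lam * (s0 * \<bar>a - b\<bar>) - (lam - 1) * s0 * \<bar>a - b\<bar> \<le> lam * \<bar>X n a - X n b\<bar> - K * \<bar>a - b\<bar>"
    using IH lam K_le by (intro diff_mono mult_left_mono mult_right_mono) auto
  also have "\<dots> \<le> \<bar>X (Suc n) a - X (Suc n) b\<bar>"
    by (rule growth1[OF ab branch_side[OF Suc.prems _ assms(2,3)]]) simp
  finally show ?case by (simp add: algebra_simps)
qed

lemma growth:
  assumes "branch (n + m) u v" "a \<in> {u..v}" "b \<in> {u..v}"
  shows "growth_const * lam ^ m * \<bar>X n a - X n b\<bar> \<le> \<bar>X (n + m) a - X (n + m) b\<bar>"
proof -
  define M where "M = K / (lam - 1)"
  have KM: "K = (lam - 1) * M" using lam by (simp add: M_def)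
  have M0: "0 \<le> M" using K lam by (simp add: M_def)
  have ab: "a \<in> {p..q}" "b \<in> {p..q}" using branch_in[OF assms(1)] assms by blast+
  \<comment> \<open>With \<open>K = (lam - 1) * M\<close> the excess
    \<open>\<bar>X n a - X n b\<bar> - M * \<bar>a - b\<bar>\<close> is multiplied by at least
    \<open>lam\<close> in each step.\<close>
  have *: "lam ^ m * (\<bar>X n a - X n b\<bar> - M * \<bar>a - b\<bar>) \<le> \<bar>X (n + m) a - X (n + m) b\<bar> - M * \<bar>a - b\<bar>"
    using assms(1)
  proof (induction m)
    case (Suc m)
    have "lam ^ Suc m * (\<bar>X n a - X n b\<bar> - M * \<bar>a - b\<bar>)
        \<le> lam * (\<bar>X (n + m) a - X (n + m) b\<bar> - M * \<bar>a - b\<bar>)"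
      using Suc.IH[OF branch_mono[OF Suc.prems]] lam by simp
    also have "\<dots> = lam * \<bar>X (n + m) a - X (n + m) b\<bar> - K * \<bar>a - b\<bar> - M * \<bar>a - b\<bar>"
      by (simp add: KM algebra_simps)
    also have "\<dots> \<le> \<bar>X (n + Suc m) a - X (n + Suc m) b\<bar> - M * \<bar>a - b\<bar>"
      using growth1[OF ab branch_side[OF Suc.prems _ assms(2,3)], of "n + m"] by simp
    finally show ?case .
  qed simp
  have "s0 * \<bar>a - b\<bar> \<le> \<bar>X n a - X n b\<bar>"
    using slope_lower[OF branch_mono[OF assms(1)] assms(2,3)] by simp
  hence "M / s0 * (s0 * \<bar>a - b\<bar>) \<le> M / s0 * \<bar>X n a - X n b\<bar>"
    using M0 s0_pos by (intro mult_left_mono) auto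
  hence "M * \<bar>a - b\<bar> \<le> M / s0 * \<bar>X n a - X n b\<bar>" using s0_pos by simp
  hence "growth_const * \<bar>X n a - X n b\<bar> \<le> \<bar>X n a - X n b\<bar> - M * \<bar>a - b\<bar>"
    by (simp add: growth_const_def M_def algebra_simps)
  hence "lam ^ m * (growth_const * \<bar>X n a - X n b\<bar>) \<le> lam ^ m * (\<bar>X n a - X n b\<bar> - M * \<bar>a - b\<bar>)"
    using lam by (intro mult_left_mono) auto
  moreover have "0 \<le> M * \<bar>a - b\<bar>" using M0 by simp
  ultimately show ?thesis using * by (simp add: algebra_simps)
qed

lemma upper1:
  assumes "a \<in> {p..q}" "b \<in> {p..q}"
  shows "\<bar>X (Suc k) a - X (Suc k) b\<bar> \<le> Lam * \<bar>X k a - X k b\<bar> + K * \<bar>a - b\<bar>"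
  using two_point_upper[OF assms X_range[OF assms(1)] X_range[OF assms(2)]] by (simp add: X_Suc)

text \<open>Adding the parameter distance to the image distance makes the one-step bound
  homogeneous, so that it iterates to a pure power.\<close>

lemma upper:
  assumes "a \<in> {p..q}" "b \<in> {p..q}"
  shows "\<bar>X (n + m) a - X (n + m) b\<bar> + \<bar>a - b\<bar> \<le> (Lam + K + 1) ^ m * (\<bar>X n a - X n b\<bar> + \<bar>a - b\<bar>)"
proof (induction m)
  case (Suc m)
  have "\<bar>X (n + Suc m) a - X (n + Suc m) b\<bar> + \<bar>a - b\<bar>
      \<le> Lam * \<bar>X (n + m) a - X (n + m) b\<bar> + K * \<bar>a - b\<bar> + \<bar>a - b\<bar>"
    using upper1[OF assms, of "n + m"] by simp
  also have "\<dots> \<le> (Lam + K + 1) * (\<bar>X (n + m) a - X (n + m) b\<bar> + \<bar>a - b\<bar>)"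
    using Lam K by (simp add: algebra_simps)
  also have "\<dots> \<le> (Lam + K + 1) * ((Lam + K + 1) ^ m * (\<bar>X n a - X n b\<bar> + \<bar>a - b\<bar>))"
    using Suc Lam K by (intro mult_left_mono) auto
  finally show ?case by simp
qed simp

lemma continuous_X: "continuous_on {p..q} (X n)"
proof (induction n)
  case 0
  have "\<bar>Q0\<bar>-lipschitz_on {p..q} (X 0)"
  proof (rule lipschitz_onI)
    fix a b assume ab: "a \<in> {p..q}" "b \<in> {p..q}"
    have "Q0 * \<bar>a - b\<bar> \<le> \<bar>Q0\<bar> * \<bar>a - b\<bar>" by (intro mult_right_mono) auto
    thus "dist (X 0 a) (X 0 b) \<le> \<bar>Q0\<bar> * dist a b" using X0_upper[OF ab] by (simp add: dist_real_def)
  qed simp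
  thus ?case by (rule lipschitz_on_continuous_on)
next
  case (Suc n)
  show ?case unfolding X_Suc by (rule continuous_step[OF Suc X_range])
qed

section \<open>Bounded distortion of difference quotients\<close>

lemma geometric_bounds:
  fixes r :: real assumes "0 < r" "r < 1"
  shows "(\<Sum>i<k. r ^ i) \<le> 1 / (1 - r)" "k \<le> n \<Longrightarrow> (\<Sum>i<k. r ^ (n - i)) \<le> 1 / (1 - r)"
proof -
  show *: "(\<Sum>i<k. r ^ i) \<le> 1 / (1 - r)" for k
    using assms by (subst sum_gp_strict) (auto simp: divide_simps)
  assume "k \<le> n"
  have "(\<Sum>i<k. r ^ (n - i)) = (\<Sum>j\<in>(\<lambda>i. n - i) ` {..<k}. r ^ j)"
    using \<open>k \<le> n\<close> by (subst sum.reindex) (auto simp: inj_on_def)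
  also have "\<dots> \<le> (\<Sum>j<Suc n. r ^ j)" using assms by (intro sum_mono2) auto
  also note *
  finally show "(\<Sum>i<k. r ^ (n - i)) \<le> 1 / (1 - r)" .
qed

text \<open>Distortion is controlled for difference quotients instead of derivatives, since the curves
  \<open>X n\<close> need not have Lipschitz derivatives in the parameter.\<close>

lemma distortion_step:
  assumes branch: "branch n u v" and k: "k < n"
    and ab: "a \<in> {u..v}" "b \<in> {u..v}" and ab': "a' \<in> {u..v}" "b' \<in> {u..v}"
    and E: "\<bar>X k a - X k b\<bar> * \<bar>a' - b'\<bar> \<le> E * (\<bar>X k a' - X k b'\<bar> * \<bar>a - b\<bar>)" "0 \<le> E"
  shows "\<bar>X (Suc k) a - X (Suc k) b\<bar> * \<bar>a' - b'\<bar> \<le>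
    E * exp (2 * K / (growth_const * s0) * (1 / lam) ^ k + H * (1 + 1 / s0) / growth_const * (1 / lam) ^ (n - k)) *
      (\<bar>X (Suc k) a' - X (Suc k) b'\<bar> * \<bar>a - b\<bar>)"
proof (cases "a' = b'")
  case True then show ?thesis by simp
next
  case False
  \<comment> \<open>\<open>y\<close> bounds the error \<open>K * \<bar>x - z\<bar>\<close> of
    switching parameters relative to the image distance from time \<open>k\<close> on.
    \<open>w\<close> bounds image and parameter distances at time \<open>k\<close>: the image at
    time \<open>n\<close> has length at most 1 and has grown since time \<open>k\<close>.\<close>
  define y where "y = K / (growth_const * s0) * (1 / lam) ^ k"
  define w where "w = (1 + 1 / s0) / growth_const * (1 / lam) ^ (n - k)"
  have y0: "0 \<le> y" using K growth_const_pos s0_pos lam by (simp add: y_def)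
  have w0: "0 \<le> w" using growth_const_pos s0_pos lam by (simp add: w_def)
  have inJ: "a \<in> {p..q}" "b \<in> {p..q}" "a' \<in> {p..q}" "b' \<in> {p..q}"
    using branch_in[OF branch] ab ab' by blast+
  have Ke: "K * \<bar>x - z\<bar> \<le> y * \<bar>X j x - X j z\<bar>" if "x \<in> {u..v}" "z \<in> {u..v}" "k \<le> j" "j \<le> n" for x z j
  proof -
    have "branch (0 + j) u v" using branch_mono[OF branch that(4)] by simp
    from growth[OF this that(1,2)]
    have "growth_const * lam ^ j * \<bar>X 0 x - X 0 z\<bar> \<le> \<bar>X j x - X j z\<bar>" by simp
    moreover have "growth_const * lam ^ j * (s0 * \<bar>x - z\<bar>) \<le> growth_const * lam ^ j * \<bar>X 0 x - X 0 z\<bar>"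
      using X0_lower branch_in[OF branch] that growth_const_pos lam by (intro mult_left_mono) auto
    moreover have "growth_const * lam ^ k * (s0 * \<bar>x - z\<bar>) \<le> growth_const * lam ^ j * (s0 * \<bar>x - z\<bar>)"
      using lam growth_const_pos s0_pos that by (intro mult_right_mono mult_left_mono power_increasing) auto
    ultimately have "growth_const * lam ^ k * (s0 * \<bar>x - z\<bar>) \<le> \<bar>X j x - X j z\<bar>" by linarith
    hence "y * (growth_const * lam ^ k * (s0 * \<bar>x - z\<bar>)) \<le> y * \<bar>X j x - X j z\<bar>"
      using y0 by (rule mult_left_mono)
    moreover have "y * (growth_const * lam ^ k * (s0 * \<bar>x - z\<bar>)) = K * \<bar>x - z\<bar>"
      using growth_const_pos s0_pos lam by (simp add: y_def power_divide)
    ultimately show ?thesis by simp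
  qed
  have nk: "n = k + (n - k)" using k by simp
  have Xw: "\<bar>X k x - X k z\<bar> \<le> w" "\<bar>x - z\<bar> \<le> w" if "x \<in> {u..v}" "z \<in> {u..v}" for x z
  proof -
    have "growth_const * lam ^ (n - k) * \<bar>X k x - X k z\<bar> \<le> \<bar>X n x - X n z\<bar>"
      using growth[of k "n - k" u v x z] nk branch that by simp
    also have "\<dots> \<le> 1"
      using X_range[of x n] X_range[of z n] branch_in[OF branch] that by fastforce
    finally have 1: "\<bar>X k x - X k z\<bar> \<le> 1 / growth_const * (1 / lam) ^ (n - k)"
      using growth_const_pos lam by (simp add: field_simps power_divide)
    have 2: "s0 * \<bar>x - z\<bar> \<le> \<bar>X k x - X k z\<bar>"
      using slope_lower[OF branch_mono[OF branch] that, of k] k by simp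
    have 3: "w = 1 / growth_const * (1 / lam) ^ (n - k) + 1 / s0 * (1 / growth_const * (1 / lam) ^ (n - k))"
      unfolding w_def by (simp add: add_divide_distrib distrib_right)
    have p: "0 \<le> 1 / growth_const * (1 / lam) ^ (n - k)" using growth_const_pos lam by simp
    have "\<bar>x - z\<bar> \<le> 1 / growth_const * (1 / lam) ^ (n - k) / s0"
      using order_trans[OF 2 1] s0_pos by (simp only: pos_le_divide_eq mult.commute)
    hence "\<bar>x - z\<bar> \<le> 1 / s0 * (1 / growth_const * (1 / lam) ^ (n - k))" by (simp add: mult.commute)
    with 3 p show "\<bar>x - z\<bar> \<le> w" by linarith
    have "0 \<le> 1 / s0 * (1 / growth_const * (1 / lam) ^ (n - k))" using mult_nonneg_nonneg[OF _ p, of "1 / s0"] s0_pos by simp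
    with 1 3 show "\<bar>X k x - X k z\<bar> \<le> w" by linarith
  qed
  have sides: "(\<forall>x\<in>{u..v}. X k x \<le> c x) \<or> (\<forall>x\<in>{u..v}. c x \<le> X k x)"
    using branch k unfolding branch_def by blast
  have "\<exists>\<alpha>\<in>{a, b}. \<exists>\<alpha>'\<in>{a', b'}. (X k a \<le> c \<alpha> \<and> X k b \<le> c \<alpha> \<and> X k a' \<le> c \<alpha>' \<and> X k b' \<le> c \<alpha>') \<or>
        (c \<alpha> \<le> X k a \<and> c \<alpha> \<le> X k b \<and> c \<alpha>' \<le> X k a' \<and> c \<alpha>' \<le> X k b')"
    using sides
  proof
    assume "\<forall>x\<in>{u..v}. X k x \<le> c x"
    with pick_param(1)[of "X k a" a "X k b" b] pick_param(1)[of "X k a'" a' "X k b'" b'] ab ab' show ?thesis by meson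
  next
    assume "\<forall>x\<in>{u..v}. c x \<le> X k x"
    with pick_param(2)[of a "X k a" b "X k b"] pick_param(2)[of a' "X k a'" b' "X k b'"] ab ab' show ?thesis by meson
  qed
  then obtain \<alpha> \<alpha>' where al: "\<alpha> = a \<or> \<alpha> = b" and al': "\<alpha>' = a' \<or> \<alpha>' = b'"
    and same: "(X k a \<le> c \<alpha> \<and> X k b \<le> c \<alpha> \<and> X k a' \<le> c \<alpha>' \<and> X k b' \<le> c \<alpha>') \<or>
        (c \<alpha> \<le> X k a \<and> c \<alpha> \<le> X k b \<and> c \<alpha>' \<le> X k a' \<and> c \<alpha>' \<le> X k b')" by blast
  have aluv: "\<alpha> \<in> {u..v}" "\<alpha>' \<in> {u..v}" using al al' ab ab' by auto
  have alJ: "\<alpha> \<in> {p..q}" "\<alpha>' \<in> {p..q}" using aluv branch_in[OF branch] by blast+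
  define d d' t t' where "d = \<bar>X k a - X k b\<bar>" and "d' = \<bar>X k a' - X k b'\<bar>"
    and "t = \<bar>T \<alpha> (X k a) - T \<alpha> (X k b)\<bar>" and "t' = \<bar>T \<alpha>' (X k a') - T \<alpha>' (X k b')\<bar>"
  note defs = d_def d'_def t_def t'_def
  have tt: "t * d' \<le> (1 + H * w) * (t' * d)" unfolding defs
    by (rule T_distortion[OF alJ X_range[OF inJ(1)] X_range[OF inJ(2)] X_range[OF inJ(3)]
          X_range[OF inJ(4)] same])
      (use Xw ab ab' aluv in auto)
  have "lam * d \<le> t" unfolding defs
    using same by (intro T_expand alJ X_range inJ) auto
  moreover have "d \<le> lam * d" unfolding defs using lam by (simp add: mult_le_cancel_right1)
  ultimately have dt: "d \<le> t" by simp
  have A1: "\<bar>X (Suc k) a - X (Suc k) b\<bar> \<le> (1 + y) * t"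
    using two_point_compare(1)[OF inJ(1,2) X_range[OF inJ(1)] X_range[OF inJ(2)] al, of k k] Ke[OF ab, of k] mult_left_mono[OF dt y0] k
    by (simp add: defs X_Suc algebra_simps)
  have A2: "t' \<le> (1 + y) * \<bar>X (Suc k) a' - X (Suc k) b'\<bar>"
    using two_point_compare(2)[OF inJ(3,4) X_range[OF inJ(3)] X_range[OF inJ(4)] al', of k k] Ke[OF ab', of "Suc k"] k
    by (simp add: defs X_Suc algebra_simps)
  have "s0 * \<bar>a' - b'\<bar> \<le> d'"
    using slope_lower[OF branch_mono[OF branch] ab', of k] k by (simp add: defs)
  moreover have "0 < s0 * \<bar>a' - b'\<bar>" using s0_pos False by simp
  ultimately have d'0: "0 < d'" by linarith
  let ?e = "\<bar>a - b\<bar>" and ?e' = "\<bar>a' - b'\<bar>" and ?x' = "\<bar>X (Suc k) a' - X (Suc k) b'\<bar>"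
  have t0: "0 \<le> t" "0 \<le> t'" by (simp_all add: defs)
  \<comment> \<open>Quotients are compared without division: multiply by \<open>d' > 0\<close>, use
    \<open>T_distortion\<close> and the bound at time \<open>k\<close>, and cancel.\<close>
  have "(t * ?e') * d' \<le> ((1 + H * w) * t' * E * ?e) * d'"
  proof -
    have "(t * ?e') * d' = (t * d') * ?e'" by simp
    also have "\<dots> \<le> (1 + H * w) * (t' * d) * ?e'" by (intro mult_right_mono tt) simp
    also have "\<dots> = (1 + H * w) * t' * (d * ?e')" by simp
    also have "\<dots> \<le> (1 + H * w) * t' * (E * (d' * ?e))"
      using E(1) t0 H w0 by (intro mult_left_mono) (auto simp: defs)
    finally show ?thesis by (simp add: algebra_simps)
  qed
  hence B: "t * ?e' \<le> (1 + H * w) * t' * E * ?e" using d'0 by simp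
  have "\<bar>X (Suc k) a - X (Suc k) b\<bar> * ?e' \<le> (1 + y) * t * ?e'" by (intro mult_right_mono A1) simp
  also have "\<dots> \<le> (1 + y) * ((1 + H * w) * t' * E * ?e)"
    using B y0 by (simp add: mult.assoc mult_left_mono)
  also have "\<dots> = (1 + y) * (1 + H * w) * E * ?e * t'" by simp
  also have "\<dots> \<le> (1 + y) * (1 + H * w) * E * ?e * ((1 + y) * ?x')"
    using y0 H w0 E(2) by (intro mult_left_mono A2) auto
  also have "\<dots> = ((1 + y) * (1 + y) * (1 + H * w)) * (E * (?x' * ?e))" by simp
  also have "\<dots> \<le> (exp y * exp y * exp (H * w)) * (E * (?x' * ?e))"
    using y0 H w0 E(2) by (intro mult_right_mono mult_mono) (auto simp: add.commute)
  also have "exp y * exp y * exp (H * w) = exp (2 * K / (growth_const * s0) * (1 / lam) ^ k +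
      H * (1 + 1 / s0) / growth_const * (1 / lam) ^ (n - k))"
    by (simp add: y_def w_def mult.assoc mult.commute[of s0] flip: exp_add)
  finally show ?thesis by (simp add: algebra_simps)
qed

lemma Q0_ge: "s0 \<le> Q0"
proof -
  have "s0 * (q - p) \<le> Q0 * (q - p)"
    using order_trans[OF X0_lower[of q p] X0_upper[of q p]] p_less_q by simp
  thus ?thesis using p_less_q by (simp only: mult_le_cancel_right_pos diff_gt_0_iff_gt)
qed

lemma dist_const_ge1: "1 \<le> dist_const"
proof -
  have "1 \<le> Q0 / s0" using Q0_ge s0_pos by simp
  moreover have "0 \<le> (2 * K / (growth_const * s0) + H * (1 + 1 / s0) / growth_const) / (1 - 1 / lam)"
    using K H growth_const_pos s0_pos lam by (intro divide_nonneg_nonneg add_nonneg_nonneg mult_nonneg_nonneg) auto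
  ultimately have "1 * 1 \<le> dist_const" unfolding dist_const_def by (intro mult_mono) auto
  thus ?thesis by simp
qed

text \<open>The factors of \<open>distortion_step\<close> are multiplied over the times
  \<open>k \<le> n\<close> of one branch. Their second term comes from the image at the final time,
  so \<open>n\<close> stays fixed in the induction.\<close>

lemma distortion:
  assumes branch: "branch n u v"
    and ab: "a \<in> {u..v}" "b \<in> {u..v}" and ab': "a' \<in> {u..v}" "b' \<in> {u..v}"
  shows "\<bar>X n a - X n b\<bar> * \<bar>a' - b'\<bar> \<le> dist_const * (\<bar>X n a' - X n b'\<bar> * \<bar>a - b\<bar>)"
proof -
  define A B where "A = 2 * K / (growth_const * s0)" and "B = H * (1 + 1 / s0) / growth_const"
  have AB: "0 \<le> A" "0 \<le> B" using K H growth_const_pos s0_pos by (auto simp: A_def B_def)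
  define e where "e = (\<lambda>i. A * (1 / lam) ^ i + B * (1 / lam) ^ (n - i))"
  have "\<bar>X k a - X k b\<bar> * \<bar>a' - b'\<bar> \<le> Q0 / s0 * exp (\<Sum>i<k. e i) * (\<bar>X k a' - X k b'\<bar> * \<bar>a - b\<bar>)"
    if "k \<le> n" for k
    using that
  proof (induction k)
    case 0
    have inJ: "a \<in> {p..q}" "b \<in> {p..q}" "a' \<in> {p..q}" "b' \<in> {p..q}"
      using branch_in[OF branch] ab ab' by blast+
    have "\<bar>X 0 a - X 0 b\<bar> * \<bar>a' - b'\<bar> \<le> (Q0 * \<bar>a - b\<bar>) * (\<bar>X 0 a' - X 0 b'\<bar> / s0)"
      using X0_upper[OF inJ(1,2)] X0_lower[OF inJ(3,4)] s0_pos Q0_ge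
      by (intro mult_mono) (auto simp: field_simps)
    thus ?case by (simp add: field_simps)
  next
    case (Suc k)
    have "0 \<le> Q0 / s0 * exp (\<Sum>i<k. e i)" using s0_pos Q0_ge by simp
    from distortion_step[OF branch _ ab ab' Suc.IH this] Suc.prems
    show ?case by (simp add: e_def A_def B_def exp_add mult.assoc)
  qed
  from this[of n] have 1: "\<bar>X n a - X n b\<bar> * \<bar>a' - b'\<bar> \<le>
      Q0 / s0 * exp (\<Sum>i<n. e i) * (\<bar>X n a' - X n b'\<bar> * \<bar>a - b\<bar>)" by simp
  have l: "0 < 1 / lam" "1 / lam < 1" using lam by auto
  have "(\<Sum>i<n. e i) = A * (\<Sum>i<n. (1 / lam) ^ i) + B * (\<Sum>i<n. (1 / lam) ^ (n - i))"
    unfolding e_def by (simp add: sum.distrib sum_distrib_left)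
  also have "\<dots> \<le> A * (1 / (1 - 1 / lam)) + B * (1 / (1 - 1 / lam))"
    using AB geometric_bounds[OF l] by (intro add_mono mult_left_mono) auto
  also have "\<dots> = (A + B) / (1 - 1 / lam)" by (simp add: add_divide_distrib)
  finally have "Q0 / s0 * exp (\<Sum>i<n. e i) \<le> dist_const"
    unfolding dist_const_def A_def[symmetric] B_def[symmetric] using s0_pos Q0_ge by (intro mult_left_mono) auto
  from mult_right_mono[OF this, of "\<bar>X n a' - X n b'\<bar> * \<bar>a - b\<bar>"] 1 show ?thesis by simp
qed

section \<open>Inverse slopes and tilings by branches\<close>

lemma X_diff_pos: "branch n u v \<Longrightarrow> 0 < \<bar>X n v - X n u\<bar>"
proof -
  assume branch: "branch n u v"
  hence "u < v" by (simp add: branch_def)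
  with slope_lower[OF branch, of v u] s0_pos show ?thesis
    by (smt (verit, best) mult_pos_pos atLeastAtMost_iff)
qed

lemma inv_slope_pos: "branch n u v \<Longrightarrow> 0 < inv_slope n u v"
  using X_diff_pos unfolding inv_slope_def branch_def by simp

lemma inv_slope_mult: "branch n u v \<Longrightarrow> inv_slope n u v * \<bar>X n v - X n u\<bar> = v - u"
  using X_diff_pos unfolding inv_slope_def by fastforce

text \<open>Distortion against the endpoints: on a branch every difference quotient agrees with the
  mean one up to \<open>dist_const\<close>. The next lemma is the opposite bound.\<close>

lemma len_le_inv_slope:
  assumes "branch n u v" "a \<in> {u..v}" "b \<in> {u..v}"
  shows "\<bar>a - b\<bar> \<le> dist_const * inv_slope n u v * \<bar>X n a - X n b\<bar>"
proof -
  have uv: "u < v" "v \<in> {u..v}" "u \<in> {u..v}" using assms(1) by (auto simp: branch_def)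
  have "\<bar>X n v - X n u\<bar> * \<bar>a - b\<bar> \<le> dist_const * (\<bar>X n a - X n b\<bar> * \<bar>v - u\<bar>)"
    by (rule distortion[OF assms(1) uv(2,3) assms(2,3)])
  thus ?thesis using X_diff_pos[OF assms(1)] uv(1)
    by (simp add: inv_slope_def field_simps)
qed

lemma X_lip_inv_slope:
  assumes "branch n u v" "a \<in> {u..v}" "b \<in> {u..v}"
  shows "\<bar>X n a - X n b\<bar> \<le> dist_const / inv_slope n u v * \<bar>a - b\<bar>"
proof -
  have uv: "u < v" "v \<in> {u..v}" "u \<in> {u..v}" using assms(1) by (auto simp: branch_def)
  have "\<bar>X n a - X n b\<bar> * \<bar>v - u\<bar> \<le> dist_const * (\<bar>X n v - X n u\<bar> * \<bar>a - b\<bar>)"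
    by (rule distortion[OF assms uv(2,3)])
  thus ?thesis using X_diff_pos[OF assms(1)] uv(1)
    by (simp add: inv_slope_def field_simps)
qed

text \<open>Passing to the smaller interval costs one distortion factor at time \<open>n\<close>;
  the further \<open>m\<close> steps gain \<open>lam ^ m\<close> by \<open>growth\<close>.\<close>

lemma inv_slope_child:
  assumes branch: "branch n u v" and branch': "branch (n + m) u' v'" and sub: "u \<le> u'" "v' \<le> v"
  shows "inv_slope (n + m) u' v' \<le> dist_const / (growth_const * lam ^ m) * inv_slope n u v"
proof -
  have uv: "u' < v'" using branch' by (simp add: branch_def)
  have "growth_const * lam ^ m * \<bar>X n v' - X n u'\<bar> \<le> \<bar>X (n + m) v' - X (n + m) u'\<bar>"
    using growth[OF branch', of v' u'] uv by simp
  hence "dist_const * inv_slope n u v * (growth_const * lam ^ m * \<bar>X n v' - X n u'\<bar>)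
     \<le> dist_const * inv_slope n u v * \<bar>X (n + m) v' - X (n + m) u'\<bar>"
    using dist_const_ge1 inv_slope_pos[OF branch] by (intro mult_left_mono) auto
  moreover have "(v' - u') * (growth_const * lam ^ m) \<le> dist_const * inv_slope n u v * \<bar>X n v' - X n u'\<bar> * (growth_const * lam ^ m)"
    using len_le_inv_slope[OF branch, of v' u'] uv sub growth_const_pos lam by (intro mult_right_mono) auto
  ultimately have "(v' - u') * (growth_const * lam ^ m) \<le> dist_const * inv_slope n u v * \<bar>X (n + m) v' - X (n + m) u'\<bar>"
    by (simp add: algebra_simps)
  hence "v' - u' \<le> dist_const * inv_slope n u v * \<bar>X (n + m) v' - X (n + m) u'\<bar> / (growth_const * lam ^ m)"
    using growth_const_pos lam by (simp only: pos_le_divide_eq mult_pos_pos zero_less_power less_trans[OF zero_less_one])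
  hence "inv_slope (n + m) u' v' \<le> dist_const * inv_slope n u v / (growth_const * lam ^ m)"
    unfolding inv_slope_def[of "n + m"] using X_diff_pos[OF branch']
    by (simp only: pos_divide_le_eq times_divide_eq_left)
  thus ?thesis by simp
qed

text \<open>A finite splitting of \<open>{u..v}\<close> into branches at time \<open>m\<close>, with
  \<open>S\<close> bounding the sum of their inverse slopes. Only this bound is recorded, not the
  pieces, so that estimates over all pieces become rule inductions.\<close>

inductive tiling :: "nat \<Rightarrow> real \<Rightarrow> real \<Rightarrow> real \<Rightarrow> bool" for m where
  single: "branch m u v \<Longrightarrow> inv_slope m u v \<le> S \<Longrightarrow> tiling m u v S"
| concat: "tiling m u z S \<Longrightarrow> tiling m z v S' \<Longrightarrow> tiling m u v (S + S')"

lemma tiling_mono: "tiling m u v S \<Longrightarrow> S \<le> S' \<Longrightarrow> tiling m u v S'"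
proof (induction arbitrary: S' rule: tiling.induct)
  case (concat u z S v S1)
  from concat.IH(2)[of "S' - S"] concat.prems have "tiling m z v (S' - S)" by simp
  from tiling.concat[OF concat.hyps(1) this] show ?case by simp
qed (auto intro: tiling.single)

lemma tiling_trans:
  assumes "tiling m u v S" "0 \<le> th"
    and "\<And>u v. branch m u v \<Longrightarrow> tiling m' u v (th * inv_slope m u v + C * (v - u))"
  shows "tiling m' u v (th * S + C * (v - u))"
  using assms(1)
proof (induction rule: tiling.induct)
  case (single u v S)
  show ?case
    by (rule tiling_mono[OF assms(3)[OF single(1)]]) (use single assms(2) in \<open>simp add: mult_left_mono\<close>)
next
  case (concat u z S v S')
  from tiling.concat[OF concat.IH] show ?case by (simp add: algebra_simps)
qed

lemma tiling_less: "tiling m u v S \<Longrightarrow> u < v \<and> p \<le> u \<and> v \<le> q"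
  by (induction rule: tiling.induct) (auto simp: branch_def)

text \<open>The way to sum over the pieces: \<open>F\<close> will be an integral or a negated
  measure, additive over adjacent intervals, and a bound per branch that is linear in length and
  inverse slope adds up.\<close>

lemma tiling_superadditive:
  assumes "tiling m u v S"
    and "\<And>u z v. p \<le> u \<Longrightarrow> u < z \<Longrightarrow> z < v \<Longrightarrow> v \<le> q \<Longrightarrow> (F u v::real) = F u z + F z v"
    and "\<And>u v. branch m u v \<Longrightarrow> F u v \<le> A * (v - u) + B * inv_slope m u v" "0 \<le> B"
  shows "F u v \<le> A * (v - u) + B * S"
  using assms(1)
proof (induction rule: tiling.induct)
  case (single u v S)
  then show ?case using assms(3)[OF single(1)] mult_left_mono[OF single(2) assms(4)] by linarith
next
  case (concat u z S v S')
  with tiling_less[OF concat.hyps(1)] tiling_less[OF concat.hyps(2)] show ?case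
    by (simp add: assms(2)[of u z v] algebra_simps)
qed

text \<open>\<open>X n\<close> has slope at least \<open>s0\<close>, while \<open>c\<close> has
  Lipschitz constant \<open>K / lam \<le> K / (lam - 1) < s0\<close>; so within a branch the curve
  meets the turning point at most once.\<close>

lemma one_step:
  assumes "branch n u v"
  shows "branch (Suc n) u v \<or> (\<exists>z\<in>{u<..<v}. X n z = c z \<and> branch (Suc n) u z \<and> branch (Suc n) z v)"
proof -
  define f where "f a = X n a - c a" for a
  have uv: "p \<le> u" "u < v" "v \<le> q" using assms by (auto simp: branch_def)
  have Ks: "K / lam < s0"
  proof -
    have "K / lam \<le> K / (lam - 1)" using K lam by (simp add: frac_le)
    thus ?thesis using s0 by simp
  qed
  have inj: "a = b" if "f a = 0" "f b = 0" "a \<in> {u..v}" "b \<in> {u..v}" for a b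
  proof (rule ccontr)
    assume "a \<noteq> b"
    have "s0 * \<bar>a - b\<bar> \<le> \<bar>X n a - X n b\<bar>" by (rule slope_lower[OF assms that(3,4)])
    also have "\<dots> = \<bar>c a - c b\<bar>" using that by (simp add: f_def)
    also have "\<dots> \<le> K / lam * \<bar>a - b\<bar>" using c_lip branch_in[OF assms] that by blast
    finally have "s0 * \<bar>a - b\<bar> \<le> K / lam * \<bar>a - b\<bar>" .
    hence "s0 \<le> K / lam" using \<open>a \<noteq> b\<close> by (simp only: mult_le_cancel_right_pos zero_less_abs_iff right_minus_eq not_False_eq_True)
    thus False using Ks by simp
  qed
  have cont: "continuous_on {p..q} f" unfolding f_def by (intro continuous_on_diff continuous_X continuous_c)
  have side: "(\<forall>a\<in>{x..y}. f a \<le> 0) \<or> (\<forall>a\<in>{x..y}. 0 \<le> f a)"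
    if "u \<le> x" "y \<le> v" "\<forall>a\<in>{x<..<y}. f a \<noteq> 0" for x y
  proof (rule ccontr)
    assume "\<not> ?thesis"
    then obtain a b where ab: "a \<in> {x..y}" "b \<in> {x..y}" "f a > 0" "f b < 0" by force
    define s t where "s = min a b" and "t = max a b"
    have "\<exists>z\<in>{s<..<t}. f z = 0"
    proof -
      have co: "continuous_on {s..t} f"
        using ab that uv by (intro continuous_on_subset[OF cont]) (auto simp: s_def t_def)
      have ne: "a \<noteq> b" using ab by auto
      show ?thesis
      proof (cases "a < b")
        case True
        hence st: "s = a" "t = b" by (auto simp: s_def t_def)
        obtain z where "s \<le> z" "z \<le> t" "f z = 0"
          using IVT2'[of f t 0 s] co ab st True by auto
        thus ?thesis using ab st by (intro bexI[of _ z]) (auto simp: less_le)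
      next
        case False
        hence st: "s = b" "t = a" using ne by (auto simp: s_def t_def)
        obtain z where "s \<le> z" "z \<le> t" "f z = 0"
          using IVT'[of f s 0 t] co ab st False by auto
        thus ?thesis using ab st by (intro bexI[of _ z]) (auto simp: less_le)
      qed
    qed
    then obtain z where "z \<in> {s<..<t}" "f z = 0" by blast
    moreover have "x \<le> s" "t \<le> y" using ab by (auto simp: s_def t_def)
    ultimately show False using that(3) by auto
  qed
  have admI: "branch (Suc n) x y" if "u \<le> x" "x < y" "y \<le> v" "\<forall>a\<in>{x<..<y}. f a \<noteq> 0" for x y
    using branch_sub[OF assms that(1-3)] side[OF that(1,3,4)]
    unfolding branch_def f_def by (auto simp: less_Suc_eq)
  show ?thesis
  proof (cases "\<exists>z\<in>{u<..<v}. f z = 0")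
    case False thus ?thesis using admI[of u v] uv by auto
  next
    case True
    then obtain z where z: "z \<in> {u<..<v}" "f z = 0" by blast
    have "\<forall>a\<in>{u<..<z}. f a \<noteq> 0" "\<forall>a\<in>{z<..<v}. f a \<noteq> 0" using inj[OF _ z(2)] z(1) by fastforce+
    thus ?thesis using admI[of u z] admI[of z v] z by (auto simp: f_def)
  qed
qed

text \<open>Each step at most doubles the number of pieces, and every final piece is compared with
  the original branch directly, so that the distortion constant enters once and not once per
  step.\<close>

lemma tiling_count:
  assumes "branch n u v" "j \<le> m" "branch (n + j) u' v'" "u \<le> u'" "v' \<le> v"
  shows "tiling (n + m) u' v' (2 ^ (m - j) * (dist_const / (growth_const * lam ^ m) * inv_slope n u v))"
  using assms(2-)
proof (induction "m - j" arbitrary: j u' v')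
  case 0
  hence [simp]: "j = m" by simp
  have "inv_slope (n + m) u' v' \<le> dist_const / (growth_const * lam ^ m) * inv_slope n u v"
    using 0 by (intro inv_slope_child[OF assms(1)]) auto
  thus ?case using 0 by (auto intro!: tiling.single)
next
  case (Suc k)
  let ?s = "dist_const / (growth_const * lam ^ m) * inv_slope n u v"
  have s: "0 \<le> ?s" using dist_const_ge1 growth_const_pos lam inv_slope_pos[OF assms(1)] by simp
  have k: "k = m - Suc j" "m - j = Suc k" "Suc j \<le> m" using Suc by auto
  from one_step[OF Suc.prems(2)] show ?case
  proof (elim disjE bexE conjE)
    assume "branch (Suc (n + j)) u' v'"
    with Suc.hyps(1)[OF k(1,3) _ Suc.prems(3,4)] have "tiling (n + m) u' v' (2 ^ (m - Suc j) * ?s)" by simp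
    thus ?case
      by (rule tiling_mono) (use s in \<open>intro mult_right_mono power_increasing; simp\<close>)
  next
    fix z assume z: "z \<in> {u'<..<v'}" "branch (Suc (n + j)) u' z" "branch (Suc (n + j)) z v'"
    have "tiling (n + m) u' z (2 ^ (m - Suc j) * ?s)" "tiling (n + m) z v' (2 ^ (m - Suc j) * ?s)"
      using Suc.hyps(1)[OF k(1,3), of u' z] Suc.hyps(1)[OF k(1,3), of z v'] z Suc.prems by auto
    from tiling.concat[OF this] show ?case unfolding k(1)[symmetric] k(2)
      by (simp only: power_Suc mult_2 distrib_right)
  qed
qed

end

text \<open>The 4 leaves a factor 1/2 when a branch splits in two during \<open>N\<close> steps:
  each piece has at most a quarter of the inverse slope.\<close>

locale nonrecurrent_curve = expanding_curve +
  fixes N :: nat and \<eta> :: real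
  assumes N_large: "4 * dist_const \<le> growth_const * lam ^ N"
    and eta_pos: "0 < \<eta>"
    and nonrec: "a \<in> {p..q} \<Longrightarrow> 1 \<le> j \<Longrightarrow> j \<le> N \<Longrightarrow> \<eta> \<le> \<bar>(T a ^^ j) (c a) - c a\<bar>"
begin

section \<open>At most one cut of a short image in \<open>N\<close> steps\<close>

lemma X_add: "X (n + i) b = (T b ^^ i) (X n b)"
  by (induction i) (simp_all add: X_Suc)

lemma funpow_lip:
  assumes "a \<in> {p..q}" "x \<in> {0..1}" "y \<in> {0..1}"
  shows "(T a ^^ i) x \<in> {0..1}" "\<bar>(T a ^^ i) x - (T a ^^ i) y\<bar> \<le> Lam ^ i * \<bar>x - y\<bar>"
proof -
  have r: "(T a ^^ i) z \<in> {0..1}" if "z \<in> {0..1}" for i z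
    using that T_range[OF assms(1)] by (induction i) auto
  show "(T a ^^ i) x \<in> {0..1}" using r assms(2) .
  show "\<bar>(T a ^^ i) x - (T a ^^ i) y\<bar> \<le> Lam ^ i * \<bar>x - y\<bar>"
  proof (induction i)
    case (Suc i)
    have "\<bar>(T a ^^ Suc i) x - (T a ^^ Suc i) y\<bar> \<le> Lam * \<bar>(T a ^^ i) x - (T a ^^ i) y\<bar>"
      using T_lip[OF assms(1) r[OF assms(2)] r[OF assms(3)]] by simp
    also have "\<dots> \<le> Lam * (Lam ^ i * \<bar>x - y\<bar>)" using Suc Lam by (rule mult_left_mono)
    finally show ?case by simp
  qed simp
qed

definition growth_bound :: real where "growth_bound = (Lam + K + 1) ^ N"

text \<open>Solved from the estimate in \<open>no_recut\<close>. The last factor bounds the spread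
  of the branch at the time of the cut, the other one its effect on the return of the turning point,
  and the result is \<open>\<eta> / 2\<close>.\<close>

definition short_len :: real where "short_len = \<eta> / (2 * (growth_bound * (1 + K / lam)) * (growth_bound * (dist_const + 1 / s0)))"

lemma growth_bound_ge1: "1 \<le> growth_bound"
  using Lam K by (simp add: growth_bound_def one_le_power)

lemma growth_bound_ge: "i \<le> N \<Longrightarrow> (Lam + K + 1) ^ i \<le> growth_bound"
  using Lam K by (simp add: growth_bound_def power_increasing)

lemma short_len_pos: "0 < short_len"
  using eta_pos growth_bound_ge1 K lam dist_const_ge1 s0_pos unfolding short_len_def
  by (intro divide_pos_pos mult_pos_pos add_pos_nonneg add_pos_pos) auto

text \<open>After a cut at the turning point, short pieces follow the orbit of the turning point, which
  stays away from the turning point for \<open>N\<close> steps.\<close>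

lemma no_recut:
  assumes branch: "branch n u v" and short: "\<bar>X n v - X n u\<bar> \<le> short_len"
    and j: "j \<le> N" and zb: "z \<in> {u..v}" "b \<in> {u..v}" and z: "X (n + j) z = c z"
    and i: "1 \<le> i" "i \<le> N"
  shows "X (n + j + i) b \<noteq> c b"
proof
  assume *: "X (n + j + i) b = c b"
  \<comment> \<open>\<open>e\<close> bounds the distance of \<open>b\<close> from the cut parameter
    \<open>z\<close> plus that of their images at time \<open>n + j\<close>.\<close>
  define e where "e = growth_bound * (dist_const + 1 / s0) * short_len"
  have uv: "u < v" using branch by (simp add: branch_def)
  have J: "z \<in> {p..q}" "b \<in> {p..q}" using branch_in[OF branch] zb by blast+
  have l1: "\<bar>b - z\<bar> \<le> v - u" using zb by auto
  have "s0 * \<bar>v - u\<bar> \<le> \<bar>X n v - X n u\<bar>" using slope_lower[OF branch, of v u] uv by simp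
  hence l2: "v - u \<le> 1 / s0 * short_len" using short s0_pos uv by (simp add: field_simps)
  have "\<bar>X n b - X n z\<bar> * \<bar>v - u\<bar> \<le> dist_const * (\<bar>X n v - X n u\<bar> * \<bar>b - z\<bar>)"
    using distortion[OF branch zb(2,1), of v u] uv by simp
  also have "\<dots> \<le> dist_const * (\<bar>X n v - X n u\<bar> * \<bar>v - u\<bar>)"
    using l1 dist_const_ge1 by (intro mult_left_mono) auto
  finally have "\<bar>X n b - X n z\<bar> * \<bar>v - u\<bar> \<le> (dist_const * \<bar>X n v - X n u\<bar>) * \<bar>v - u\<bar>" by simp
  moreover have "0 < \<bar>v - u\<bar>" using uv by simp
  ultimately have "\<bar>X n b - X n z\<bar> \<le> dist_const * \<bar>X n v - X n u\<bar>" by (simp only: mult_le_cancel_right_pos)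
  also have "\<dots> \<le> dist_const * short_len" using short dist_const_ge1 by (intro mult_left_mono) auto
  finally have "\<bar>X n b - X n z\<bar> + \<bar>b - z\<bar> \<le> (dist_const + 1 / s0) * short_len"
    using l1 l2 by (simp add: algebra_simps)
  hence "(Lam + K + 1) ^ j * (\<bar>X n b - X n z\<bar> + \<bar>b - z\<bar>) \<le> growth_bound * ((dist_const + 1 / s0) * short_len)"
    using growth_bound_ge[OF j] growth_bound_ge1 by (intro mult_mono) auto
  with upper[OF J(2,1), of n j] have e: "\<bar>X (n + j) b - X (n + j) z\<bar> + \<bar>b - z\<bar> \<le> e"
    unfolding e_def by (simp only: mult.assoc)
  have e0: "0 \<le> e" using e by linarith
  have "\<bar>X (n + j) b - c b\<bar> \<le> \<bar>X (n + j) b - X (n + j) z\<bar> + \<bar>c z - c b\<bar>" using z by simp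
  also have "\<bar>c z - c b\<bar> \<le> K / lam * \<bar>z - b\<bar>" by (rule c_lip[OF J])
  also have "\<dots> \<le> K / lam * e" using e K lam by (intro mult_left_mono) auto
  finally have 1: "\<bar>X (n + j) b - c b\<bar> \<le> (1 + K / lam) * e" using e by (simp add: algebra_simps)
  \<comment> \<open>At the parameter \<open>b\<close> the curve is close to \<open>c b\<close> at
    time \<open>n + j\<close> and equal to \<open>c b\<close> at time \<open>n + j + i\<close>; so
    \<open>T b ^^ i\<close> would bring \<open>c b\<close> back to within \<open>\<eta> / 2\<close>
    of itself.\<close>
  have "\<eta> \<le> \<bar>(T b ^^ i) (c b) - c b\<bar>" by (rule nonrec[OF J(2) i])
  also have "\<dots> = \<bar>(T b ^^ i) (X (n + j) b) - (T b ^^ i) (c b)\<bar>" using * by (simp add: X_add)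
  also have "\<dots> \<le> Lam ^ i * \<bar>X (n + j) b - c b\<bar>"
    by (rule funpow_lip(2)[OF J(2) X_range[OF J(2)] c_range[OF J(2)]])
  also have "\<dots> \<le> growth_bound * ((1 + K / lam) * e)"
  proof (rule mult_mono[OF _ 1])
    have "Lam ^ i \<le> (Lam + K + 1) ^ i" using Lam K by (intro power_mono) auto
    thus "Lam ^ i \<le> growth_bound" using growth_bound_ge[OF i(2)] by simp
  qed (use growth_bound_ge1 in auto)
  also have "\<dots> = \<eta> / 2"
  proof -
    have "growth_bound * (1 + K / lam) \<noteq> 0" "growth_bound * (dist_const + 1 / s0) \<noteq> 0"
      using growth_bound_ge1 K lam dist_const_ge1 s0_pos by (auto simp: add_nonneg_eq_0_iff)
    hence "2 * (growth_bound * (1 + K / lam)) * (growth_bound * (dist_const + 1 / s0)) \<noteq> 0" by simp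
    hence "2 * (growth_bound * (1 + K / lam)) * (growth_bound * (dist_const + 1 / s0)) * short_len = \<eta>"
      unfolding short_len_def times_divide_eq_right by (rule nonzero_mult_div_cancel_left)
    thus ?thesis unfolding e_def by (simp add: mult_ac)
  qed
  finally show False using eta_pos by simp
qed

lemma uncut:
  assumes branch: "branch n u v" and short: "\<bar>X n v - X n u\<bar> \<le> short_len"
    and j: "j < N" and z: "z \<in> {u..v}" "X (n + j) z = c z"
    and branch': "branch (Suc (n + j)) u' v'" and sub: "u \<le> u'" "v' \<le> v"
  shows "branch (n + N) u' v'"
proof -
  have "branch (n + i) u' v'" if "Suc j \<le> i" "i \<le> N" for i
    using that
  proof (induction i rule: dec_induct)
    case base thus ?case using branch' by simp
  next
    case (step i)
    have "X (n + i) b \<noteq> c b" if "b \<in> {u'<..<v'}" for b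
      using no_recut[OF branch short _ z(1) _ z(2), of b "i - j"] that sub step j by auto
    thus ?case using one_step[of "n + i" u' v'] step by auto
  qed
  thus ?thesis using j by simp
qed

text \<open>Up to the first cut the piece stays whole, and after it \<open>uncut\<close> keeps both
  halves whole up to time \<open>n + N\<close>. Hence there are at most two pieces.\<close>

lemma tiling_short:
  assumes branch: "branch n u v" and short: "\<bar>X n v - X n u\<bar> \<le> short_len"
    and "j \<le> N" "branch (n + j) u' v'" "u \<le> u'" "v' \<le> v"
  shows "tiling (n + N) u' v' (2 * (dist_const / (growth_const * lam ^ N) * inv_slope n u v))"
  using assms(3-)
proof (induction "N - j" arbitrary: j)
  case 0
  hence "j = N" by simp
  with tiling_count[OF branch 0(2,3,4,5)] 0 have "tiling (n + N) u' v' (dist_const / (growth_const * lam ^ N) * inv_slope n u v)" by simp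
  moreover have "0 \<le> dist_const / (growth_const * lam ^ N) * inv_slope n u v"
    using dist_const_ge1 growth_const_pos lam inv_slope_pos[OF branch] by simp
  ultimately show ?case by (elim tiling_mono) linarith
next
  case (Suc k)
  let ?s = "dist_const / (growth_const * lam ^ N) * inv_slope n u v"
  have k: "k = N - Suc j" "Suc j \<le> N" using Suc by auto
  have s: "0 \<le> ?s" using dist_const_ge1 growth_const_pos lam inv_slope_pos[OF branch] by simp
  from one_step[OF Suc.prems(2)] show ?case
  proof (elim disjE bexE conjE)
    assume "branch (Suc (n + j)) u' v'"
    thus ?case using Suc.hyps(1)[OF k] Suc.prems by simp
  next
    fix z assume z: "z \<in> {u'<..<v'}" "X (n + j) z = c z"
      "branch (Suc (n + j)) u' z" "branch (Suc (n + j)) z v'"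
    have jN: "j < N" and zuv: "z \<in> {u..v}" using k z Suc.prems by auto
    note un = uncut[OF branch short jN zuv z(2)]
    have *: "branch (n + N) u' z" "branch (n + N) z v'"
      using un[OF z(3)] un[OF z(4)] z(1) Suc.prems by auto
    have "inv_slope (n + N) u' z \<le> ?s" "inv_slope (n + N) z v' \<le> ?s"
      using inv_slope_child[OF branch *(1)] inv_slope_child[OF branch *(2)] z(1) Suc.prems by auto
    from tiling.concat[OF tiling.single[OF *(1) this(1)] tiling.single[OF *(2) this(2)]]
    show ?case by (simp only: mult_2)
  qed
qed

text \<open>The price per unit length of cutting a branch with long image: \<open>2 ^ N\<close>
  possible pieces, and an inverse slope of at most length over \<open>short_len\<close>.\<close>

definition tile_const :: real where "tile_const = 2 ^ N * (dist_const / (growth_const * lam ^ N)) / short_len"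

lemma tile_const_pos: "0 < tile_const"
  using dist_const_ge1 growth_const_pos lam short_len_pos by (simp add: tile_const_def)

text \<open>A short image gives two pieces of at most a quarter each. For a long one the inverse
  slope is already controlled by the length, which pays for the crude count. The shape, a
  contraction plus a lower-order term, is that of a Lasota--Yorke inequality.\<close>

lemma tiling_N:
  assumes branch: "branch n u v"
  shows "tiling (n + N) u v (1 / 2 * inv_slope n u v + tile_const * (v - u))"
proof (cases "\<bar>X n v - X n u\<bar> \<le> short_len")
  case True
  have "tiling (n + N) u v (2 * (dist_const / (growth_const * lam ^ N) * inv_slope n u v))"
    using tiling_short[OF branch True, of 0 u v] branch by simp
  moreover have "dist_const / (growth_const * lam ^ N) \<le> 1 / 4"
    using N_large growth_const_pos lam by (simp add: field_simps)
  hence "dist_const / (growth_const * lam ^ N) * inv_slope n u v \<le> 1 / 4 * inv_slope n u v"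
    using inv_slope_pos[OF branch] by (intro mult_right_mono) auto
  moreover have "0 \<le> tile_const * (v - u)" using tile_const_pos branch by (simp add: branch_def)
  ultimately show ?thesis by (elim tiling_mono) linarith
next
  case False
  have uv: "u < v" using branch by (simp add: branch_def)
  have "inv_slope n u v \<le> (v - u) / short_len"
    unfolding inv_slope_def using False uv short_len_pos by (intro divide_left_mono) auto
  hence "2 ^ N * (dist_const / (growth_const * lam ^ N)) * inv_slope n u v \<le> 2 ^ N * (dist_const / (growth_const * lam ^ N)) * ((v - u) / short_len)"
    using dist_const_ge1 growth_const_pos lam by (intro mult_left_mono) auto
  also have "\<dots> = tile_const * (v - u)" by (simp add: tile_const_def)
  also have "\<dots> \<le> 1 / 2 * inv_slope n u v + tile_const * (v - u)" using inv_slope_pos[OF branch] by simp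
  finally have "2 ^ N * (dist_const / (growth_const * lam ^ N) * inv_slope n u v) \<le> 1 / 2 * inv_slope n u v + tile_const * (v - u)"
    by (simp only: mult.assoc)
  moreover have "tiling (n + N) u v (2 ^ N * (dist_const / (growth_const * lam ^ N) * inv_slope n u v))"
    using tiling_count[OF branch, of 0 N u v] branch by simp
  ultimately show ?thesis by (rule tiling_mono[rotated])
qed

text \<open>\<open>2 * tile_const\<close> sums the geometric series of the length terms, which are
  halved in each round.\<close>

lemma tiling_iterate:
  assumes branch: "branch n u v"
  shows "tiling (n + k * N) u v ((1 / 2) ^ k * inv_slope n u v + 2 * tile_const * (v - u))"
proof (induction k)
  case 0
  show ?case by (rule tiling.single) (use branch tile_const_pos in \<open>auto simp: branch_def\<close>)
next
  case (Suc k)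
  from tiling_trans[OF Suc _ tiling_N] have
    "tiling (n + k * N + N) u v (1 / 2 * ((1 / 2) ^ k * inv_slope n u v + 2 * tile_const * (v - u)) + tile_const * (v - u))" by simp
  thus ?case by (simp add: algebra_simps)
qed

section \<open>Exponential moments of visit counts\<close>

definition hit :: "real \<Rightarrow> real \<Rightarrow> nat \<Rightarrow> real set" where
  "hit r t n = {a \<in> {p..q}. X n a \<in> {r..t}}"

text \<open>Equal to 2 to the number of visits to \<open>{r..t}\<close> at the times
  \<open>n + i * g\<close> with \<open>i < k\<close> (\<open>weight_card\<close>), so its integral
  is an exponential moment. In product form the first visit splits off
  (\<open>weight_Suc\<close>).\<close>

definition weight :: "real \<Rightarrow> real \<Rightarrow> nat \<Rightarrow> nat \<Rightarrow> nat \<Rightarrow> real \<Rightarrow> real" where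
  "weight r t g k n a = (\<Prod>i<k. 1 + indicator (hit r t (n + i * g)) a)"

lemma closed_hit: "closed (hit r t n)"
proof -
  have "closed ({p..q} \<inter> X n -` {r..t})"
    by (intro continuous_closed_preimage continuous_X) auto
  moreover have "hit r t n = {p..q} \<inter> X n -` {r..t}" by (auto simp: hit_def)
  ultimately show ?thesis by simp
qed

lemma hit_borel [measurable]: "hit r t n \<in> sets borel"
  using closed_hit by (rule borel_closed)

lemma weight_borel [measurable]: "weight r t g k n \<in> borel_measurable borel"
  unfolding weight_def by measurable

lemma weight_bounds: "1 \<le> weight r t g k n a" "weight r t g k n a \<le> 2 ^ k"
proof -
  show "1 \<le> weight r t g k n a" unfolding weight_def by (intro prod_ge_1) auto
  have "weight r t g k n a \<le> (\<Prod>i<k. 2)" unfolding weight_def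
    by (intro prod_mono) (auto simp: indicator_def)
  thus "weight r t g k n a \<le> 2 ^ k" by simp
qed

lemma weight_Suc: "weight r t g (Suc k) n a = (1 + indicator (hit r t n) a) * weight r t g k (n + g) a"
  unfolding weight_def prod.lessThan_Suc_shift by (simp add: algebra_simps)

lemma weight_integrable: "set_integrable lborel {u..v} (weight r t g k n)"
proof -
  have "integrable lborel (\<lambda>a. indicator {u..v} a * (2::real) ^ k)"
    by (intro integrable_mult_left) (auto simp: integrable_indicator_iff emeasure_lborel_Icc_eq)
  thus ?thesis unfolding set_integrable_def
  proof (rule Bochner_Integration.integrable_bound)
    show "AE a in lborel. norm (indicator {u..v} a *\<^sub>R weight r t g k n a) \<le> norm (indicator {u..v} a * (2::real) ^ k)"
      using weight_bounds[of r t g k n] by (auto simp: indicator_def intro!: AE_I2) (smt (verit))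
  qed measurable
qed

definition hits_int :: "real \<Rightarrow> real \<Rightarrow> nat \<Rightarrow> nat \<Rightarrow> nat \<Rightarrow> real \<Rightarrow> real \<Rightarrow> real" where
  "hits_int r t g k n u v = (LINT a:{u..v}|lborel. weight r t g k n a)"

lemma hits_int_split:
  assumes "u < z" "z < v"
  shows "hits_int r t g k n u v = hits_int r t g k n u z + hits_int r t g k n z v"
proof -
  have "hits_int r t g k n u v = (LINT a:{u..z} \<union> {z..v}|lborel. weight r t g k n a)"
    unfolding hits_int_def using assms by (simp add: ivl_disj_un)
  also have "\<dots> = hits_int r t g k n u z + hits_int r t g k n z v"
    unfolding hits_int_def
  proof (rule set_integral_Un_AE)
    have "AE a in lborel. a \<noteq> z" by (rule AE_lborel_singleton)
    thus "AE a in lborel. \<not> (a \<in> {u..z} \<and> a \<in> {z..v})" by eventually_elim auto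
  qed (auto intro: weight_integrable)
  finally show ?thesis .
qed

text \<open>By compactness the hitting set has extreme points, and distortion bounds their distance.
  The spanning interval may be degenerate; without any visit it is a point.\<close>

lemma hit_interval:
  assumes branch: "branch n u v" and "r < t"
  obtains u' v' where "u \<le> u'" "u' \<le> v'" "v' \<le> v" "hit r t n \<inter> {u..v} \<subseteq> {u'..v'}"
    "v' - u' \<le> dist_const * inv_slope n u v * (t - r)"
proof (cases "hit r t n \<inter> {u..v} = {}")
  case True
  have "0 \<le> dist_const * inv_slope n u v * (t - r)" using dist_const_ge1 inv_slope_pos[OF branch] assms(2) by simp
  thus ?thesis using that[of u u] True branch by (auto simp: branch_def)
next
  case False
  let ?S = "hit r t n \<inter> {u..v}"
  have S: "compact ?S" using closed_hit by (intro closed_Int_compact) auto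
  obtain u' where u': "u' \<in> ?S" "\<And>x. x \<in> ?S \<Longrightarrow> u' \<le> x" using compact_attains_inf[OF S False] by blast
  obtain v' where v': "v' \<in> ?S" "\<And>x. x \<in> ?S \<Longrightarrow> x \<le> v'" using compact_attains_sup[OF S False] by blast
  have "\<bar>v' - u'\<bar> \<le> dist_const * inv_slope n u v * \<bar>X n v' - X n u'\<bar>"
    using len_le_inv_slope[OF branch] u' v' by blast
  also have "\<dots> \<le> dist_const * inv_slope n u v * (t - r)"
    using dist_const_ge1 inv_slope_pos[OF branch] u' v' by (intro mult_left_mono) (auto simp: hit_def)
  finally have "v' - u' \<le> dist_const * inv_slope n u v * (t - r)" by simp
  moreover have "?S \<subseteq> {u'..v'}" using u'(2) v'(2) by auto
  moreover have "u \<le> u'" "u' \<le> v'" "v' \<le> v" using u'(1) v'(1) u'(2)[OF v'(1)] by auto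
  ultimately show ?thesis using that by blast
qed

text \<open>A visit at time \<open>n\<close> doubles the weight, so it adds a second copy of the
  remaining integral, over the hit interval only.\<close>

lemma hits_int_step:
  assumes branch: "branch n u v" and "r < t"
  obtains u' v' where "u \<le> u'" "u' \<le> v'" "v' \<le> v" "v' - u' \<le> dist_const * inv_slope n u v * (t - r)"
    "hits_int r t g (Suc k) n u v \<le> hits_int r t g k (n + g) u v + hits_int r t g k (n + g) u' v'"
proof -
  obtain u' v' where uv': "u \<le> u'" "u' \<le> v'" "v' \<le> v" "hit r t n \<inter> {u..v} \<subseteq> {u'..v'}"
    "v' - u' \<le> dist_const * inv_slope n u v * (t - r)" using hit_interval[OF assms] .
  have "hits_int r t g (Suc k) n u v \<le> (LINT a|lborel. indicator {u..v} a *\<^sub>R weight r t g k (n + g) a +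
      indicator {u'..v'} a *\<^sub>R weight r t g k (n + g) a)"
    unfolding hits_int_def set_lebesgue_integral_def
  proof (rule integral_mono)
    show "integrable lborel (\<lambda>a. indicator {u..v} a *\<^sub>R weight r t g (Suc k) n a)"
      using weight_integrable unfolding set_integrable_def .
    show "integrable lborel (\<lambda>a. indicator {u..v} a *\<^sub>R weight r t g k (n + g) a +
      indicator {u'..v'} a *\<^sub>R weight r t g k (n + g) a)"
      using weight_integrable unfolding set_integrable_def by (intro Bochner_Integration.integrable_add)
    fix a
    show "indicator {u..v} a *\<^sub>R weight r t g (Suc k) n a \<le> indicator {u..v} a *\<^sub>R weight r t g k (n + g) a +
      indicator {u'..v'} a *\<^sub>R weight r t g k (n + g) a"
      using uv'(4) weight_bounds(1)[of r t g k "n + g" a]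
      by (auto simp: weight_Suc indicator_def split: if_splits)
  qed
  also have "\<dots> = hits_int r t g k (n + g) u v + hits_int r t g k (n + g) u' v'"
    unfolding hits_int_def set_lebesgue_integral_def
    using weight_integrable unfolding set_integrable_def by (intro Bochner_Integration.integral_add)
  finally show ?thesis using that uv' by blast
qed

text \<open>The factor by which the inverse slope can rise when a branch is shortened without
  advancing the time: \<open>inv_slope_child\<close> with \<open>m = 0\<close>.\<close>

definition child_const :: real where "child_const = dist_const / growth_const"

lemma child_const: "1 \<le> child_const" "dist_const \<le> child_const"
proof -
  show "dist_const \<le> child_const" using growth_const_pos growth_const_le1 dist_const_ge1 by (simp add: child_const_def field_simps)
  thus "1 \<le> child_const" using dist_const_ge1 by simp
qed

text \<open>A branch is first split according to whether it hits \<open>{r..t}\<close>, which costs a bounded factor in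
  the inverse slopes; the next \<open>g\<close> steps win this factor back.\<close>

lemma hits_int_bound:
  assumes rt: "r < t" and kk: "(1 / 2) ^ kk * (1 + child_const) \<le> 1 / 2" and g: "g = kk * N"
    and bet: "bet = 2 * child_const * (t - r)" and R: "R = 1 + 2 * tile_const * bet"
  shows "branch n u v \<Longrightarrow> hits_int r t g k n u v \<le> R ^ k * ((v - u) + bet * inv_slope n u v)"
proof (induction k arbitrary: n u v)
  case 0
  have "0 \<le> bet * inv_slope n u v" using bet child_const rt inv_slope_pos[OF 0] by simp
  thus ?case using 0
    by (simp add: hits_int_def weight_def set_lebesgue_integral_def branch_def)
next
  case (Suc k)
  let ?th = "(1 / 2) ^ kk :: real" and ?s = "inv_slope n u v"
  have bet0: "0 \<le> bet" using bet child_const rt by simp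
  have R1: "1 \<le> R" using R bet0 tile_const_pos by simp
  have s0: "0 < ?s" using inv_slope_pos[OF Suc.prems] .
  have th0: "0 \<le> ?th" by simp
  \<comment> \<open>The remaining visits are seen from time \<open>n + g\<close>: the induction
    hypothesis is summed over a tiling at that time.\<close>
  have F: "hits_int r t g k (n + g) x y \<le> R ^ k * ((y - x) + bet * (?th * inv_slope n x y + 2 * tile_const * (y - x)))"
    if "branch n x y" for x y
  proof -
    have "hits_int r t g k (n + g) x y \<le> R ^ k * (y - x) + R ^ k * bet * (?th * inv_slope n x y + 2 * tile_const * (y - x))"
      by (rule tiling_superadditive[OF tiling_iterate[OF that, of kk, folded g] hits_int_split])
        (use Suc.IH R1 bet0 in \<open>auto simp: algebra_simps\<close>)
    thus ?thesis by (simp add: algebra_simps)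
  qed
  obtain u' v' where uv': "u \<le> u'" "u' \<le> v'" "v' \<le> v" "v' - u' \<le> dist_const * ?s * (t - r)"
    "hits_int r t g (Suc k) n u v \<le> hits_int r t g k (n + g) u v + hits_int r t g k (n + g) u' v'"
    using hits_int_step[OF Suc.prems rt] .
  have len: "v' - u' \<le> child_const * ?s * (t - r)"
    using uv'(4) child_const(2) s0 rt by (smt (verit, best) mult_right_mono mult_pos_pos)
  have F': "hits_int r t g k (n + g) u' v' \<le> R ^ k * (child_const * ?s * (t - r) + bet * (?th * (child_const * ?s) + 2 * tile_const * (child_const * ?s * (t - r))))"
  proof (cases "u' < v'")
    case True
    have branch': "branch n u' v'" using branch_sub[OF Suc.prems uv'(1) True uv'(3)] .
    have inv_slope': "inv_slope n u' v' \<le> child_const * ?s"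
      using inv_slope_child[OF Suc.prems, of 0 u' v'] branch' uv' by (simp add: child_const_def)
    show ?thesis
      by (rule order_trans[OF F[OF branch']])
        (use len inv_slope' R1 bet0 tile_const_pos in \<open>intro mult_left_mono add_mono; simp\<close>)
  next
    case False
    hence "u' = v'" using uv' by simp
    hence "hits_int r t g k (n + g) u' v' = (LINT a|lborel. indicator {v'} a * weight r t g k (n + g) a)"
      by (simp add: hits_int_def set_lebesgue_integral_def)
    also have "\<dots> = 0"
    proof (rule integral_eq_zero_AE)
      have "AE a in lborel. a \<noteq> v'" by (rule AE_lborel_singleton)
      thus "AE a in lborel. indicator {v'} a * weight r t g k (n + g) a = 0" by eventually_elim simp
    qed
    moreover have "0 \<le> child_const * ?s" using child_const s0 by simp
    ultimately show ?thesis using rt bet0 tile_const_pos R1 by simp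
  qed
  \<comment> \<open>The choice of \<open>bet\<close> makes the added length \<open>?y\<close> one
    half of \<open>bet * ?s\<close>; the choice of \<open>kk\<close> makes the inverse slopes after
    \<open>g\<close> steps contribute at most the other half. The terms with
    \<open>tile_const\<close> are absorbed by one more factor \<open>R\<close>.\<close>
  let ?y = "child_const * ?s * (t - r)"
  have y: "?y = bet * ?s / 2" by (simp add: bet)
  have "hits_int r t g (Suc k) n u v \<le>
      R ^ k * ((v - u) + bet * (?th * ?s + 2 * tile_const * (v - u))) +
      R ^ k * (?y + bet * (?th * (child_const * ?s) + 2 * tile_const * ?y))"
    using uv'(5) F[OF Suc.prems] F' by linarith
  also have "\<dots> = R ^ k * (R * (v - u) + bet * ?s * (?th * (1 + child_const)) + R * ?y)"
    by (simp add: R algebra_simps)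
  also have "\<dots> \<le> R ^ k * (R * (v - u) + bet * ?s * (R * (1 / 2)) + R * ?y)"
    using R1 kk bet0 s0 child_const(1) by (intro mult_left_mono add_mono) auto
  also have "\<dots> = R ^ Suc k * ((v - u) + bet * ?s)"
    unfolding y by (simp add: algebra_simps)
  finally show ?case .
qed

lemma weight_card: "a \<in> {p..q} \<Longrightarrow> weight r t g k n a = 2 ^ card {i. i < k \<and> X (n + i * g) a \<in> {r..t}}"
proof (induction k)
  case (Suc k)
  have "{i. i < Suc k \<and> X (n + i * g) a \<in> {r..t}} =
      (if X (n + k * g) a \<in> {r..t} then insert k {i. i < k \<and> X (n + i * g) a \<in> {r..t}}
       else {i. i < k \<and> X (n + i * g) a \<in> {r..t}})"
    by (auto simp: less_Suc_eq)
  thus ?case using Suc by (auto simp: weight_def hit_def indicator_def)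
qed (simp add: weight_def)

text \<open>Markov's inequality for the exponential moment: it grows at most like
  \<open>exp (y * k)\<close>, the threshold is \<open>4 powr (y * k)\<close>, and
  \<open>exp 1 < 4\<close> makes the measures of the exceptional sets summable. The 8 is twice the 4
  in \<open>y\<close>.\<close>

lemma hits_AE:
  assumes rt: "r < t" and kk: "(1 / 2) ^ kk * (1 + child_const) \<le> 1 / 2" and g: "g = kk * N"
  shows "AE a in lborel. a \<in> {p..q} \<longrightarrow>
     (\<forall>\<^sub>F k in sequentially. real (card {i. i < k \<and> X (m + i * g) a \<in> {r..t}}) \<le> 8 * tile_const * child_const * (t - r) * k)"
proof -
  define bet R where "bet = 2 * child_const * (t - r)" and "R = 1 + 2 * tile_const * bet"
  define y where "y = 4 * tile_const * child_const * (t - r)"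
  have y0: "0 < y" using tile_const_pos child_const rt by (simp add: y_def)
  have R: "R = 1 + y" by (simp add: R_def y_def bet_def)
  have bet0: "0 \<le> bet" using child_const rt by (simp add: bet_def)
  have adm0: "branch 0 p q" using p_less_q by (simp add: branch_def)
  \<comment> \<open>The progression starts at time \<open>m\<close>, so the interval is first cut
    into branches at that time; the resulting \<open>S\<close> only affects the prefactor
    \<open>c0\<close>.\<close>
  obtain S where S: "tiling m p q S" using tiling_count[OF adm0, of 0 m p q] adm0 by auto
  define A where "A k = {a \<in> {p..q}. 2 powr (2 * y * k) \<le> weight r t g k m a}" for k
  have A_sets: "A k \<in> sets lborel" for k unfolding A_def by measurable
  have bound: "hits_int r t g k m p q \<le> R ^ k * ((q - p) + bet * S)" for k
  proof -
    have "hits_int r t g k m p q \<le> R ^ k * (q - p) + R ^ k * bet * S"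
      by (rule tiling_superadditive[OF S hits_int_split])
        (use hits_int_bound[OF rt kk g bet_def R_def] R y0 bet0 in \<open>auto simp: algebra_simps\<close>)
    thus ?thesis by (simp add: algebra_simps)
  qed
  define c0 where "c0 = (q - p) + bet * S"
  have mA: "emeasure lborel (A k) < \<infinity>" for k
  proof -
    have "emeasure lborel (A k) \<le> emeasure lborel {p..q}" by (rule emeasure_mono) (auto simp: A_def)
    thus ?thesis using p_less_q by (simp add: top.not_eq_extremum le_less_trans)
  qed
  have meas: "measure lborel (A k) \<le> c0 * exp (- (2 * ln 2 - 1) * y) ^ k" for k
  proof -
    have "2 powr (2 * y * k) * measure lborel (A k) = (LINT a|lborel. indicator (A k) a * 2 powr (2 * y * k))"
      using A_sets mA by simp
    also have "\<dots> \<le> hits_int r t g k m p q" unfolding hits_int_def set_lebesgue_integral_def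
    proof (rule integral_mono)
      show "integrable lborel (\<lambda>a. indicator {p..q} a *\<^sub>R weight r t g k m a)"
        using weight_integrable unfolding set_integrable_def .
      show "integrable lborel (\<lambda>a. indicator (A k) a * 2 powr (2 * y * k))"
        using A_sets mA by (intro integrable_mult_left) (auto simp: integrable_indicator_iff)
      show "indicator (A k) a * 2 powr (2 * y * k) \<le> indicator {p..q} a *\<^sub>R weight r t g k m a" for a
        using weight_bounds(1)[of r t g k m a] by (auto simp: A_def indicator_def)
    qed
    also have "\<dots> \<le> R ^ k * c0" using bound by (simp add: c0_def)
    also have "\<dots> \<le> exp y ^ k * c0"
    proof (intro mult_right_mono power_mono)
      show "R \<le> exp y" using R by simp
      show "0 \<le> R" using R y0 by simp
      have "0 \<le> hits_int r t g 0 m p q"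
        unfolding hits_int_def set_lebesgue_integral_def
        by (intro integral_nonneg_AE AE_I2) (auto simp: weight_def)
      thus "0 \<le> c0" using bound[of 0] by (simp add: c0_def)
    qed
    finally have "measure lborel (A k) \<le> exp y ^ k * c0 / 2 powr (2 * y * k)"
      by (simp add: field_simps)
    also have "2 powr (2 * y * k) = exp (2 * ln 2 * y) ^ k"
      by (simp add: powr_def mult_ac flip: exp_of_nat_mult)
    also have "exp y ^ k * c0 / exp (2 * ln 2 * y) ^ k = c0 * exp (- (2 * ln 2 - 1) * y) ^ k"
    proof -
      have "exp y / exp (2 * ln 2 * y) = exp (- (2 * ln 2 - 1) * y)"
        by (simp add: algebra_simps flip: exp_diff)
      thus ?thesis by (metis mult.commute power_divide times_divide_eq_right)
    qed
    finally show ?thesis .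
  qed
  have l2: "1 < 2 * ln (2::real)" using ln2_ge_two_thirds by simp
  have "summable (\<lambda>k. c0 * exp (- (2 * ln 2 - 1) * y) ^ k)"
    using l2 y0 by (intro summable_mult summable_geometric) (simp add: mult_neg_pos)
  hence sm: "summable (\<lambda>k. measure lborel (A k))"
    by (rule summable_comparison_test'[where N = 0]) (use meas in auto)
  have "AE a in lborel. \<forall>\<^sub>F k in sequentially. a \<in> space lborel - A k"
    using A_sets mA sm by (rule borel_cantelli_AE1)
  thus ?thesis
  proof eventually_elim
    case (elim a)
    show ?case
    proof
      assume a: "a \<in> {p..q}"
      from elim show "\<forall>\<^sub>F k in sequentially. real (card {i. i < k \<and> X (m + i * g) a \<in> {r..t}}) \<le> 8 * tile_const * child_const * (t - r) * k"
      proof eventually_elim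
        case (elim k)
        let ?n = "card {i. i < k \<and> X (m + i * g) a \<in> {r..t}}"
        have "weight r t g k m a < 2 powr (2 * y * k)" using elim a by (auto simp: A_def)
        hence "2 powr (real ?n) < 2 powr (2 * y * k)" using weight_card[OF a] by (simp add: powr_realpow)
        hence "real ?n < 2 * y * k" by simp
        thus ?case by (simp add: y_def mult.assoc)
      qed
    qed
  qed
qed

text \<open>The progressions over the residues \<open>m < g\<close> cover all times. Rational
  endpoints leave only countably many null sets to discard, and \<open>C\<close> does not depend on
  the interval, which later yields a bounded density.\<close>

theorem frequency_AE:
  "\<exists>C>0. AE a in lborel. a \<in> {p..q} \<longrightarrow>
     (\<forall>r\<in>\<rat>. \<forall>t\<in>\<rat>. r < t \<longrightarrow>
        (\<forall>\<^sub>F n in sequentially. real (card {i. i < n \<and> X i a \<in> {r..t}}) \<le> C * (t - r) * n))"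
proof -
  have "\<exists>kk. (1 / 2) ^ kk < 1 / (2 * (1 + child_const))"
    using child_const by (intro real_arch_pow_inv) auto
  then obtain kk0 where "(1 / 2) ^ kk0 < 1 / (2 * (1 + child_const))" by blast
  \<comment> \<open>One more than \<open>kk0\<close>, which makes the spacing \<open>g\<close>
    visibly positive.\<close>
  moreover define kk where "kk = Suc kk0"
  moreover have "(1 / 2 :: real) ^ kk \<le> (1 / 2) ^ kk0" unfolding kk_def by simp
  ultimately have "(1 / 2) ^ kk \<le> 1 / (2 * (1 + child_const))" by linarith
  hence kk: "(1 / 2) ^ kk * (1 + child_const) \<le> 1 / 2" using child_const by (simp add: field_simps)
  define g where "g = kk * N"
  have "N \<noteq> 0" using N_large dist_const_ge1 growth_const_le1 by (cases N) auto
  hence g: "0 < g" by (simp add: g_def kk_def)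
  define c1 where "c1 = 8 * tile_const * child_const"
  have c1: "0 < c1" using tile_const_pos child_const by (simp add: c1_def)
  have "AE a in lborel. \<forall>r\<in>\<rat>. \<forall>t\<in>\<rat>. \<forall>m\<in>{..<g}. a \<in> {p..q} \<longrightarrow> r < t \<longrightarrow>
     (\<forall>\<^sub>F k in sequentially. real (card {i. i < k \<and> X (m + i * g) a \<in> {r..t}}) \<le> c1 * (t - r) * k)"
  proof (intro AE_ball_countable[THEN iffD2] countable_rat ballI)
    fix r t :: real and m
    show "AE a in lborel. a \<in> {p..q} \<longrightarrow> r < t \<longrightarrow>
     (\<forall>\<^sub>F k in sequentially. real (card {i. i < k \<and> X (m + i * g) a \<in> {r..t}}) \<le> c1 * (t - r) * k)"
    proof (cases "r < t")
      case True
      from hits_AE[OF this kk g_def, of m] show ?thesis unfolding c1_def by eventually_elim simp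
    qed simp
  qed simp_all
  hence "AE a in lborel. a \<in> {p..q} \<longrightarrow> (\<forall>r\<in>\<rat>. \<forall>t\<in>\<rat>. r < t \<longrightarrow>
        (\<forall>\<^sub>F n in sequentially. real (card {i. i < n \<and> X i a \<in> {r..t}}) \<le> 2 * c1 * (t - r) * n))"
  proof eventually_elim
    case (elim a)
    show ?case
    proof (intro impI ballI)
      fix r t :: real assume a: "a \<in> {p..q}" and rt: "r \<in> \<rat>" "t \<in> \<rat>" "r < t"
      let ?P = "\<lambda>k. \<forall>m<g. real (card {i. i < k \<and> X (m + i * g) a \<in> {r..t}}) \<le> c1 * (t - r) * k"
      have "\<forall>\<^sub>F k in sequentially. \<forall>m\<in>{..<g}. real (card {i. i < k \<and> X (m + i * g) a \<in> {r..t}}) \<le> c1 * (t - r) * k"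
        using elim a rt by (intro eventually_ball_finite) auto
      then obtain k0 where k0: "\<And>k. k0 \<le> k \<Longrightarrow> ?P k"
        unfolding eventually_sequentially by auto
      show "\<forall>\<^sub>F n in sequentially. real (card {i. i < n \<and> X i a \<in> {r..t}}) \<le> 2 * c1 * (t - r) * n"
        unfolding eventually_sequentially
      proof (intro exI[of _ "g * k0 + g"] allI impI)
        fix n assume n: "g * k0 + g \<le> n"
        \<comment> \<open>Rounding up: \<open>n < g * k \<le> 2 * n\<close> once
          \<open>g \<le> n\<close>, which costs the factor 2 in the constant.\<close>
        define k where "k = n div g + 1"
        have "k0 \<le> n div g" using n g by (simp add: less_eq_div_iff_mult_less_eq algebra_simps)
        hence "k0 \<le> k" by (simp add: k_def)
        hence Pk: "?P k" by (rule k0)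
        have nk: "n < g * k" unfolding k_def using dividend_less_times_div[OF g, of n] by simp
        have gk: "g * k \<le> 2 * n"
        proof -
          have "g * (n div g) \<le> n" by simp
          moreover have "g * k = g * (n div g) + g" by (simp add: k_def)
          ultimately show ?thesis using n by linarith
        qed
        let ?B = "\<lambda>m. (\<lambda>i. m + i * g) ` {i. i < k \<and> X (m + i * g) a \<in> {r..t}}"
        have "{i. i < n \<and> X i a \<in> {r..t}} \<subseteq> (\<Union>m<g. ?B m)"
        proof
          fix i assume i: "i \<in> {i. i < n \<and> X i a \<in> {r..t}}"
          have "i div g < k" using i nk g by (simp add: div_less_iff_less_mult mult.commute)
          hence "i \<in> ?B (i mod g)" using i by (intro image_eqI[of _ _ "i div g"]) auto
          thus "i \<in> (\<Union>m<g. ?B m)" using g by (intro UN_I[of "i mod g"]) auto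
        qed
        hence "card {i. i < n \<and> X i a \<in> {r..t}} \<le> card (\<Union>m<g. ?B m)"
          by (intro card_mono) auto
        also have "\<dots> \<le> (\<Sum>m<g. card (?B m))" by (rule card_UN_le) simp
        also have "\<dots> \<le> (\<Sum>m<g. card {i. i < k \<and> X (m + i * g) a \<in> {r..t}})"
          by (intro sum_mono card_image_le) auto
        finally have "real (card {i. i < n \<and> X i a \<in> {r..t}}) \<le>
            (\<Sum>m<g. real (card {i. i < k \<and> X (m + i * g) a \<in> {r..t}}))"
          by (simp only: of_nat_sum[symmetric] of_nat_le_iff)
        also have "\<dots> \<le> (\<Sum>m<g. c1 * (t - r) * k)" using Pk by (intro sum_mono) auto
        also have "\<dots> = c1 * (t - r) * real (g * k)" by simp
        also have "\<dots> \<le> c1 * (t - r) * real (2 * n)"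
          using gk c1 rt by (intro mult_left_mono of_nat_mono) auto
        finally show "real (card {i. i < n \<and> X i a \<in> {r..t}}) \<le> 2 * c1 * (t - r) * n" by simp
      qed
    qed
  qed
  thus ?thesis using c1 by (intro exI[of _ "2 * c1"]) auto
qed

end

section \<open>Measures of invariant sets\<close>

text \<open>Cover \<open>S\<close> by countably many nonoverlapping intervals of total length close
  to that of \<open>S\<close>. The hypothesis concerns the traces \<open>S \<inter> {x..y}\<close>,
  so it may exploit properties of the particular set, as in
  \<open>invariant_set_null\<close>.\<close>

lemma measure_le_of_intervals:
  fixes \<mu> :: "real measure" and C :: real
  assumes sets: "sets \<mu> = sets borel" and S: "S \<in> sets borel" "S \<subseteq> {u..v}" and C: "0 \<le> C"
    and le: "\<And>x y. u \<le> x \<Longrightarrow> x \<le> y \<Longrightarrow> y \<le> v \<Longrightarrow> emeasure \<mu> (S \<inter> {x..y}) \<le> ennreal (C * (y - x))"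
  shows "emeasure \<mu> S \<le> ennreal (C * measure lborel S)"
proof (rule ennreal_le_epsilon)
  fix e :: real assume e: "0 < e"
  define e' where "e' = e / (C + 1)"
  have e': "0 < e'" "C * e' \<le> e" using e C by (auto simp: e'_def field_simps)
  have Sl: "S \<in> lmeasurable"
    by (rule bounded_set_imp_lmeasurable[OF bounded_subset[OF bounded_closed_interval S(2)]])
      (use S in auto)
  obtain \<D> where D: "countable \<D>"
        "\<And>K. K \<in> \<D> \<Longrightarrow> K \<subseteq> cbox u v \<and> K \<noteq> {} \<and> (\<exists>c d. K = cbox c d)"
        "pairwise (\<lambda>A B. interior A \<inter> interior B = {}) \<D>"
        "S \<subseteq> \<Union>\<D>" "\<Union>\<D> \<in> lmeasurable" "measure lebesgue (\<Union>\<D>) \<le> measure lebesgue S + e'"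
    by (rule measurable_outer_intervals_bounded[OF Sl _ e'(1), of u v]) (use S in simp_all)
  have K: "\<exists>x y. K = {x..y} \<and> u \<le> x \<and> x \<le> y \<and> y \<le> v" if "K \<in> \<D>" for K
  proof -
    obtain x y where "K = {x..y}" "K \<noteq> {}" "K \<subseteq> {u..v}" using D(2)[OF \<open>K \<in> \<D>\<close>] by (auto simp: box_real)
    thus ?thesis by (intro exI[of _ x] exI[of _ y]) auto
  qed
  have bor: "interior K \<in> sets borel" for K :: "real set" by simp
  \<comment> \<open>The covering intervals overlap at most in endpoints. Those in \<open>S\<close>
    form a countable set, null for \<open>\<mu>\<close> by the hypothesis with
    \<open>x = y\<close>.\<close>
  define E where "E = (\<Union>K\<in>\<D>. S \<inter> (K - interior K))"
  have E_count: "countable E" unfolding E_def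
  proof (intro countable_UN D(1) countable_Int2)
    fix K assume "K \<in> \<D>"
    then obtain x y where "K = {x..y}" using K by blast
    hence "K - interior K \<subseteq> {x, y}" by (auto simp: interior_atLeastAtMost_real)
    thus "countable (K - interior K)" by (rule countable_subset) simp
  qed
  have "E \<subseteq> S" by (auto simp: E_def)
  have "(\<Union>x\<in>E. {x}) \<in> null_sets \<mu>"
  proof (intro null_sets_UN' E_count)
    fix x assume "x \<in> E"
    hence x: "x \<in> S" "u \<le> x" "x \<le> v" using \<open>E \<subseteq> S\<close> S by auto
    from le[of x x] x have "emeasure \<mu> {x} = 0" by (simp add: Int_absorb1)
    thus "{x} \<in> null_sets \<mu>" by (auto simp: sets)
  qed
  hence E0: "E \<in> null_sets \<mu>" by simp
  define F where "F = (\<Union>K\<in>\<D>. S \<inter> interior K)"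
  have F_sets: "F \<in> sets \<mu>" unfolding F_def sets by (intro sets.countable_UN' D(1)) (use S in auto)
  have disj: "disjoint_family_on (\<lambda>K. interior K) \<D>"
    using D(3) by (auto simp: disjoint_family_on_def pairwise_def)
  hence disj': "disjoint_family_on (\<lambda>K. S \<inter> interior K) \<D>"
    by (auto simp: disjoint_family_on_def)
  have len: "emeasure \<mu> (S \<inter> interior K) \<le> ennreal C * emeasure lborel (interior K)" if "K \<in> \<D>" for K
  proof -
    obtain x y where xy: "K = {x..y}" "u \<le> x" "x \<le> y" "y \<le> v" using K[OF \<open>K \<in> \<D>\<close>] by blast
    have "emeasure \<mu> (S \<inter> interior K) \<le> emeasure \<mu> (S \<inter> {x..y})"
      using S sets by (intro emeasure_mono) (auto simp: xy interior_atLeastAtMost_real)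
    also have "\<dots> \<le> ennreal (C * (y - x))" by (rule le[OF xy(2-4)])
    also have "\<dots> = ennreal C * emeasure lborel (interior K)"
      using xy C by (simp add: interior_atLeastAtMost_real ennreal_mult)
    finally show ?thesis .
  qed
  have "emeasure \<mu> F = (\<integral>\<^sup>+K. emeasure \<mu> (S \<inter> interior K) \<partial>count_space \<D>)"
    unfolding F_def using S sets by (intro emeasure_UN_countable D(1) disj') auto
  also have "\<dots> \<le> (\<integral>\<^sup>+K. ennreal C * emeasure lborel (interior K) \<partial>count_space \<D>)"
    using len by (intro nn_integral_mono) auto
  also have "\<dots> = ennreal C * (\<integral>\<^sup>+K. emeasure lborel (interior K) \<partial>count_space \<D>)"
    by (rule nn_integral_cmult) simp
  also have "(\<integral>\<^sup>+K. emeasure lborel (interior K) \<partial>count_space \<D>) = emeasure lborel (\<Union>K\<in>\<D>. interior K)"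
    by (rule emeasure_UN_countable[symmetric]) (use D(1) disj in auto)
  also have "\<dots> = emeasure lebesgue (\<Union>K\<in>\<D>. interior K)"
  proof -
    have "(\<Union>K\<in>\<D>. interior K) \<in> sets lborel" by (simp add: open_UN)
    thus ?thesis by simp
  qed
  also have "\<dots> \<le> emeasure lebesgue (\<Union>\<D>)"
    by (rule emeasure_mono) (use interior_subset fmeasurableD[OF D(5)] in \<open>blast+\<close>)
  also have "\<dots> \<le> ennreal (measure lebesgue S + e')"
    using D(5,6) by (simp add: emeasure_eq_measure2 ennreal_leI)
  also have "measure lebesgue S = measure lborel S" using S by simp
  finally have F: "emeasure \<mu> F \<le> ennreal C * ennreal (measure lborel S + e')"
    by (simp add: mult_left_mono)
  have "S \<subseteq> F \<union> E" using D(4) by (auto simp: F_def E_def)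
  hence "emeasure \<mu> S \<le> emeasure \<mu> (F \<union> E)"
    using F_sets E0 by (intro emeasure_mono) auto
  also have "\<dots> = emeasure \<mu> F" using F_sets E0 by (rule emeasure_Un_null_set)
  also have "\<dots> \<le> ennreal (C * (measure lborel S + e'))" using F C e' by (simp add: ennreal_mult)
  also have "\<dots> \<le> ennreal (C * measure lborel S + e)"
    using e' by (intro ennreal_leI) (simp add: algebra_simps)
  also have "\<dots> = ennreal (C * measure lborel S) + ennreal e"
    using C e by (intro ennreal_plus) auto
  finally show "emeasure \<mu> S \<le> ennreal (C * measure lborel S) + ennreal e" .
qed

lemma Icc_Diff_fmeasurable: "A \<in> sets borel \<Longrightarrow> {x..y::real} - A \<in> fmeasurable lborel"
  by (rule fmeasurableI2[of "{x..y}"]) (auto simp: fmeasurable_def emeasure_lborel_Icc_eq)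

text \<open>In a finite grid with cells shorter than \<open>e / 2\<close>, every interval of length
  \<open>e\<close> contains a whole cell, so the smallest cell measure is a uniform bound.\<close>

lemma grid_lower_bound:
  fixes A :: "real set"
  assumes A: "A \<in> sets borel" and pos: "\<And>x y. 0 \<le> x \<Longrightarrow> x < y \<Longrightarrow> y \<le> 1 \<Longrightarrow> 0 < measure lborel ({x..y} - A)"
    and e: "0 < e"
  shows "\<exists>\<eta>>0. \<forall>x y. 0 \<le> x \<and> x + e \<le> y \<and> y \<le> 1 \<longrightarrow> \<eta> \<le> measure lborel ({x..y} - A)"
proof -
  obtain m :: nat where m: "2 / e < m" using reals_Archimedean2 by blast
  hence m0: "0 < m" using e by (auto intro: gr0I)
  have m2: "2 / real m < e" using m e m0 by (simp add: field_simps)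
  define f where "f i = measure lborel ({real i / m..(real i + 1) / m} - A)" for i :: nat
  define \<eta> where "\<eta> = Min (f ` {..<m})"
  have ne: "{..<m} \<noteq> {}" using m0 by auto
  have "0 < f i" if "i < m" for i
    unfolding f_def using that m0 by (intro pos) (auto simp: field_simps)
  hence "0 < \<eta>" unfolding \<eta>_def using ne by simp
  moreover have "\<eta> \<le> measure lborel ({x..y} - A)" if xy: "0 \<le> x" "x + e \<le> y" "y \<le> 1" for x y
  proof -
    define i where "i = nat \<lceil>x * m\<rceil>"
    have i: "x * m \<le> real i" "real i < x * m + 1"
      using xy by (auto simp: i_def) linarith
    have 1: "x \<le> real i / m" using i m0 by (simp add: field_simps)
    have "(real i + 1) / m \<le> (x * m + 2) / m" using i m0 by (intro divide_right_mono) auto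
    also have "\<dots> = x + 2 / m" using m0 by (simp add: field_simps)
    also have "\<dots> \<le> y" using m2 xy by simp
    finally have 2: "(real i + 1) / m \<le> y" .
    hence "(real i + 1) / m \<le> 1" using xy by simp
    hence "real i + 1 \<le> m" using m0 by (simp add: field_simps)
    hence "i < m" by simp
    hence "\<eta> \<le> f i" unfolding \<eta>_def by (intro Min_le) auto
    also have "\<dots> \<le> measure lborel ({x..y} - A)" unfolding f_def
    proof (rule measure_mono_fmeasurable[OF _ _ Icc_Diff_fmeasurable[OF A]])
      show "{real i / m..(real i + 1) / m} - A \<subseteq> {x..y} - A" using 1 2 by auto
    qed (use A in auto)
    finally show ?thesis .
  qed
  ultimately show ?thesis by blast
qed

section \<open>Invariant sets whose complement meets every interval in positive measure\<close>

context nonrecurrent_curve begin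

text \<open>By invariance \<open>X m\<close> carries \<open>{u..v} - A\<close> onto the part of the
  image outside \<open>A\<close>, and distortion bounds how much it stretches measure. The term with
  \<open>e\<close> makes the bound trivial for images shorter than \<open>e\<close>, so that it
  holds on all pieces of a tiling.\<close>

lemma image_measure_lower:
  assumes branch: "branch m u v" and A: "A \<in> sets borel"
    and inv: "\<And>a. a \<in> {p..q} \<Longrightarrow> X m a \<in> A \<longleftrightarrow> a \<in> A"
    and h: "\<And>x y. 0 \<le> x \<Longrightarrow> x + e \<le> y \<Longrightarrow> y \<le> 1 \<Longrightarrow> h \<le> measure lborel ({x..y} - A)"
    and e: "0 < e" "0 < h"
  shows "h / dist_const * ((v - u) - e * inv_slope m u v) \<le> measure lborel ({u..v} - A)"
proof (cases "e \<le> \<bar>X m v - X m u\<bar>")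
  case False
  have "v - u = inv_slope m u v * \<bar>X m v - X m u\<bar>" using inv_slope_mult[OF branch] by simp
  also have "\<dots> \<le> inv_slope m u v * e" using False inv_slope_pos[OF branch] by (intro mult_left_mono) auto
  finally have "h / dist_const * ((v - u) - e * inv_slope m u v) \<le> 0"
    using dist_const_ge1 e by (intro mult_nonneg_nonpos) (auto simp: mult.commute)
  thus ?thesis using measure_nonneg order_trans by blast
next
  case True
  have uv: "u < v" "{u..v} \<subseteq> {p..q}" using branch by (auto simp: branch_def)
  define Q where "Q = dist_const / inv_slope m u v"
  have Q: "0 < Q" using dist_const_ge1 inv_slope_pos[OF branch] by (simp add: Q_def)
  have cont: "continuous_on {u..v} (X m)" by (rule continuous_on_subset[OF continuous_X uv(2)])
  have inj: "inj_on (X m) {u..v}"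
  proof (rule inj_onI)
    fix x y assume "x \<in> {u..v}" "y \<in> {u..v}" "X m x = X m y"
    with slope_lower[OF branch, of x y] s0_pos show "x = y" by (simp add: mult_le_0_iff)
  qed
  define I where "I = X m ` {u..v}"
  define g where "g = the_inv_into {u..v} (X m)"
  have g: "g z \<in> {u..v}" "X m (g z) = z" if "z \<in> I" for z
    using that by (auto simp: g_def I_def the_inv_into_f_f[OF inj])
  have compI: "compact I" unfolding I_def by (intro compact_continuous_image cont) auto
  have contg: "continuous_on I g"
    unfolding I_def by (rule continuous_on_inv[OF cont]) (auto simp: g_def the_inv_into_f_f[OF inj])
  \<comment> \<open>Lebesgue measure on the image, transported to \<open>{u..v}\<close> by the
    inverse of \<open>X m\<close>. On intervals it is at most \<open>Q\<close> times the length,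
    hence also on Borel sets.\<close>
  define \<mu> where "\<mu> = distr (restrict_space lborel I) borel g"
  have Ib: "I \<in> sets borel" using compI by (intro borel_closed compact_imp_closed)
  have gm: "g \<in> measurable (restrict_space lborel I) borel"
  proof -
    have "g \<in> borel_measurable (restrict_space borel I)"
      by (rule borel_measurable_continuous_on_restrict[OF contg])
    thus ?thesis by (subst measurable_cong_sets[OF sets_restrict_space_cong[OF sets_lborel] refl])
  qed
  have mu: "emeasure \<mu> S = emeasure lborel {z \<in> I. g z \<in> S}" if "S \<in> sets borel" for S
  proof -
    have "emeasure \<mu> S = emeasure (restrict_space lborel I) (g -` S \<inter> I)"
      unfolding \<mu>_def using that gm by (simp add: emeasure_distr space_restrict_space)
    also have "\<dots> = emeasure lborel (g -` S \<inter> I)"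
      using Ib by (intro emeasure_restrict_space) auto
    finally show ?thesis by (simp add: vimage_def Int_def conj_commute)
  qed
  have int: "emeasure \<mu> (S \<inter> {x..y}) \<le> ennreal (Q * (y - x))"
    if "u \<le> x" "x \<le> y" "y \<le> v" "S \<in> sets borel" for x y S
  proof -
    have sub: "{x..y} \<subseteq> {u..v}" using that by auto
    have co: "compact (X m ` {x..y})"
      by (intro compact_continuous_image continuous_on_subset[OF cont sub]) auto
    have ne: "X m ` {x..y} \<noteq> {}" using that by auto
    obtain z1 where z1: "z1 \<in> {x..y}" "\<And>w. w \<in> {x..y} \<Longrightarrow> X m z1 \<le> X m w"
      using compact_attains_inf[OF co ne] by auto
    obtain z2 where z2: "z2 \<in> {x..y}" "\<And>w. w \<in> {x..y} \<Longrightarrow> X m w \<le> X m z2"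
      using compact_attains_sup[OF co ne] by auto
    have "X m z2 - X m z1 \<le> Q * \<bar>z2 - z1\<bar>"
      using X_lip_inv_slope[OF branch, of z2 z1] z1 z2 sub by (auto simp: Q_def)
    also have "\<dots> \<le> Q * (y - x)" using z1 z2 Q by (intro mult_left_mono) auto
    finally have len: "X m z2 - X m z1 \<le> Q * (y - x)" .
    have "emeasure \<mu> (S \<inter> {x..y}) = emeasure lborel {z \<in> I. g z \<in> S \<inter> {x..y}}"
      using that by (intro mu) auto
    also have "\<dots> \<le> emeasure lborel {X m z1..X m z2}"
    proof (rule emeasure_mono)
      show "{z \<in> I. g z \<in> S \<inter> {x..y}} \<subseteq> {X m z1..X m z2}"
        using g z1 z2 by (smt (verit, ccfv_threshold) IntD2 atLeastAtMost_iff mem_Collect_eq subsetI)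
    qed simp
    also have "\<dots> = ennreal (X m z2 - X m z1)" using z1 z2 by simp
    also have "\<dots> \<le> ennreal (Q * (y - x))" using len by (rule ennreal_leI)
    finally show ?thesis .
  qed
  have "emeasure \<mu> ({u..v} - A) \<le> ennreal (Q * measure lborel ({u..v} - A))"
    by (rule measure_le_of_intervals[where u = u and v = v])
      (use A Q int[of _ _ "{u..v} - A"] in \<open>auto simp: \<mu>_def\<close>)
  also have "emeasure \<mu> ({u..v} - A) = emeasure lborel (I - A)"
  proof -
    have "z \<in> A \<longleftrightarrow> g z \<in> A" if "z \<in> I" for z using inv[of "g z"] g[OF that] uv by auto
    hence "{z \<in> I. g z \<in> {u..v} - A} = I - A" using g by auto
    thus ?thesis using mu[of "{u..v} - A"] A by simp
  qed
  finally have 1: "emeasure lborel (I - A) \<le> ennreal (Q * measure lborel ({u..v} - A))" .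
  define x y where "x = min (X m u) (X m v)" and "y = max (X m u) (X m v)"
  have "{x..y} \<subseteq> I"
  proof -
    have "connected I" unfolding I_def by (intro connected_continuous_image cont) auto
    moreover have "x \<in> I" "y \<in> I" using uv by (auto simp: I_def x_def y_def min_def max_def)
    ultimately show ?thesis using connected_contains_Icc by blast
  qed
  have "x + e \<le> y" using True by (auto simp: x_def y_def)
  moreover have "0 \<le> x" "y \<le> 1"
    using X_range[of u m] X_range[of v m] uv by (auto simp: x_def y_def subset_iff)
  ultimately have 2: "h \<le> measure lborel ({x..y} - A)" using h by blast
  have "ennreal (measure lborel ({x..y} - A)) = emeasure lborel ({x..y} - A)"
    using Icc_Diff_fmeasurable[OF A] by (simp add: emeasure_eq_measure2)
  also have "\<dots> \<le> emeasure lborel (I - A)" using \<open>{x..y} \<subseteq> I\<close> Ib A by (intro emeasure_mono) auto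
  also note 1
  finally have "measure lborel ({x..y} - A) \<le> Q * measure lborel ({u..v} - A)"
    using Q by (subst (asm) ennreal_le_iff) auto
  with 2 have "h \<le> Q * measure lborel ({u..v} - A)" by linarith
  hence "inv_slope m u v * h / dist_const \<le> measure lborel ({u..v} - A)"
    using dist_const_ge1 inv_slope_pos[OF branch] by (simp add: Q_def field_simps)
  moreover have "h / dist_const * ((v - u) - e * inv_slope m u v) \<le> inv_slope m u v * h / dist_const"
  proof -
    have "\<bar>X m v - X m u\<bar> \<le> 1" using \<open>0 \<le> x\<close> \<open>y \<le> 1\<close> by (auto simp: x_def y_def)
    hence "inv_slope m u v * \<bar>X m v - X m u\<bar> \<le> inv_slope m u v" using inv_slope_pos[OF branch] by (simp add: mult_left_le)
    hence "(v - u) - e * inv_slope m u v \<le> inv_slope m u v"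
      using inv_slope_mult[OF branch] e inv_slope_pos[OF branch] by (smt (verit) mult_pos_pos)
    hence "h / dist_const * ((v - u) - e * inv_slope m u v) \<le> h / dist_const * inv_slope m u v"
      using e dist_const_ge1 by (intro mult_left_mono) auto
    thus ?thesis by (simp add: algebra_simps)
  qed
  ultimately show ?thesis by linarith
qed

text \<open>The complement of \<open>A\<close> fills a fixed proportion of every subinterval, so
  \<open>A\<close> has at most the proportion \<open>c < 1\<close> of each. Passing from intervals
  to \<open>A\<close> itself, its measure is at most \<open>c\<close> times its measure. This takes
  the place of a density point argument.\<close>

theorem invariant_set_null:
  assumes A: "A \<in> sets borel"
    and inv: "\<And>m a. a \<in> {p..q} \<Longrightarrow> X m a \<in> A \<longleftrightarrow> a \<in> A"
    and pos: "\<And>x y. 0 \<le> x \<Longrightarrow> x < y \<Longrightarrow> y \<le> 1 \<Longrightarrow> 0 < measure lborel ({x..y} - A)"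
  shows "emeasure lborel (A \<inter> {p..q}) = 0"
proof -
  \<comment> \<open>With this \<open>e\<close> the term \<open>2 * tile_const * (y - x)\<close> of
    the tiling loses half of \<open>y - x\<close>; a large \<open>k\<close> loses at most another
    quarter, and a quarter is left.\<close>
  define e where "e = 1 / (4 * tile_const)"
  have e: "0 < e" using tile_const_pos by (simp add: e_def)
  obtain h where h: "0 < h" "\<And>x y. 0 \<le> x \<Longrightarrow> x + e \<le> y \<Longrightarrow> y \<le> 1 \<Longrightarrow> h \<le> measure lborel ({x..y} - A)"
    using grid_lower_bound[OF A pos e] by blast
  have lower: "h / (4 * dist_const) * (y - x) \<le> measure lborel ({x..y} - A)" if xy: "p \<le> x" "x < y" "y \<le> q" for x y
  proof -
    have branch: "branch 0 x y" using xy by (simp add: branch_def)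
    have inv_slope: "0 < inv_slope 0 x y" using inv_slope_pos[OF branch] .
    obtain k where k: "(1 / 2) ^ k < (y - x) / (4 * (e * inv_slope 0 x y))"
      using real_arch_pow_inv[of "(y - x) / (4 * (e * inv_slope 0 x y))" "1 / 2"] xy e inv_slope by auto
    hence k': "e * ((1 / 2) ^ k * inv_slope 0 x y) \<le> (y - x) / 4" using e inv_slope by (simp add: field_simps)
    define S where "S = (1 / 2) ^ k * inv_slope 0 x y + 2 * tile_const * (y - x)"
    have eS: "e * S \<le> 3 / 4 * (y - x)"
    proof -
      have "e * (2 * tile_const * (y - x)) = (y - x) / 2" using tile_const_pos by (simp add: e_def)
      moreover have "e * S = e * ((1 / 2) ^ k * inv_slope 0 x y) + e * (2 * tile_const * (y - x))"
        by (simp only: S_def distrib_left)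
      ultimately show ?thesis using k' by linarith
    qed
    have alg: "k * (w - e * s) = - (- k * w + (k * e) * s)" for k w s :: real by (simp add: algebra_simps)
    have "- measure lborel ({x..y} - A) \<le> - (h / dist_const) * (y - x) + (h / dist_const * e) * S"
    proof (rule tiling_superadditive[OF tiling_iterate[OF branch, of k, folded S_def], of "\<lambda>u v. - measure lborel ({u..v} - A)"])
      fix u z v :: real assume "u < z" "z < v"
      hence "measure lborel ({u..v} - A) = measure lborel (({u..z} - A) \<union> ({z..v} - A))"
        by (intro arg_cong[of _ _ "measure lborel"]) auto
      also have "\<dots> = measure lborel ({u..z} - A) + measure lborel ({z..v} - A)"
      proof (rule measure_Un_AE)
        have "AE a in lborel. a \<noteq> z" by (rule AE_lborel_singleton)
        thus "AE a in lborel. a \<notin> {u..z} - A \<or> a \<notin> {z..v} - A" by eventually_elim auto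
      qed (use Icc_Diff_fmeasurable[OF A] in auto)
      finally show "- measure lborel ({u..v} - A) = - measure lborel ({u..z} - A) + - measure lborel ({z..v} - A)" by simp
    next
      fix u v assume "branch (0 + k * N) u v"
      hence "h / dist_const * ((v - u) - e * inv_slope (0 + k * N) u v) \<le> measure lborel ({u..v} - A)"
        by (rule image_measure_lower[OF _ A]) (use inv h e in auto)
      moreover have "h / dist_const * ((v - u) - e * inv_slope (0 + k * N) u v) =
          - (- (h / dist_const) * (v - u) + (h / dist_const * e) * inv_slope (0 + k * N) u v)"
        by (rule alg)
      ultimately show "- measure lborel ({u..v} - A) \<le> - (h / dist_const) * (v - u) + (h / dist_const * e) * inv_slope (0 + k * N) u v"
        by linarith
    qed (use h e dist_const_ge1 in auto)
    hence "h / dist_const * ((y - x) - e * S) \<le> measure lborel ({x..y} - A)"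
      using alg[of "h / dist_const" "y - x" S] by linarith
    moreover have "h / dist_const * ((y - x) / 4) \<le> h / dist_const * ((y - x) - e * S)"
      using eS h dist_const_ge1 by (intro mult_left_mono) auto
    ultimately show ?thesis by simp
  qed
  define c where "c = max 0 (1 - h / (4 * dist_const))"
  have c: "0 \<le> c" "c < 1" using h dist_const_ge1 by (auto simp: c_def)
  have "emeasure lborel (A \<inter> {p..q}) \<le> ennreal (c * measure lborel (A \<inter> {p..q}))"
  proof (rule measure_le_of_intervals[where u = p and v = q])
    fix x y assume xy: "p \<le> x" "x \<le> y" "y \<le> q"
    have fm: "{x..y} \<in> fmeasurable lborel" by (auto simp: fmeasurable_def emeasure_lborel_Icc_eq)
    have eq: "A \<inter> {p..q} \<inter> {x..y} = {x..y} - ({x..y} - A)" using xy by auto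
    have "measure lborel (A \<inter> {p..q} \<inter> {x..y}) = measure lborel {x..y} - measure lborel ({x..y} - A)"
      unfolding eq using A by (intro measurable_measure_Diff fm) auto
    also have "\<dots> \<le> c * (y - x)"
    proof (cases "x = y")
      case False
      have "h / (4 * dist_const) * (y - x) \<le> measure lborel ({x..y} - A)" using lower[of x y] xy False by simp
      hence "measure lborel {x..y} - measure lborel ({x..y} - A) \<le> (1 - h / (4 * dist_const)) * (y - x)"
        using xy by (simp add: algebra_simps)
      also have "\<dots> \<le> c * (y - x)" using xy by (intro mult_right_mono) (auto simp: c_def)
      finally show ?thesis .
    qed simp
    finally have *: "measure lborel (A \<inter> {p..q} \<inter> {x..y}) \<le> c * (y - x)" .
    have "A \<inter> {p..q} \<inter> {x..y} \<in> fmeasurable lborel"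
      by (rule fmeasurableI2[OF fm]) (use A in auto)
    thus "emeasure lborel (A \<inter> {p..q} \<inter> {x..y}) \<le> ennreal (c * (y - x))"
      using * by (simp add: emeasure_eq_measure2 ennreal_leI)
  qed (use A c in auto)
  moreover have fm: "A \<inter> {p..q} \<in> fmeasurable lborel"
    by (rule fmeasurableI2[of "{p..q}"]) (use A in \<open>auto simp: fmeasurable_def emeasure_lborel_Icc_eq\<close>)
  ultimately have "measure lborel (A \<inter> {p..q}) \<le> c * measure lborel (A \<inter> {p..q})"
    using c by (simp add: emeasure_eq_measure2)
  hence "(1 - c) * measure lborel (A \<inter> {p..q}) \<le> 0" by (simp add: algebra_simps)
  hence "measure lborel (A \<inter> {p..q}) \<le> 0" using c by (simp add: mult_le_0_iff)
  hence "measure lborel (A \<inter> {p..q}) = 0" by (intro order_antisym measure_nonneg)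
  thus ?thesis unfolding emeasure_eq_measure2[OF fm] by simp
qed

end

section \<open>Uniqueness of the absolutely continuous invariant measure\<close>

lemma sets_lebesgue01: "A \<in> sets lebesgue01 \<longleftrightarrow> A \<in> sets borel \<and> A \<subseteq> {0..1}"
  unfolding lebesgue01_def by (subst sets_restrict_space_iff) auto

lemma space_lebesgue01 [simp]: "space lebesgue01 = {0..1}"
  by (simp add: lebesgue01_def space_restrict_space)

lemma emeasure_lebesgue01: "A \<in> sets lebesgue01 \<Longrightarrow> emeasure lebesgue01 A = emeasure lborel A"
  unfolding sets_lebesgue01 unfolding lebesgue01_def by (auto intro: emeasure_restrict_space)

lemma null_sets_lebesgue01: "N \<in> null_sets lebesgue01 \<longleftrightarrow> N \<in> null_sets lborel \<and> N \<subseteq> {0..1}"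
  using emeasure_lebesgue01[of N] sets_lebesgue01[of N] by (auto simp: null_sets_def)

lemma finite_lebesgue01: "finite_measure lebesgue01"
proof
  have "{0..1::real} \<in> sets lebesgue01" by (auto simp: sets_lebesgue01)
  thus "emeasure lebesgue01 (space lebesgue01) \<noteq> \<infinity>" by (simp add: emeasure_lebesgue01)
qed

lemma borel_measurable_lebesgue01:
  assumes "continuous_on {0..1} f"
  shows "f \<in> borel_measurable lebesgue01"
  unfolding lebesgue01_def using borel_measurable_continuous_on_restrict[OF assms]
  by (subst measurable_cong_sets[OF sets_restrict_space_cong[OF sets_lborel] refl])

lemma measurable_lebesgue01:
  assumes "continuous_on {0..1} T" "T ` {0..1} \<subseteq> {0..1}"
  shows "T \<in> measurable lebesgue01 lebesgue01"
proof -
  have "T \<in> measurable lebesgue01 lborel" using borel_measurable_lebesgue01[OF assms(1)] by simp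
  thus ?thesis using assms(2)
    by (subst (2) lebesgue01_def) (simp add: measurable_restrict_space2_iff Pi_iff image_subset_iff)
qed

lemma emeasure_le_diameter:
  assumes "S \<in> sets borel" "S \<subseteq> {u..v}" "0 \<le> d" "\<And>a b. a \<in> S \<Longrightarrow> b \<in> S \<Longrightarrow> \<bar>a - b\<bar> \<le> (d::real)"
  shows "emeasure lborel S \<le> ennreal d"
proof (cases "S = {}")
  case False
  have bdd: "bdd_below S" using assms(2) by (meson bdd_below_Icc bdd_below_mono)
  have "S \<subseteq> {Inf S..Inf S + d}"
  proof
    fix a assume a: "a \<in> S"
    have "Inf S \<le> a" using cInf_lower[OF a bdd] .
    moreover have "a - d \<le> Inf S"     proof (rule cInf_greatest[OF False])
      fix b assume "b \<in> S"
      from assms(4)[OF a this] show "a - d \<le> b" by simp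
    qed
    ultimately show "a \<in> {Inf S..Inf S + d}" by auto
  qed
  hence "emeasure lborel S \<le> emeasure lborel {Inf S..Inf S + d}" by (rule emeasure_mono) simp
  also have "\<dots> = ennreal d" using assms(3) by simp
  finally show ?thesis .
qed simp

text \<open>The preimage of an interval has one part on each side of \<open>c\<close>, of diameter
  at most the length of the interval; hence the 2. Null sets follow from intervals by
  \<open>measure_le_of_intervals\<close>.\<close>

lemma expanding_nonsingular:
  assumes cont: "continuous_on {0..1} T" and range: "T ` {0..1} \<subseteq> {0..1}"
    and exp: "\<And>x y. x \<in> {0..1} \<Longrightarrow> y \<in> {0..1} \<Longrightarrow> (x \<le> c \<and> y \<le> c) \<or> (c \<le> x \<and> c \<le> y) \<Longrightarrow> \<bar>x - y\<bar> \<le> \<bar>T x - T y\<bar>"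
    and N: "N \<in> null_sets lebesgue01"
  shows "T -` N \<inter> {0..1} \<in> null_sets lebesgue01"
proof -
  define \<mu> where "\<mu> = distr lebesgue01 borel T"
  have Tm: "T \<in> measurable lebesgue01 borel" by (rule borel_measurable_lebesgue01[OF cont])
  have mu: "emeasure \<mu> S = emeasure lebesgue01 (T -` S \<inter> {0..1})" if "S \<in> sets borel" for S
    using that Tm by (simp add: \<mu>_def emeasure_distr)
  have pre: "T -` S \<inter> {0..1} \<in> sets lebesgue01" if "S \<in> sets borel" for S
    using measurable_sets[OF Tm that] by simp
  have "emeasure \<mu> N \<le> ennreal (2 * measure lborel N)"
  proof (rule measure_le_of_intervals[where u = 0 and v = 1])
    fix x y :: real assume xy: "0 \<le> x" "x \<le> y" "y \<le> 1"
    have half: "emeasure lborel (T -` {x..y} \<inter> {0..1} \<inter> K) \<le> ennreal (y - x)"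
      if K: "K \<in> sets borel" "(\<forall>z\<in>K. z \<le> c) \<or> (\<forall>z\<in>K. c \<le> z)" for K
    proof (rule emeasure_le_diameter[where u = 0 and v = 1])
      have "T -` {x..y} \<inter> {0..1} \<in> sets borel" using pre[of "{x..y}"] by (simp add: sets_lebesgue01)
      thus "T -` {x..y} \<inter> {0..1} \<inter> K \<in> sets borel" using K(1) by blast
      fix a b assume ab: "a \<in> T -` {x..y} \<inter> {0..1} \<inter> K" "b \<in> T -` {x..y} \<inter> {0..1} \<inter> K"
      have "\<bar>a - b\<bar> \<le> \<bar>T a - T b\<bar>" using ab K(2) by (intro exp) auto
      also have "\<dots> \<le> y - x" using ab by (auto simp: abs_le_iff)
      finally show "\<bar>a - b\<bar> \<le> y - x" .
    qed (use xy in auto)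
    have "emeasure \<mu> (N \<inter> {x..y}) \<le> emeasure \<mu> {x..y}" by (rule emeasure_mono) (auto simp: \<mu>_def)
    also have "\<dots> = emeasure lebesgue01 (T -` {x..y} \<inter> {0..1})" by (rule mu) simp
    also have "\<dots> = emeasure lborel (T -` {x..y} \<inter> {0..1})" by (rule emeasure_lebesgue01[OF pre]) simp
    also have "\<dots> = emeasure lborel ((T -` {x..y} \<inter> {0..1} \<inter> {..c}) \<union> (T -` {x..y} \<inter> {0..1} \<inter> {c..}))"
      by (rule arg_cong[of _ _ "emeasure lborel"]) auto
    also have "\<dots> \<le> emeasure lborel (T -` {x..y} \<inter> {0..1} \<inter> {..c}) + emeasure lborel (T -` {x..y} \<inter> {0..1} \<inter> {c..})"
      using pre[of "{x..y}"] by (intro emeasure_subadditive) (auto simp: sets_lebesgue01)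
    also have "\<dots> \<le> ennreal (y - x) + ennreal (y - x)" by (intro add_mono half) auto
    also have "\<dots> = ennreal (2 * (y - x))" using xy by (simp flip: ennreal_plus)
    finally show "emeasure \<mu> (N \<inter> {x..y}) \<le> ennreal (2 * (y - x))" .
  qed (use N in \<open>auto simp: \<mu>_def null_sets_lebesgue01\<close>)
  also have "measure lborel N = 0" using N by (simp add: null_sets_lebesgue01 measure_eq_0_null_sets)
  finally have "emeasure \<mu> N = 0" by simp
  moreover have "N \<in> sets borel" using N by (auto simp: null_sets_lebesgue01)
  ultimately show ?thesis using mu pre by auto
qed

lemma funpow_mem: "T ` S \<subseteq> S \<Longrightarrow> x \<in> S \<Longrightarrow> (T ^^ n) x \<in> (S :: 'a set)"
  by (induction n) auto

lemma continuous_on_funpow: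
  assumes "continuous_on S T" "T ` S \<subseteq> S"
  shows "continuous_on S (T ^^ n)"
proof (induction n)
  case (Suc n)
  have "continuous_on S (T \<circ> (T ^^ n))"
    using Suc continuous_on_subset[OF assms(1)] funpow_mem[OF assms(2)]
    by (intro continuous_on_compose) blast+
  thus ?case by (simp add: o_def)
qed (simp add: continuous_on_id)

lemma nonsingular_funpow:
  assumes range: "T ` {0..1} \<subseteq> {0..1}"
    and "\<And>N. N \<in> null_sets lebesgue01 \<Longrightarrow> T -` N \<inter> {0..1} \<in> null_sets lebesgue01"
    and N: "N \<in> null_sets lebesgue01"
  shows "(T ^^ n) -` N \<inter> {0..1} \<in> null_sets lebesgue01"
proof (induction n)
  case 0 thus ?case using N by (simp add: null_sets_lebesgue01 Int_absorb2)
next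
  case (Suc n)
  have "(T ^^ Suc n) -` N \<inter> {0..1} = T -` ((T ^^ n) -` N \<inter> {0..1}) \<inter> {0..1}"
    using range by (auto simp: funpow_swap1)
  thus ?case using assms(2)[OF Suc] by (simp del: funpow.simps)
qed

locale nonsingular_ergodic =
  fixes T :: "real \<Rightarrow> real"
  assumes cont: "continuous_on {0..1} T" and range: "T ` {0..1} \<subseteq> {0..1}"
    and nonsing: "N \<in> null_sets lebesgue01 \<Longrightarrow> T -` N \<inter> {0..1} \<in> null_sets lebesgue01"
    and ergodic: "A \<in> sets lebesgue01 \<Longrightarrow> (\<And>x. x \<in> {0..1} \<Longrightarrow> T x \<in> A \<longleftrightarrow> x \<in> A) \<Longrightarrow>
        A \<in> null_sets lebesgue01 \<or> {0..1} - A \<in> null_sets lebesgue01"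
begin

lemma T_measurable: "T \<in> measurable lebesgue01 lebesgue01"
  by (rule measurable_lebesgue01[OF cont range])

lemma Tn_measurable: "T ^^ n \<in> measurable lebesgue01 lebesgue01"
  by (rule measurable_compose_n[OF T_measurable])

lemma Tn_in: "x \<in> {0..1} \<Longrightarrow> (T ^^ n) x \<in> {0..1}"
  using range by (rule funpow_mem)

lemma nonsing_n: "N \<in> null_sets lebesgue01 \<Longrightarrow> (T ^^ n) -` N \<inter> {0..1} \<in> null_sets lebesgue01"
  using range nonsing by (rule nonsingular_funpow)

lemma preimage_measure:
  assumes "acip T \<mu>" "E \<in> sets lebesgue01"
  shows "emeasure \<mu> ((T ^^ n) -` E \<inter> {0..1}) = emeasure \<mu> E"
proof (induction n)
  have sp: "sets \<mu> = sets lebesgue01" "space \<mu> = {0..1}" and inv: "distr \<mu> \<mu> T = \<mu>" and Tm: "T \<in> measurable \<mu> \<mu>"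
    using assms by (auto simp: acip_def invariant_prob_def dest: sets_eq_imp_space_eq)
  {
    case 0 show ?case using assms(2) by (simp add: sets_lebesgue01 Int_absorb2)
  next
    case (Suc n)
    have S: "(T ^^ n) -` E \<inter> {0..1} \<in> sets \<mu>" using measurable_sets[OF Tn_measurable assms(2)] by (simp add: sp)
    have "(T ^^ Suc n) -` E \<inter> {0..1} = T -` ((T ^^ n) -` E \<inter> {0..1}) \<inter> space \<mu>"
      using range by (auto simp: funpow_swap1 sp)
    hence "emeasure \<mu> ((T ^^ Suc n) -` E \<inter> {0..1}) = emeasure (distr \<mu> \<mu> T) ((T ^^ n) -` E \<inter> {0..1})"
      using emeasure_distr[OF Tm S] by simp
    thus ?case using inv Suc by (simp del: funpow.simps)
  }
qed

text \<open>The set where one density exceeds the other is forward invariant up to a null set, since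
  the positive part of an invariant signed measure is invariant; ergodicity leaves no room for it.\<close>

lemma acip_density_le:
  assumes mu: "acip T (density lebesgue01 f)" and nu: "acip T (density lebesgue01 g)"
    and f [measurable]: "f \<in> borel_measurable lebesgue01" and g [measurable]: "g \<in> borel_measurable lebesgue01"
  shows "AE x in lebesgue01. f x \<le> (g x :: ennreal)"
proof -
  define M where "M = lebesgue01"
  define \<mu> \<nu> where "\<mu> = density M f" and "\<nu> = density M g"
  note fg = f[folded M_def] g[folded M_def]
  have ac: "acip T \<mu>" "acip T \<nu>" using mu nu by (auto simp: \<mu>_def \<nu>_def M_def)
  interpret mu: prob_space \<mu> using ac by (simp add: acip_def invariant_prob_def)
  interpret nu: prob_space \<nu> using ac by (simp add: acip_def invariant_prob_def)
  have sp: "space \<mu> = {0..1}" "space \<nu> = {0..1}" "space M = {0..1}" "sets \<mu> = sets M" "sets \<nu> = sets M"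
    by (simp_all add: \<mu>_def \<nu>_def M_def)
  define E where "E = {x \<in> space M. g x < f x}"
  have E: "E \<in> sets M" unfolding E_def using fg by measurable
  define P where "P n = (T ^^ n) -` E \<inter> {0..1}" for n
  have P: "P n \<in> sets M" for n
    using measurable_sets[OF Tn_measurable E[unfolded M_def]] by (simp add: P_def M_def)
  have muP: "measure \<mu> (P n) = measure \<mu> E" and nuP: "measure \<nu> (P n) = measure \<nu> E" for n
    using preimage_measure[OF ac(1)] preimage_measure[OF ac(2)] E by (simp_all add: measure_def P_def M_def)
  \<comment> \<open>On \<open>E\<close> the density \<open>f\<close> is strictly larger, so a subset
    to which \<open>\<mu>\<close> gives no more mass than \<open>\<nu>\<close> is Lebesgue
    null.\<close>
  have null: "K \<in> null_sets M" if K: "K \<in> sets M" "K \<subseteq> E" "emeasure \<mu> K \<le> emeasure \<nu> K" for K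
  proof (rule ccontr)
    assume "K \<notin> null_sets M"
    have fK: "emeasure \<mu> K = (\<integral>\<^sup>+x. f x * indicator K x \<partial>M)" "emeasure \<nu> K = (\<integral>\<^sup>+x. g x * indicator K x \<partial>M)"
      using K(1) fg by (simp_all add: \<mu>_def \<nu>_def emeasure_density)
    have "(\<integral>\<^sup>+x. g x * indicator K x \<partial>M) < (\<integral>\<^sup>+x. f x * indicator K x \<partial>M)"
    proof (rule nn_integral_less)
      show "(\<integral>\<^sup>+x. g x * indicator K x \<partial>M) \<noteq> \<infinity>" using fK(2) nu.emeasure_finite[of K] by simp
      show "AE x in M. g x * indicator K x \<le> f x * indicator K x"
        using K(2) by (intro AE_I2) (auto simp: E_def indicator_def)
      show "\<not> (AE x in M. f x * indicator K x \<le> g x * indicator K x)"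
      proof
        assume "AE x in M. f x * indicator K x \<le> g x * indicator K x"
        hence "AE x in M. x \<notin> K"
          by eventually_elim (use K(2) in \<open>auto simp: E_def indicator_def split: if_splits\<close>)
        hence "K \<in> null_sets M" using AE_iff_null_sets[OF K(1)] by simp
        thus False using \<open>K \<notin> null_sets M\<close> by simp
      qed
    qed (use K(1) fg in measurable)
    thus False using K(3) fK by simp
  qed
  \<comment> \<open>\<open>D\<close> is what leaves \<open>E\<close> in one step. By invariance it
    has the measure of what enters, for both \<open>\<mu>\<close> and \<open>\<nu>\<close>; outside
    \<open>E\<close> the measure \<open>\<mu>\<close> does not exceed \<open>\<nu>\<close>, so
    \<open>null\<close> applies.\<close>
  define D where "D = E - P 1"
  have D: "D \<in> null_sets M"
  proof (rule null)
    show "D \<in> sets M" "D \<subseteq> E" using E P by (auto simp: D_def)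
    have out: "measure \<mu> (P 1 - E) \<le> measure \<nu> (P 1 - E)"
    proof -
      have "emeasure \<mu> (P 1 - E) = (\<integral>\<^sup>+x. f x * indicator (P 1 - E) x \<partial>M)"
        "emeasure \<nu> (P 1 - E) = (\<integral>\<^sup>+x. g x * indicator (P 1 - E) x \<partial>M)"
        using P E fg by (simp_all add: \<mu>_def \<nu>_def emeasure_density)
      moreover have "(\<integral>\<^sup>+x. f x * indicator (P 1 - E) x \<partial>M) \<le> (\<integral>\<^sup>+x. g x * indicator (P 1 - E) x \<partial>M)"
        by (intro nn_integral_mono) (auto simp: indicator_def E_def)
      ultimately have "emeasure \<mu> (P 1 - E) \<le> emeasure \<nu> (P 1 - E)" by simp
      thus ?thesis by (simp add: mu.emeasure_eq_measure nu.emeasure_eq_measure)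
    qed
    have "measure \<mu> D = measure \<mu> (P 1 - E)"
      using mu.finite_measure_Diff'[of E "P 1"] mu.finite_measure_Diff'[of "P 1" E] E P muP[of 1]
      by (simp add: D_def sp Int_commute)
    moreover have "measure \<nu> D = measure \<nu> (P 1 - E)"
      using nu.finite_measure_Diff'[of E "P 1"] nu.finite_measure_Diff'[of "P 1" E] E P nuP[of 1]
      by (simp add: D_def sp Int_commute)
    ultimately show "emeasure \<mu> D \<le> emeasure \<nu> D"
      using out by (simp add: mu.emeasure_eq_measure nu.emeasure_eq_measure)
  qed
  define E0 where "E0 = (\<Inter>n. P n)"
  \<comment> \<open>\<open>E\<close> is forward invariant only up to a null set, while
    \<open>ergodic\<close> asks for exact invariance; the points whose orbits end up in
    \<open>E\<close> form an exactly invariant set.\<close>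
  define A where "A = {x \<in> {0..1}. \<exists>m. \<forall>n\<ge>m. (T ^^ n) x \<in> E}"
  have A_eq: "A = (\<Union>m. \<Inter>n\<in>{m..}. P n)" by (auto simp: A_def P_def)
  have A: "A \<in> sets M" unfolding A_eq using P by (intro sets.countable_UN sets.countable_INT') auto
  have E0s: "E0 \<in> sets M" unfolding E0_def using P by (intro sets.countable_INT) auto
  have E0_A: "E0 \<subseteq> A" by (auto simp: A_eq E0_def)
  have E_E0: "E - E0 \<in> null_sets M"
  proof (rule null_sets_subset)
    show "(\<Union>n. (T ^^ n) -` D \<inter> {0..1}) \<in> null_sets M"
      using nonsing_n D by (intro null_sets_UN) (auto simp: M_def)
    show "E - E0 \<subseteq> (\<Union>n. (T ^^ n) -` D \<inter> {0..1})"
    proof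
      fix x assume x: "x \<in> E - E0"
      have x01: "x \<in> {0..1}" using x by (auto simp: E_def sp)
      hence ex: "\<exists>n. (T ^^ n) x \<notin> E" using x by (auto simp: E0_def P_def)
      define n where "n = (LEAST n. (T ^^ n) x \<notin> E)"
      have n: "(T ^^ n) x \<notin> E" unfolding n_def using ex by (rule LeastI_ex)
      have "n \<noteq> 0" using n x by (intro notI) simp
      then obtain k where k: "n = Suc k" by (cases n) auto
      have "(T ^^ k) x \<in> E" using not_less_Least[of k "\<lambda>n. (T ^^ n) x \<notin> E"] k by (simp add: n_def)
      hence "(T ^^ k) x \<in> D" using n k Tn_in[OF x01] by (auto simp: D_def P_def)
      thus "x \<in> (\<Union>n. (T ^^ n) -` D \<inter> {0..1})" using x01 by auto
    qed
  qed (use E E0s in auto)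
  have "A \<in> null_sets M \<or> {0..1} - A \<in> null_sets M"
    unfolding M_def
  proof (rule ergodic)
    show "A \<in> sets lebesgue01" using A by (simp add: M_def)
    fix x :: real assume x: "x \<in> {0..1}"
    hence "T x \<in> {0..1}" using range by blast
    moreover have "(\<exists>m. \<forall>n\<ge>m. (T ^^ n) (T x) \<in> E) \<longleftrightarrow> (\<exists>m. \<forall>n\<ge>m. (T ^^ n) x \<in> E)"
    proof
      assume "\<exists>m. \<forall>n\<ge>m. (T ^^ n) (T x) \<in> E"
      then obtain m where m: "\<And>n. n \<ge> m \<Longrightarrow> (T ^^ n) (T x) \<in> E" by blast
      have "(T ^^ n) x \<in> E" if n: "n \<ge> Suc m" for n
      proof -
        obtain j where j: "n = Suc j" using n by (cases n) auto
        show ?thesis using m[of j] n by (simp add: j funpow_swap1)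
      qed
      thus "\<exists>m. \<forall>n\<ge>m. (T ^^ n) x \<in> E" by blast
    next
      assume "\<exists>m. \<forall>n\<ge>m. (T ^^ n) x \<in> E"
      then obtain m where m: "\<And>n. n \<ge> m \<Longrightarrow> (T ^^ n) x \<in> E" by blast
      have "(T ^^ n) (T x) \<in> E" if n: "n \<ge> m" for n
        using m[of "Suc n"] n by (simp add: funpow_swap1)
      thus "\<exists>m. \<forall>n\<ge>m. (T ^^ n) (T x) \<in> E" by blast
    qed
    ultimately show "T x \<in> A \<longleftrightarrow> x \<in> A" using x by (simp add: A_def)
  qed
  hence "E \<in> null_sets M"
  proof
    assume "A \<in> null_sets M"
    hence "E0 \<in> null_sets M" by (rule null_sets_subset[OF _ E0s E0_A])
    hence "E0 \<union> (E - E0) \<in> null_sets M" using E_E0 by (rule null_sets.Un)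
    thus ?thesis by (rule null_sets_subset) (use E in auto)
  next
    assume Ac: "{0..1} - A \<in> null_sets M"
    have ac_null: "K \<in> null_sets \<mu>" "K \<in> null_sets \<nu>" if "K \<in> null_sets M" for K
      using ac that by (auto simp: acip_def absolutely_continuous_def M_def)
    \<comment> \<open>Invariance balances leaving against entering, so the points that enter
      \<open>E\<close> in \<open>n\<close> steps are null too. As almost every orbit ends up in
      \<open>E\<close>, almost every point is in \<open>E\<close>. Then both measures give
      \<open>E\<close> mass 1, and \<open>null\<close> applies to \<open>E\<close> itself.\<close>
    have full: "measure \<kappa> E = 1" if k: "prob_space \<kappa>" "sets \<kappa> = sets M" "\<And>n. measure \<kappa> (P n) = measure \<kappa> E"
      "\<And>K. K \<in> null_sets M \<Longrightarrow> K \<in> null_sets \<kappa>" for \<kappa>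
    proof -
      interpret k: prob_space \<kappa> by fact
      have spk: "space \<kappa> = {0..1}" using sets_eq_imp_space_eq[OF k(2)] sp by simp
      have PE: "P n - E \<in> null_sets \<kappa>" for n
      proof -
        have "E - P n \<in> null_sets M" using E_E0 by (rule null_sets_subset) (use E P in \<open>auto simp: E0_def\<close>)
        hence "measure \<kappa> (E - P n) = 0" using k(4) by (simp add: measure_eq_0_null_sets)
        hence "measure \<kappa> (P n - E) = 0"
          using k.finite_measure_Diff'[of E "P n"] k.finite_measure_Diff'[of "P n" E] E P k(3)[of n] k(2)
          by (simp add: Int_commute)
        thus ?thesis using E P k(2) by (auto simp: null_sets_def k.emeasure_eq_measure)
      qed
      have "(\<Union>n. P n - E) \<union> ({0..1} - A) \<in> null_sets \<kappa>"
        using PE k(4)[OF Ac] by (intro null_sets.Un null_sets_UN)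
      hence "space \<kappa> - E \<in> null_sets \<kappa>"
      proof (rule null_sets_subset)
        show "space \<kappa> - E \<in> sets \<kappa>" using E k(2) by auto
        show "space \<kappa> - E \<subseteq> (\<Union>n. P n - E) \<union> ({0..1} - A)" by (auto simp: A_eq spk)
      qed
      hence "measure \<kappa> (space \<kappa> - E) = 0" by (rule measure_eq_0_null_sets)
      thus ?thesis using k.prob_compl[of E] E k(2) by simp
    qed
    have "measure \<mu> E = 1" "measure \<nu> E = 1"
      using full[of \<mu>] full[of \<nu>] ac_null muP nuP sp mu.prob_space_axioms nu.prob_space_axioms by auto
    hence "emeasure \<mu> E \<le> emeasure \<nu> E" by (simp add: mu.emeasure_eq_measure nu.emeasure_eq_measure)
    thus ?thesis by (intro null E subset_refl)
  qed
  hence "AE x in M. x \<notin> E" by (rule AE_not_in)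
  hence "AE x in M. f x \<le> g x" using AE_space[of M] by eventually_elim (auto simp: E_def)
  thus ?thesis unfolding M_def .
qed

theorem acip_unique:
  assumes "acip T \<mu>" "acip T \<nu>"
  shows "\<mu> = \<nu>"
proof -
  interpret L: finite_measure lebesgue01 by (rule finite_lebesgue01)
  have *: "\<exists>f\<in>borel_measurable lebesgue01. density lebesgue01 f = \<mu>" if "acip T \<mu>" for \<mu>
    using that by (intro L.Radon_Nikodym_finite_measure)
      (auto simp: acip_def invariant_prob_def prob_space_def)
  obtain f g where fg: "f \<in> borel_measurable lebesgue01" "g \<in> borel_measurable lebesgue01"
    "density lebesgue01 f = \<mu>" "density lebesgue01 g = \<nu>" using *[OF assms(1)] *[OF assms(2)] by blast
  have "AE x in lebesgue01. f x \<le> g x" "AE x in lebesgue01. g x \<le> f x"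
    using acip_density_le[of f g] acip_density_le[of g f] fg assms by auto
  hence "AE x in lebesgue01. f x = g x" by eventually_elim (rule order_antisym)
  thus ?thesis using density_cong[OF fg(1,2)] fg(3,4) by simp
qed

end

section \<open>Typical points from frequency bounds\<close>

text \<open>Weak limits are taken on the whole line; composing with this retraction extends
  functions on \<open>{0..1}\<close> continuously without altering them along orbits.\<close>

definition clamp01 :: "real \<Rightarrow> real" where "clamp01 z = max 0 (min 1 z)"

lemma clamp01: "clamp01 z \<in> {0..1}" "z \<in> {0..1} \<Longrightarrow> clamp01 z = z"
  by (auto simp: clamp01_def)

lemma continuous_clamp01:
  assumes "continuous_on {0..1} f"
  shows "continuous_on UNIV (\<lambda>z. f (clamp01 z))"
proof (rule continuous_on_compose2[OF assms])
  show "continuous_on UNIV clamp01" unfolding clamp01_def by (intro continuous_intros)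
qed (use clamp01 in auto)

locale orbit_frequency =
  fixes T :: "real \<Rightarrow> real" and x C :: real
  assumes cont: "continuous_on {0..1} T" and range: "T ` {0..1} \<subseteq> {0..1}" and x: "x \<in> {0..1}"
    and C: "0 < C"
    and freq: "r \<in> \<rat> \<Longrightarrow> t \<in> \<rat> \<Longrightarrow> r < t \<Longrightarrow>
        \<forall>\<^sub>F n in sequentially. real (card {i. i < n \<and> (T ^^ i) x \<in> {r..t}}) \<le> C * (t - r) * n"
begin

text \<open>The index is shifted by one against \<open>empirical_measure\<close>, so that
  \<open>rho 0\<close> is a probability measure too, and the measure lives on the line instead of
  \<open>{0..1}\<close>.\<close>

definition rho :: "nat \<Rightarrow> real measure" where
  "rho n = distr (uniform_count_measure {..<Suc n}) borel (\<lambda>i. (T ^^ i) x)"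

lemma orbit_in: "(T ^^ i) x \<in> {0..1}"
  using range x by (rule funpow_mem)

lemma measurable_ucm: "(\<And>i. i \<in> A \<Longrightarrow> f i \<in> space N) \<Longrightarrow> f \<in> measurable (uniform_count_measure A) N"
  by (rule measurableI) (auto simp: space_uniform_count_measure sets_uniform_count_measure)

lemma rho_real_distribution: "real_distribution (rho n)"
proof -
  interpret prob_space "uniform_count_measure {..<Suc n}"
    by (rule prob_space_uniform_count_measure) auto
  show ?thesis unfolding rho_def
    by (rule real_distribution_distr) (auto intro: measurable_ucm)
qed

lemma rho_integral:
  fixes f :: "real \<Rightarrow> 'a :: {banach, second_countable_topology}"
  assumes "f \<in> borel_measurable borel"
  shows "integral\<^sup>L (rho n) f = (\<Sum>i<Suc n. f ((T ^^ i) x)) /\<^sub>R real (Suc n)"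
proof -
  have "integral\<^sup>L (rho n) f = integral\<^sup>L (uniform_count_measure {..<Suc n}) (\<lambda>i. f ((T ^^ i) x))"
    unfolding rho_def by (rule integral_distr) (auto intro: measurable_ucm assms)
  also have "\<dots> = (\<Sum>i<Suc n. f ((T ^^ i) x)) /\<^sub>R real (Suc n)"
    unfolding uniform_count_measure_def
    by (subst lebesgue_integral_point_measure_finite) (auto simp: scaleR_sum_right inverse_eq_divide scaleR_add_right)
  finally show ?thesis .
qed

lemma tight_rho: "tight rho"
  unfolding tight_def
proof (intro conjI allI impI rho_real_distribution)
  fix e :: real assume e: "0 < e"
  have "measure (rho n) {-1<..2} = 1" for n
  proof -
    interpret r: real_distribution "rho n" by (rule rho_real_distribution)
    have "measure (rho n) {-1<..2} = integral\<^sup>L (rho n) (indicator {-1<..2})" by simp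
    also have "\<dots> = (\<Sum>i<Suc n. indicator {-1<..2} ((T ^^ i) x)) /\<^sub>R real (Suc n)"
      by (rule rho_integral) simp
    also have "(\<Sum>i<Suc n. indicator {-1<..2} ((T ^^ i) x)) = (\<Sum>i<Suc n. 1::real)"
      by (intro sum.cong refl) (use orbit_in in \<open>auto simp: indicator_def\<close>, (smt (verit) atLeastAtMost_iff)+)
    finally show ?thesis by simp
  qed
  thus "\<exists>a b. a < b \<and> (\<forall>n. 1 - e < measure (rho n) {a<..b})"
    using e by (intro exI[of _ "-1"] exI[of _ 2]) auto
qed

lemma rho_interval:
  assumes "r \<in> \<rat>" "t \<in> \<rat>" "r < t"
  shows "\<forall>\<^sub>F n in sequentially. measure (rho n) {r..t} \<le> C * (t - r)"
proof -
  have "\<forall>\<^sub>F n in sequentially. real (card {i. i < Suc n \<and> (T ^^ i) x \<in> {r..t}}) \<le> C * (t - r) * Suc n"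
    using freq[OF assms] by (subst eventually_sequentially_Suc)
  thus ?thesis
  proof eventually_elim
    case (elim n)
    interpret rd: real_distribution "rho n" by (rule rho_real_distribution)
    have "measure (rho n) {r..t} = integral\<^sup>L (rho n) (indicator {r..t})" by simp
    also have "\<dots> = (\<Sum>i<Suc n. indicator {r..t} ((T ^^ i) x)) /\<^sub>R real (Suc n)"
      by (rule rho_integral) simp
    also have "(\<Sum>i<Suc n. indicator {r..t} ((T ^^ i) x)) = (\<Sum>i\<in>{i. i < Suc n \<and> (T ^^ i) x \<in> {r..t}}. 1::real)"
      by (intro sum.mono_neutral_cong_right) (auto simp: indicator_def)
    finally have "measure (rho n) {r..t} = real (card {i. i < Suc n \<and> (T ^^ i) x \<in> {r..t}}) / real (Suc n)"
      by (simp add: divide_inverse mult.commute)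
    also have "\<dots> \<le> C * (t - r)" using elim by (simp add: pos_divide_le_eq)
    finally show ?case .
  qed
qed

section \<open>Weak limits of the empirical measures along a subsequence\<close>

context
  fixes s :: "nat \<Rightarrow> nat" and \<nu> :: "real measure"
  assumes s: "strict_mono s" and nu: "real_distribution \<nu>" and conv: "weak_conv_m (rho \<circ> s) \<nu>"
begin

interpretation nu: real_distribution \<nu> by (rule nu)

lemma lim_integral:
  fixes f :: "real \<Rightarrow> 'a :: {banach, second_countable_topology}"
  assumes "\<And>z. isCont f z" "\<And>z. norm (f z) \<le> B"
  shows "(\<lambda>n. integral\<^sup>L (rho (s n)) f) \<longlonglongrightarrow> integral\<^sup>L \<nu> f"
proof -
  have "(\<lambda>n. integral\<^sup>L ((rho \<circ> s) n) f) \<longlonglongrightarrow> integral\<^sup>L \<nu> f"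
    by (rule weak_conv_imp_integral_bdd_continuous_conv[OF _ nu conv assms])
      (simp add: rho_real_distribution)
  thus ?thesis by simp
qed

lemma limit_interval:
  assumes "a \<le> b" shows "measure \<nu> {a..b} \<le> C * (b - a)"
proof (rule field_le_epsilon)
  fix e :: real assume e: "0 < e"
  \<comment> \<open>Rational endpoints \<open>r\<close> and \<open>t\<close> are taken between
    \<open>d\<close> and \<open>2 * d\<close> outside \<open>{a..b}\<close>, which lengthens it by
    at most \<open>4 * d\<close>; the trapezoid \<open>f\<close> then separates the two indicators
    continuously.\<close>
  define d where "d = e / (4 * C)"
  have d: "0 < d" using e C by (simp add: d_def)
  obtain r where r: "r \<in> \<rat>" "a - 2 * d < r" "r < a - d" using Rats_dense_in_real[of "a - 2 * d" "a - d"] d by auto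
  obtain t where t: "t \<in> \<rat>" "b + d < t" "t < b + 2 * d" using Rats_dense_in_real[of "b + d" "b + 2 * d"] d by auto
  define f where "f z = max 0 (min 1 (1 - max (a - z) (z - b) / d))" for z
  have cf: "isCont f z" for z unfolding f_def using d by (intro continuous_intros) auto
  have bf: "norm (f z) \<le> 1" for z by (auto simp: f_def)
  have fm: "f \<in> borel_measurable borel"
    using cf by (intro borel_measurable_continuous_onI continuous_at_imp_continuous_on) auto
  have f1: "indicator {a..b} z \<le> f z" for z
  proof (cases "z \<in> {a..b}")
    case True
    hence "max (a - z) (z - b) / d \<le> 0" using d by (intro divide_nonpos_pos) auto
    thus ?thesis by (simp add: f_def indicator_def)
  qed (simp add: f_def)
  have f2: "f z \<le> indicator {r..t} z" for z
  proof (cases "z \<in> {r..t}")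
    case False
    hence "d \<le> max (a - z) (z - b)" using r t by auto
    hence "1 \<le> max (a - z) (z - b) / d" using d by simp
    thus ?thesis using False by (simp add: f_def)
  qed (simp add: f_def)
  have "measure \<nu> {a..b} = integral\<^sup>L \<nu> (indicator {a..b})" by simp
  also have "\<dots> \<le> integral\<^sup>L \<nu> f"
    by (intro integral_mono f1 nu.integrable_const_bound[of _ 1] AE_I2)
      (use bf fm in \<open>auto simp: indicator_def\<close>)
  also have "\<dots> \<le> C * (t - r)"
  proof (rule tendsto_upperbound[OF lim_integral[OF cf bf]])
    have "\<forall>\<^sub>F n in sequentially. measure (rho (s n)) {r..t} \<le> C * (t - r)"
      using rho_interval[OF r(1) t(1)] r t assms d filterlim_subseq[OF s]
      by (auto simp: filterlim_iff)
    thus "\<forall>\<^sub>F n in sequentially. integral\<^sup>L (rho (s n)) f \<le> C * (t - r)"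
    proof eventually_elim
      case (elim n)
      interpret rd: real_distribution "rho (s n)" by (rule rho_real_distribution)
      have "integral\<^sup>L (rho (s n)) f \<le> integral\<^sup>L (rho (s n)) (indicator {r..t})"
        by (intro integral_mono f2 rd.integrable_const_bound[of _ 1] AE_I2)
          (use bf fm in \<open>auto simp: indicator_def\<close>)
      thus ?case using elim by simp
    qed
  qed simp
  also have "\<dots> \<le> C * ((b - a) + 4 * d)" using r t C by (intro mult_left_mono) auto
  also have "\<dots> = C * (b - a) + e" using C by (simp add: d_def field_simps)
  finally show "measure \<nu> {a..b} \<le> C * (b - a) + e" .
qed

lemma limit_support: "AE z in \<nu>. z \<in> {0..1}"
proof -
  define g where "g z = min 1 (max 0 (max (- z) (z - 1)))" for z :: real
  have cg: "isCont g z" for z unfolding g_def by (intro continuous_intros)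
  have bg: "norm (g z) \<le> 1" "0 \<le> g z" for z by (auto simp: g_def)
  have gm: "g \<in> borel_measurable borel"
    using cg by (intro borel_measurable_continuous_onI continuous_at_imp_continuous_on) auto
  have "g ((T ^^ i) x) = 0" for i using orbit_in[of i] by (auto simp: g_def)
  hence "integral\<^sup>L (rho n) g = 0" for n by (simp add: rho_integral[OF gm])
  hence "(\<lambda>n. 0) \<longlonglongrightarrow> integral\<^sup>L \<nu> g" using lim_integral[OF cg bg(1)] by simp
  hence "integral\<^sup>L \<nu> g = 0" by (simp add: LIMSEQ_const_iff)
  moreover have "integrable \<nu> g" using bg gm by (intro nu.integrable_const_bound[of _ 1]) auto
  ultimately have "AE z in \<nu>. g z = 0" using bg(2) by (subst (asm) integral_nonneg_eq_0_iff_AE) auto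
  thus ?thesis by eventually_elim (auto simp: g_def min_def max_def split: if_splits)
qed

text \<open>Averages of a bounded function along the orbit and along the shifted orbit differ by two
  boundary terms, divided by the number of points. Exponentials suffice as test functions, since
  characteristic functions determine the measure.\<close>

lemma limit_invariant: "distr \<nu> borel (\<lambda>z. T (clamp01 z)) = \<nu>"
proof (rule Levy_uniqueness)
  let ?T = "\<lambda>z. T (clamp01 z)"
  have cT: "continuous_on UNIV ?T" by (rule continuous_clamp01[OF cont])
  have mT: "?T \<in> borel_measurable borel" by (rule borel_measurable_continuous_onI[OF cT])
  have mT': "?T \<in> measurable \<nu> borel" using mT by simp
  show "real_distribution (distr \<nu> borel ?T)" by (rule nu.real_distribution_distr[OF mT'])
  show "real_distribution \<nu>" by (rule nu)
  show "char (distr \<nu> borel ?T) = char \<nu>"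
  proof
    fix t :: real
    let ?f = "\<lambda>z. iexp (t * z)" and ?g = "\<lambda>z. iexp (t * ?T z)"
    have fm: "?f \<in> borel_measurable borel" by measurable
    have gm: "?g \<in> borel_measurable borel" using mT by measurable
    have f: "isCont ?f z" "norm (?f z) \<le> 1" for z by (auto intro!: continuous_intros)
    have cT': "isCont ?T z" for z using cT by (simp add: continuous_on_eq_continuous_at)
    have g: "isCont ?g z" "norm (?g z) \<le> 1" for z using cT' by (auto intro!: continuous_intros)
    have diff: "norm (integral\<^sup>L (rho n) ?g - integral\<^sup>L (rho n) ?f) \<le> 2 / real (Suc n)" for n
    proof -
      have "?T ((T ^^ i) x) = (T ^^ Suc i) x" for i using clamp01(2)[OF orbit_in[of i]] by simp
      hence "integral\<^sup>L (rho n) ?g - integral\<^sup>L (rho n) ?f =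
          (\<Sum>i<Suc n. ?f ((T ^^ Suc i) x) - ?f ((T ^^ i) x)) /\<^sub>R real (Suc n)"
        unfolding rho_integral[OF fm] rho_integral[OF gm] by (simp only: sum_subtractf scaleR_diff_right)
      also have "(\<Sum>i<Suc n. ?f ((T ^^ Suc i) x) - ?f ((T ^^ i) x)) = ?f ((T ^^ Suc n) x) - ?f ((T ^^ 0) x)"
        by (rule sum_lessThan_telescope)
      finally have "norm (integral\<^sup>L (rho n) ?g - integral\<^sup>L (rho n) ?f) =
          norm (?f ((T ^^ Suc n) x) - ?f ((T ^^ 0) x)) / real (Suc n)"
        by (simp only: norm_scaleR) (simp add: divide_inverse)
      also have "\<dots> \<le> 2 / real (Suc n)"
        using norm_triangle_ineq4[of "?f ((T ^^ Suc n) x)" "?f ((T ^^ 0) x)"] f(2)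
        by (intro divide_right_mono) (auto intro: order_trans)
      finally show ?thesis .
    qed
    have "(\<lambda>n. integral\<^sup>L (rho (s n)) ?g - integral\<^sup>L (rho (s n)) ?f) \<longlonglongrightarrow> 0"
    proof (rule Lim_null_comparison)
      show "\<forall>\<^sub>F n in sequentially. norm (integral\<^sup>L (rho (s n)) ?g - integral\<^sup>L (rho (s n)) ?f) \<le> 2 / real (Suc (s n))"
        using diff by simp
      have "(\<lambda>n. 2 / real (Suc n)) \<longlonglongrightarrow> 0" by (rule LIMSEQ_Suc[OF lim_const_over_n])
      from LIMSEQ_subseq_LIMSEQ[OF this s] show "(\<lambda>n. 2 / real (Suc (s n))) \<longlonglongrightarrow> 0" by (simp add: o_def)
    qed
    moreover have "(\<lambda>n. integral\<^sup>L (rho (s n)) ?g - integral\<^sup>L (rho (s n)) ?f) \<longlonglongrightarrow> integral\<^sup>L \<nu> ?g - integral\<^sup>L \<nu> ?f"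
      by (intro tendsto_diff lim_integral[OF f] lim_integral[OF g])
    ultimately have "integral\<^sup>L \<nu> ?g - integral\<^sup>L \<nu> ?f = 0" using LIMSEQ_unique by blast
    moreover have "char (distr \<nu> borel ?T) t = integral\<^sup>L \<nu> ?g"
      unfolding char_def by (rule integral_distr[OF mT' fm])
    ultimately show "char (distr \<nu> borel ?T) t = char \<nu> t" by (simp add: char_def)
  qed
qed

definition limit01 :: "real measure" where "limit01 = restrict_space \<nu> {0..1}"

lemma emeasure_limit_01: "emeasure \<nu> {0..1} = 1"
  using limit_support nu.prob_eq_1[of "{0..1}"] by (simp add: nu.emeasure_eq_measure)

lemma emeasure_limit_Int: "A \<in> sets borel \<Longrightarrow> emeasure \<nu> (A \<inter> {0..1}) = emeasure \<nu> A"
  using limit_support by (intro emeasure_eq_AE) auto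

lemma sets_limit01: "sets limit01 = sets lebesgue01"
  unfolding limit01_def lebesgue01_def by (intro sets_restrict_space_cong) simp

lemma acip_limit01: "acip T limit01"
proof -
  have space: "space limit01 = {0..1}" by (simp add: limit01_def space_restrict_space)
  have em: "emeasure limit01 A = emeasure \<nu> A" if "A \<in> sets lebesgue01" for A
    using that unfolding limit01_def sets_lebesgue01 by (intro emeasure_restrict_space) auto
  have prob: "prob_space limit01"
    by (rule prob_spaceI) (use em[of "{0..1}"] emeasure_limit_01 in \<open>simp add: space sets_lebesgue01\<close>)
  have Tm0: "T \<in> measurable lebesgue01 lebesgue01" by (rule measurable_lebesgue01[OF cont range])
  have Tm: "T \<in> measurable limit01 limit01"
    using Tm0 by (simp add: measurable_cong_sets[OF sets_limit01 sets_limit01])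
  have inv: "distr limit01 limit01 T = limit01"
  proof (rule measure_eqI)
    fix A assume "A \<in> sets (distr limit01 limit01 T)"
    hence A: "A \<in> sets lebesgue01" "A \<in> sets limit01" by (simp_all add: sets_limit01)
    have Ab: "A \<in> sets borel" using A by (simp add: sets_lebesgue01)
    let ?T = "\<lambda>z. T (clamp01 z)"
    have mT: "?T \<in> borel_measurable borel" by (intro borel_measurable_continuous_onI continuous_clamp01 cont)
    have pre: "T -` A \<inter> {0..1} \<in> sets lebesgue01" using measurable_sets[OF Tm0 A(1)] by simp
    have "emeasure (distr limit01 limit01 T) A = emeasure limit01 (T -` A \<inter> {0..1})"
      using emeasure_distr[OF Tm A(2)] by (simp add: space)
    also have "\<dots> = emeasure \<nu> (T -` A \<inter> {0..1})" by (rule em[OF pre])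
    also have "T -` A \<inter> {0..1} = ?T -` A \<inter> {0..1}" using clamp01(2) by auto
    also have "emeasure \<nu> (?T -` A \<inter> {0..1}) = emeasure \<nu> (?T -` A)"
      using measurable_sets[OF mT Ab] by (intro emeasure_limit_Int) simp
    also have "\<dots> = emeasure (distr \<nu> borel ?T) A"
      using mT Ab by (subst emeasure_distr) auto
    also have "\<dots> = emeasure \<nu> A" by (simp only: limit_invariant)
    also have "\<dots> = emeasure limit01 A" using em A by simp
    finally show "emeasure (distr limit01 limit01 T) A = emeasure limit01 A" .
  qed simp
  have "absolutely_continuous lebesgue01 limit01"
    unfolding absolutely_continuous_def
  proof
    fix N assume N: "N \<in> null_sets lebesgue01"
    have "emeasure \<nu> N \<le> ennreal (C * measure lborel N)"
    proof (rule measure_le_of_intervals[where u = 0 and v = 1])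
      fix a b :: real assume "0 \<le> a" "a \<le> b" "b \<le> 1"
      have "emeasure \<nu> (N \<inter> {a..b}) \<le> emeasure \<nu> {a..b}" by (rule emeasure_mono) auto
      also have "\<dots> \<le> ennreal (C * (b - a))"
        using limit_interval[OF \<open>a \<le> b\<close>] by (simp add: nu.emeasure_eq_measure ennreal_leI)
      finally show "emeasure \<nu> (N \<inter> {a..b}) \<le> ennreal (C * (b - a))" .
    qed (use N C in \<open>auto simp: null_sets_lebesgue01\<close>)
    also have "measure lborel N = 0" using N by (simp add: null_sets_lebesgue01 measure_eq_0_null_sets)
    finally have "emeasure \<nu> N = 0" by simp
    thus "N \<in> null_sets limit01" using N em[of N] by (auto simp: null_sets_def sets_limit01)
  qed
  thus ?thesis using prob inv Tm sets_limit01 by (simp add: acip_def invariant_prob_def)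
qed

end

text \<open>Tightness gives a limit along some subsequence, and it is already an
  \<open>acip\<close>. Uniqueness identifies all subsequential limits, so the whole sequence
  converges; existence of the measure is a by-product.\<close>

theorem typical_if_acip_unique:
  assumes unique: "\<And>\<mu> \<nu>. acip T \<mu> \<Longrightarrow> acip T \<nu> \<Longrightarrow> \<mu> = \<nu>"
  shows "\<exists>\<mu>. acip T \<mu> \<and> (\<forall>\<nu>. acip T \<nu> \<longrightarrow> \<nu> = \<mu>) \<and> typical T \<mu> x"
proof -
  obtain r \<nu>0 where r: "strict_mono r" "real_distribution \<nu>0" "weak_conv_m (rho \<circ> id \<circ> r) \<nu>0"
    using tight_imp_convergent_subsubsequence[OF tight_rho strict_mono_id] by blast
  hence r3: "weak_conv_m (rho \<circ> r) \<nu>0" by simp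
  have "weak_conv_m rho \<nu>0"
  proof (rule tight_subseq_weak_converge[OF rho_real_distribution r(2) tight_rho])
    fix s \<nu> assume s: "strict_mono s" "real_distribution \<nu>" "weak_conv_m (rho \<circ> s) \<nu>"
    have eq: "limit01 \<nu> = limit01 \<nu>0"
      by (rule unique[OF acip_limit01[OF s] acip_limit01[OF r(1,2) r3]])
    have "\<nu> = \<nu>0"
    proof (rule measure_eqI)
      interpret s: real_distribution \<nu> by fact
      interpret r: real_distribution \<nu>0 by fact
      show "sets \<nu> = sets \<nu>0" by simp
      fix A assume "A \<in> sets \<nu>"
      hence A: "A \<in> sets borel" by simp
      have "emeasure \<nu> A = emeasure \<nu> (A \<inter> {0..1})" by (rule emeasure_limit_Int[OF s A, symmetric])
      also have "\<dots> = emeasure (limit01 \<nu>) (A \<inter> {0..1})"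
        unfolding limit01_def[OF s] using A by (intro emeasure_restrict_space[symmetric]) auto
      also have "\<dots> = emeasure (limit01 \<nu>0) (A \<inter> {0..1})" by (simp only: eq)
      also have "\<dots> = emeasure \<nu>0 (A \<inter> {0..1})"
        unfolding limit01_def[OF r(1,2) r3] using A by (intro emeasure_restrict_space) auto
      also have "\<dots> = emeasure \<nu>0 A" by (rule emeasure_limit_Int[OF r(1,2) r3 A])
      finally show "emeasure \<nu> A = emeasure \<nu>0 A" .
    qed
    thus "weak_conv_m (rho \<circ> s) \<nu>0" using s by simp
  qed
  hence conv: "weak_conv_m (rho \<circ> id) \<nu>0" by simp
  note full = strict_mono_id r(2) conv
  interpret n0: real_distribution \<nu>0 by (rule r(2))
  define \<mu> where "\<mu> = limit01 \<nu>0"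
  have acip: "acip T \<mu>" unfolding \<mu>_def by (rule acip_limit01[OF full])
  have "typical T \<mu> x" unfolding typical_def weak_star_conv_def
  proof (intro allI impI)
    fix f :: "real \<Rightarrow> real" assume f: "continuous_on {0..1} f"
    let ?g = "\<lambda>z. f (clamp01 z)"
    have cg: "continuous_on UNIV ?g" by (rule continuous_clamp01[OF f])
    have cg': "isCont ?g z" for z using cg by (simp add: continuous_on_eq_continuous_at)
    have gm: "?g \<in> borel_measurable borel" by (rule borel_measurable_continuous_onI[OF cg])
    have "compact (f ` {0..1})" by (intro compact_continuous_image f) auto
    then obtain B where B: "\<And>z. z \<in> {0..1} \<Longrightarrow> norm (f z) \<le> B"
      using compact_imp_bounded bounded_iff by (metis image_eqI)
    have Bg: "norm (?g z) \<le> B" for z using B clamp01(1) by blast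
    have 1: "(\<lambda>n. integral\<^sup>L (rho n) ?g) \<longlonglongrightarrow> integral\<^sup>L \<nu>0 ?g"
      using lim_integral[OF full cg' Bg] by simp
    have fm: "f \<in> borel_measurable lebesgue01" by (rule borel_measurable_lebesgue01[OF f])
    have emp: "integral\<^sup>L (empirical_measure T x (Suc n)) f = integral\<^sup>L (rho n) ?g" for n
    proof -
      have "integral\<^sup>L (empirical_measure T x (Suc n)) f =
          integral\<^sup>L (uniform_count_measure {..<Suc n}) (\<lambda>i. f ((T ^^ i) x))"
        unfolding empirical_measure_def
        by (rule integral_distr) (use orbit_in fm in \<open>auto intro!: measurable_ucm\<close>)
      also have "\<dots> = integral\<^sup>L (uniform_count_measure {..<Suc n}) (\<lambda>i. ?g ((T ^^ i) x))"
        using clamp01(2)[OF orbit_in] by simp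
      also have "\<dots> = integral\<^sup>L (rho n) ?g"
        unfolding rho_def by (rule integral_distr[symmetric]) (auto intro: measurable_ucm gm)
      finally show ?thesis .
    qed
    have "integral\<^sup>L \<mu> f = (\<integral>z. indicator {0..1} z *\<^sub>R f z \<partial>\<nu>0)"
      unfolding \<mu>_def limit01_def[OF full] by (rule integral_restrict_space) simp
    also have "\<dots> = (\<integral>z. indicator {0..1} z *\<^sub>R ?g z \<partial>\<nu>0)"
      by (intro Bochner_Integration.integral_cong refl) (auto simp: indicator_def clamp01(2))
    also have "\<dots> = integral\<^sup>L \<nu>0 ?g"
    proof (rule integral_cong_AE)
      show "AE z in \<nu>0. indicator {0..1} z *\<^sub>R ?g z = ?g z"
        using limit_support[OF full] by eventually_elim simp
    qed (use gm in \<open>auto intro!: borel_measurable_scaleR\<close>)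
    finally have "integral\<^sup>L \<mu> f = integral\<^sup>L \<nu>0 ?g" .
    with 1 have "(\<lambda>n. integral\<^sup>L (empirical_measure T x (Suc n)) f) \<longlonglongrightarrow> integral\<^sup>L \<mu> f"
      by (simp add: emp)
    thus "(\<lambda>n. integral\<^sup>L (empirical_measure T x n) f) \<longlonglongrightarrow> integral\<^sup>L \<mu> f"
      by (rule LIMSEQ_imp_Suc)
  qed
  thus ?thesis using acip unique by blast
qed

end

section \<open>Regularity of the family\<close>

definition space_deriv :: "(real \<Rightarrow> real) \<Rightarrow> real \<Rightarrow> real" where
  "space_deriv f x = vector_derivative f (at x within {0..1})"

lemma space_deriv_eq:
  assumes "x \<in> {0..1}" "(f has_real_derivative D) (at x within {0..1})"
  shows "space_deriv f x = D"
  using vector_derivative_within_cbox[of 0 1 x f D] assms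
  by (simp add: space_deriv_def has_real_derivative_iff_has_vector_derivative)

lemma left_branch:
  assumes "pe_unimodal L f c"
  obtains f' where "\<And>x. x \<in> {0..c} \<Longrightarrow> (f has_real_derivative f' x) (at x within {0..c})"
    "L-lipschitz_on {0..c} f'"
    "\<And>x. x \<in> {0..<c} \<Longrightarrow> (f has_real_derivative space_deriv f x) (at x within {0..1})"
    "\<And>x. x \<in> {0..<c} \<Longrightarrow> space_deriv f x = f' x"
proof -
  have c: "0 < c" "c < 1" using assms by (auto simp: pe_unimodal_def)
  obtain f' where f': "\<And>x. x \<in> {0..c} \<Longrightarrow> (f has_real_derivative f' x) (at x within {0..c})"
    "L-lipschitz_on {0..c} f'" using assms unfolding pe_unimodal_def C11_on_def by blast
  have *: "(f has_real_derivative f' x) (at x within {0..1})" if "x \<in> {0..<c}" for x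
  proof -
    have "at x within {0..c} = at x within {0..1}"
      by (rule at_within_nhd[of x "{..<c}"]) (use that c in auto)
    thus ?thesis using f'(1)[of x] that by simp
  qed
  moreover have "space_deriv f x = f' x" if "x \<in> {0..<c}" for x
    using space_deriv_eq[OF _ *[OF that]] that c by simp
  ultimately show ?thesis using that[OF f'] by simp
qed

lemma right_branch:
  assumes "pe_unimodal L f c"
  obtains f' where "L-lipschitz_on {c..1} f'"
    "\<And>x. x \<in> {c<..1} \<Longrightarrow> (f has_real_derivative space_deriv f x) (at x within {0..1})"
    "\<And>x. x \<in> {c<..1} \<Longrightarrow> space_deriv f x = f' x"
proof -
  have c: "0 < c" "c < 1" using assms by (auto simp: pe_unimodal_def)
  obtain f' where f': "\<And>x. x \<in> {c..1} \<Longrightarrow> (f has_real_derivative f' x) (at x within {c..1})"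
    "L-lipschitz_on {c..1} f'" using assms unfolding pe_unimodal_def C11_on_def by blast
  have *: "(f has_real_derivative f' x) (at x within {0..1})" if "x \<in> {c<..1}" for x
  proof -
    have "at x within {c..1} = at x within {0..1}"
      by (rule at_within_nhd[of x "{c<..}"]) (use that c in auto)
    thus ?thesis using f'(1)[of x] that by simp
  qed
  moreover have "space_deriv f x = f' x" if "x \<in> {c<..1}" for x
    using space_deriv_eq[OF _ *[OF that]] that c by simp
  ultimately show ?thesis using that[OF f'(2)] by simp
qed

text \<open>\<open>lam\<close>, \<open>Lam\<close> and \<open>K\<close> are parameters separate from
  \<open>L\<close>: for the given family \<open>lam\<close> and \<open>K\<close> are the infimum and
  the supremum in the hypothesis of the theorem, for a single map \<open>K\<close> is 0.\<close>

locale unimodal_family =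
  fixes p q L :: real and T :: "real \<Rightarrow> real \<Rightarrow> real" and c :: "real \<Rightarrow> real" and lam Lam K :: real
  assumes p_less_q: "p < q" and fam: "pe_unimodal_family L {p..q} T c" and lam: "1 < lam"
    and deriv_ge: "a \<in> {p..q} \<Longrightarrow> x \<in> {0..1} \<Longrightarrow> x \<noteq> c a \<Longrightarrow> lam \<le> \<bar>space_deriv (T a) x\<bar>"
    and deriv_le: "a \<in> {p..q} \<Longrightarrow> x \<in> {0..1} \<Longrightarrow> x \<noteq> c a \<Longrightarrow> \<bar>space_deriv (T a) x\<bar> \<le> Lam"
    and K: "0 \<le> K"
    and param_lip: "a \<in> {p..q} \<Longrightarrow> b \<in> {p..q} \<Longrightarrow> x \<in> {0..1} \<Longrightarrow> \<bar>T a x - T b x\<bar> \<le> K * \<bar>a - b\<bar>"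
begin

abbreviation "D a x \<equiv> space_deriv (T a) x"

lemma unimodal: "a \<in> {p..q} \<Longrightarrow> pe_unimodal L (T a) (c a)"
  using fam by (simp add: pe_unimodal_family_def)

lemma unimodal_simps:
  assumes "a \<in> {p..q}"
  shows "x \<in> {0..1} \<Longrightarrow> T a x \<in> {0..1}" "continuous_on {0..1} (T a)" "0 < c a" "c a < 1"
    "T a (c a) = 1" "T a 1 = 0"
proof -
  note u = unimodal[OF assms, unfolded pe_unimodal_def]
  show "x \<in> {0..1} \<Longrightarrow> T a x \<in> {0..1}" using u by blast
  show "continuous_on {0..1} (T a)" "0 < c a" "c a < 1" "T a (c a) = 1" using u by auto
  from u show "T a 1 = 0" by metis
qed

lemma L_nonneg: "0 \<le> L" and c_lip_L: "a \<in> {p..q} \<Longrightarrow> b \<in> {p..q} \<Longrightarrow> \<bar>c a - c b\<bar> \<le> L * \<bar>a - b\<bar>"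
proof -
  have l: "L-lipschitz_on {p..q} c" using fam by (simp add: pe_unimodal_family_def)
  show "0 \<le> L" by (rule lipschitz_on_nonneg[OF l])
  show "a \<in> {p..q} \<Longrightarrow> b \<in> {p..q} \<Longrightarrow> \<bar>c a - c b\<bar> \<le> L * \<bar>a - b\<bar>"
    using lipschitz_onD[OF l] by (simp add: dist_real_def)
qed

lemma has_deriv:
  assumes "a \<in> {p..q}" "x \<in> {0..1}" "x \<noteq> c a"
  shows "(T a has_real_derivative D a x) (at x within {0..1})"
  using left_branch[OF unimodal[OF assms(1)]] right_branch[OF unimodal[OF assms(1)]] assms(2,3)
  by (metis atLeastAtMost_iff atLeastLessThan_iff greaterThanAtMost_iff linorder_neqE_linordered_idom)

lemma deriv_lip:
  assumes "a \<in> {p..q}" "x \<in> {0..1}" "y \<in> {0..1}" "(x < c a \<and> y < c a) \<or> (c a < x \<and> c a < y)"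
  shows "\<bar>D a x - D a y\<bar> \<le> L * \<bar>x - y\<bar>"
  using assms(4)
proof
  assume xy: "x < c a \<and> y < c a"
  obtain f' where "L-lipschitz_on {0..c a} f'" "\<And>x. x \<in> {0..<c a} \<Longrightarrow> D a x = f' x"
    using left_branch[OF unimodal[OF assms(1)]] by metis
  thus ?thesis using xy assms(2,3) lipschitz_onD[of L "{0..c a}" f' x y] by (auto simp: dist_real_def)
next
  assume xy: "c a < x \<and> c a < y"
  obtain f' where "L-lipschitz_on {c a..1} f'" "\<And>x. x \<in> {c a<..1} \<Longrightarrow> D a x = f' x"
    using right_branch[OF unimodal[OF assms(1)]] by metis
  thus ?thesis using xy assms(2,3) lipschitz_onD[of L "{c a..1}" f' x y] by (auto simp: dist_real_def)
qed

lemma deriv_param_lip: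
  assumes "a \<in> {p..q}" "b \<in> {p..q}" "x \<in> {0..1}" "\<And>\<alpha>. min a b \<le> \<alpha> \<Longrightarrow> \<alpha> \<le> max a b \<Longrightarrow> x \<noteq> c \<alpha>"
  shows "\<bar>D a x - D b x\<bar> \<le> L * \<bar>a - b\<bar>"
proof -
  let ?J = "{min a b..max a b}"
  have "?J \<subseteq> {p..q} \<and> is_interval ?J \<and> (\<forall>a\<in>?J. x \<noteq> c a)" using assms by (auto simp: is_interval_cc)
  hence "L-lipschitz_on ?J (\<lambda>a. D a x)"
    using fam assms(3) unfolding pe_unimodal_family_def space_deriv_def by blast
  from lipschitz_onD[OF this, of a b] show ?thesis by (simp add: dist_real_def)
qed

lemma T_mvt:
  assumes "a \<in> {p..q}" "0 \<le> x" "x < y" "y \<le> 1" "y \<le> c a \<or> c a \<le> x"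
  obtains \<xi> where "x < \<xi>" "\<xi> < y" "T a y - T a x = D a \<xi> * (y - x)"
proof -
  have co: "continuous_on {x..y} (T a)"
    by (rule continuous_on_subset[OF unimodal_simps(2)[OF assms(1)]]) (use assms in auto)
  obtain \<xi> where "x < \<xi>" "\<xi> < y" "T a y - T a x = (*) (D a \<xi>) (y - x)"
  proof (rule mvt[OF assms(3) co])
    fix z assume z: "x < z" "z < y"
    have "(T a has_real_derivative D a z) (at z within {0..1})"
      using z assms by (intro has_deriv) auto
    moreover have "at z within {0..1} = at z" using z assms by (intro at_within_interior) auto
    ultimately show "(T a has_derivative (*) (D a z)) (at z)" by (simp add: has_field_derivative_def)
  qed auto
  thus ?thesis using that by blast
qed

lemma mvt_sided:
  assumes a: "a \<in> {p..q}" and xy: "x \<in> {0..1}" "y \<in> {0..1}" "x \<noteq> y"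
    and side: "(x \<le> c a \<and> y \<le> c a) \<or> (c a \<le> x \<and> c a \<le> y)"
  obtains \<xi> where "min x y < \<xi>" "\<xi> < max x y" "\<bar>T a x - T a y\<bar> = \<bar>D a \<xi>\<bar> * \<bar>x - y\<bar>"
    "T a x - T a y = D a \<xi> * (x - y)"
proof (cases "x < y")
  case True
  obtain \<xi> where "x < \<xi>" "\<xi> < y" "T a y - T a x = D a \<xi> * (y - x)"
    using T_mvt[OF a, of x y] True xy side by auto
  moreover from this have "T a x - T a y = D a \<xi> * (x - y)" by (simp add: algebra_simps)
  ultimately show ?thesis using that[of \<xi>] True by (simp add: abs_mult)
next
  case False
  hence lt: "y < x" using xy by simp
  obtain \<xi> where "y < \<xi>" "\<xi> < x" "T a x - T a y = D a \<xi> * (x - y)"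
    using T_mvt[OF a, of y x] lt xy side by auto
  thus ?thesis using that[of \<xi>] lt by (simp add: abs_mult)
qed

text \<open>Dominates both coefficients in \<open>deriv_joint_lip\<close>: \<open>2 * L\<close> for
  the points and \<open>2 * L * L + L\<close> for the parameters.\<close>

definition H0 :: real where "H0 = L * (2 * L + 3)"

lemma H0_nonneg: "0 \<le> H0"
  using L_nonneg by (simp add: H0_def)

text \<open>To compare at two parameters, pass through a point that avoids all the turning points in
  between.\<close>

lemma deriv_joint_lip:
  assumes ab: "a \<in> {p..q}" "b \<in> {p..q}" and xy: "x \<in> {0..1}" "y \<in> {0..1}"
    and side: "(x < c a \<and> y < c b) \<or> (c a < x \<and> c b < y)"
  shows "\<bar>D a x - D b y\<bar> \<le> H0 * (\<bar>a - b\<bar> + \<bar>x - y\<bar>)"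
proof -
  have m: "\<bar>c \<alpha> - c a\<bar> \<le> L * \<bar>a - b\<bar>" "\<bar>c \<alpha> - c b\<bar> \<le> L * \<bar>a - b\<bar>" "\<alpha> \<in> {p..q}"
    if "min a b \<le> \<alpha>" "\<alpha> \<le> max a b" for \<alpha>
  proof -
    show al: "\<alpha> \<in> {p..q}" using that ab by auto
    have "L * \<bar>\<alpha> - a\<bar> \<le> L * \<bar>a - b\<bar>" "L * \<bar>\<alpha> - b\<bar> \<le> L * \<bar>a - b\<bar>"
      using that by (auto intro!: mult_left_mono L_nonneg)
    thus "\<bar>c \<alpha> - c a\<bar> \<le> L * \<bar>a - b\<bar>" "\<bar>c \<alpha> - c b\<bar> \<le> L * \<bar>a - b\<bar>"
      using c_lip_L[OF al ab(1)] c_lip_L[OF al ab(2)] by auto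
  qed
  have L0: "0 \<le> L * \<bar>a - b\<bar>" using L_nonneg by simp
  obtain z where z: "z \<in> {0..1}" "\<And>\<alpha>. min a b \<le> \<alpha> \<Longrightarrow> \<alpha> \<le> max a b \<Longrightarrow> z \<noteq> c \<alpha>"
    "\<bar>x - z\<bar> \<le> \<bar>x - y\<bar> + L * \<bar>a - b\<bar>" "\<bar>z - y\<bar> \<le> \<bar>x - y\<bar> + L * \<bar>a - b\<bar>"
    "(x < c a \<and> z < c a \<and> z < c b \<and> y < c b) \<or> (c a < x \<and> c a < z \<and> c b < z \<and> c b < y)"
  proof (cases "x < c a \<and> y < c b")
    case True
    \<comment> \<open>\<open>L * \<bar>a - b\<bar>\<close> bounds the movement of the turning point
      between the two parameters, so \<open>z\<close> lies to the left of all turning points in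
      between; truncation at 0 is harmless as these are positive.\<close>
    define z where "z = max 0 (min x y - L * \<bar>a - b\<bar>)"
    have lt: "z < c \<alpha>" if "min a b \<le> \<alpha>" "\<alpha> \<le> max a b" for \<alpha>
      using m[OF that] unimodal_simps(3)[OF m(3)[OF that]] True by (auto simp: z_def)
    have "z \<in> {0..1}" "z \<le> x" "z \<le> y" "min x y - L * \<bar>a - b\<bar> \<le> z" using xy L0 by (auto simp: z_def)
    moreover from this have "\<bar>x - z\<bar> \<le> \<bar>x - y\<bar> + L * \<bar>a - b\<bar>" "\<bar>z - y\<bar> \<le> \<bar>x - y\<bar> + L * \<bar>a - b\<bar>" by auto
    moreover have "z < c a" "z < c b" using lt[of a] lt[of b] by auto
    ultimately show ?thesis using that[of z] lt True by (metis less_irrefl)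
  next
    case False
    define z where "z = min 1 (max x y + L * \<bar>a - b\<bar>)"
    have lt: "c \<alpha> < z" if "min a b \<le> \<alpha>" "\<alpha> \<le> max a b" for \<alpha>
      using m[OF that] unimodal_simps(4)[OF m(3)[OF that]] False side by (auto simp: z_def)
    have "z \<in> {0..1}" "x \<le> z" "y \<le> z" "z \<le> max x y + L * \<bar>a - b\<bar>" using xy L0 by (auto simp: z_def)
    moreover from this have "\<bar>x - z\<bar> \<le> \<bar>x - y\<bar> + L * \<bar>a - b\<bar>" "\<bar>z - y\<bar> \<le> \<bar>x - y\<bar> + L * \<bar>a - b\<bar>" by auto
    moreover have "c a < z" "c b < z" using lt[of a] lt[of b] by auto
    ultimately show ?thesis using that[of z] lt False side by (metis less_irrefl)
  qed
  have "\<bar>D a x - D b y\<bar> \<le> \<bar>D a x - D a z\<bar> + \<bar>D a z - D b z\<bar> + \<bar>D b z - D b y\<bar>" by simp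
  also have "\<dots> \<le> L * \<bar>x - z\<bar> + L * \<bar>a - b\<bar> + L * \<bar>z - y\<bar>"
    using z xy ab by (intro add_mono deriv_lip deriv_param_lip) auto
  also have "\<dots> \<le> L * (\<bar>x - y\<bar> + L * \<bar>a - b\<bar>) + L * \<bar>a - b\<bar> + L * (\<bar>x - y\<bar> + L * \<bar>a - b\<bar>)"
    using z L_nonneg by (intro add_mono mult_left_mono) auto
  also have "\<dots> = 2 * L * \<bar>x - y\<bar> + (2 * L * L + L) * \<bar>a - b\<bar>" by (simp add: algebra_simps)
  also have "\<dots> \<le> H0 * \<bar>x - y\<bar> + H0 * \<bar>a - b\<bar>"
    using L_nonneg by (intro add_mono mult_right_mono) (auto simp: H0_def algebra_simps)
  finally show ?thesis by (simp add: algebra_simps)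
qed

lemma expand:
  assumes "a \<in> {p..q}" "x \<in> {0..1}" "y \<in> {0..1}" "(x \<le> c a \<and> y \<le> c a) \<or> (c a \<le> x \<and> c a \<le> y)"
  shows "lam * \<bar>x - y\<bar> \<le> \<bar>T a x - T a y\<bar>" "\<bar>T a x - T a y\<bar> \<le> Lam * \<bar>x - y\<bar>"
proof -
  have "lam * \<bar>x - y\<bar> \<le> \<bar>T a x - T a y\<bar> \<and> \<bar>T a x - T a y\<bar> \<le> Lam * \<bar>x - y\<bar>"
  proof (cases "x = y")
    case False
    obtain \<xi> where xi: "min x y < \<xi>" "\<xi> < max x y" "\<bar>T a x - T a y\<bar> = \<bar>D a \<xi>\<bar> * \<bar>x - y\<bar>"
      by (rule mvt_sided[OF assms(1-3) False assms(4)])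
    have "\<xi> \<in> {0..1}" "\<xi> \<noteq> c a" using xi(1,2) assms by auto
    from deriv_ge[OF assms(1) this] deriv_le[OF assms(1) this] show ?thesis
      unfolding xi(3) by (auto intro: mult_right_mono)
  qed simp
  thus "lam * \<bar>x - y\<bar> \<le> \<bar>T a x - T a y\<bar>" "\<bar>T a x - T a y\<bar> \<le> Lam * \<bar>x - y\<bar>" by auto
qed

lemma T_lipschitz:
  assumes "a \<in> {p..q}" "x \<in> {0..1}" "y \<in> {0..1}"
  shows "\<bar>T a x - T a y\<bar> \<le> Lam * \<bar>x - y\<bar>"
proof (cases "(x \<le> c a \<and> y \<le> c a) \<or> (c a \<le> x \<and> c a \<le> y)")
  case True thus ?thesis using expand(2)[OF assms] by blast
next
  case False
  have c: "c a \<in> {0..1}" using unimodal_simps(3,4)[OF assms(1)] by simp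
  have "\<bar>T a x - T a y\<bar> \<le> \<bar>T a x - T a (c a)\<bar> + \<bar>T a (c a) - T a y\<bar>" by simp
  also have "\<dots> \<le> Lam * \<bar>x - c a\<bar> + Lam * \<bar>c a - y\<bar>"
    using expand(2)[OF assms(1,2) c] expand(2)[OF assms(1) c assms(3)]
      linear[of x "c a"] linear[of y "c a"] by (intro add_mono) auto
  also have "\<dots> = Lam * (\<bar>x - c a\<bar> + \<bar>c a - y\<bar>)" by (simp add: distrib_left)
  also have "\<bar>x - c a\<bar> + \<bar>c a - y\<bar> = \<bar>x - y\<bar>" using False by auto
  finally show ?thesis .
qed

text \<open>The value at the turning point is 1 for every parameter, so an expanded displacement of
  \<open>c\<close> must be made up by the change of parameter. The constant \<open>L\<close> of the
  family need not lie below \<open>s0\<close>, as \<open>one_step\<close> requires.\<close>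

lemma c_lip:
  assumes "a \<in> {p..q}" "b \<in> {p..q}"
  shows "\<bar>c a - c b\<bar> \<le> K / lam * \<bar>a - b\<bar>"
proof -
  have c: "c a \<in> {0..1}" "c b \<in> {0..1}" using unimodal_simps(3,4) assms by (auto intro: less_imp_le)
  have "lam * \<bar>c a - c b\<bar> \<le> \<bar>T b (c a) - T b (c b)\<bar>"
    using linear[of "c a" "c b"] by (intro expand(1) assms c) auto
  also have "\<dots> = \<bar>T b (c a) - T a (c a)\<bar>" using unimodal_simps(5) assms by simp
  also have "\<dots> \<le> K * \<bar>a - b\<bar>" using param_lip[OF assms c(1)] by simp
  finally show ?thesis using lam by (simp add: field_simps)
qed

text \<open>Mean value theorem for both quotients: the intermediate points are within
  \<open>w\<close> of each other and so are the parameters, hence \<open>2 * H0 * w\<close>. As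
  slopes are at least 1, the absolute error is also a relative one.\<close>

lemma distortion:
  assumes ab: "a \<in> {p..q}" "b \<in> {p..q}"
    and xy: "x \<in> {0..1}" "y \<in> {0..1}" and xy': "x' \<in> {0..1}" "y' \<in> {0..1}"
    and side: "(x \<le> c a \<and> y \<le> c a \<and> x' \<le> c b \<and> y' \<le> c b) \<or>
        (c a \<le> x \<and> c a \<le> y \<and> c b \<le> x' \<and> c b \<le> y')"
    and w: "\<bar>a - b\<bar> \<le> w" "\<bar>x - x'\<bar> \<le> w" "\<bar>x - y'\<bar> \<le> w" "\<bar>y - x'\<bar> \<le> w" "\<bar>y - y'\<bar> \<le> w"
  shows "\<bar>T a x - T a y\<bar> * \<bar>x' - y'\<bar> \<le> (1 + 2 * H0 * w) * (\<bar>T b x' - T b y'\<bar> * \<bar>x - y\<bar>)"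
proof (cases "x = y \<or> x' = y'")
  case True thus ?thesis by auto
next
  case False
  hence ne: "x \<noteq> y" "x' \<noteq> y'" by auto
  have s1: "(x \<le> c a \<and> y \<le> c a) \<or> (c a \<le> x \<and> c a \<le> y)" using side by blast
  have s2: "(x' \<le> c b \<and> y' \<le> c b) \<or> (c b \<le> x' \<and> c b \<le> y')" using side by blast
  obtain \<xi> where xi: "min x y < \<xi>" "\<xi> < max x y" "\<bar>T a x - T a y\<bar> = \<bar>D a \<xi>\<bar> * \<bar>x - y\<bar>"
    by (rule mvt_sided[OF ab(1) xy ne(1) s1])
  obtain \<xi>' where xi': "min x' y' < \<xi>'" "\<xi>' < max x' y'" "\<bar>T b x' - T b y'\<bar> = \<bar>D b \<xi>'\<bar> * \<bar>x' - y'\<bar>"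
    by (rule mvt_sided[OF ab(2) xy' ne(2) s2])
  have in01: "\<xi> \<in> {0..1}" "\<xi>' \<in> {0..1}" using xi(1,2) xi'(1,2) xy xy' by auto
  have s: "(\<xi> < c a \<and> \<xi>' < c b) \<or> (c a < \<xi> \<and> c b < \<xi>')" using side xi(1,2) xi'(1,2) by auto
  have dist: "\<bar>\<xi> - \<xi>'\<bar> \<le> w" using xi(1,2) xi'(1,2) w by (auto simp: min_def max_def split: if_splits)
  have "\<bar>D a \<xi>\<bar> \<le> \<bar>D b \<xi>'\<bar> + H0 * (\<bar>a - b\<bar> + \<bar>\<xi> - \<xi>'\<bar>)" using deriv_joint_lip[OF ab in01 s] by simp
  also have "\<dots> \<le> \<bar>D b \<xi>'\<bar> + H0 * (2 * w)" using w dist H0_nonneg by (intro add_mono mult_left_mono) auto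
  also have "\<dots> \<le> (1 + 2 * H0 * w) * \<bar>D b \<xi>'\<bar>"
  proof -
    have "\<xi>' \<noteq> c b" using s by auto
    hence "1 \<le> \<bar>D b \<xi>'\<bar>" using deriv_ge[OF ab(2) in01(2)] lam by simp
    moreover have "0 \<le> H0 * (2 * w)" using H0_nonneg w by simp
    ultimately have "H0 * (2 * w) * 1 \<le> H0 * (2 * w) * \<bar>D b \<xi>'\<bar>" by (intro mult_left_mono)
    thus ?thesis by (simp add: algebra_simps)
  qed
  finally have "\<bar>D a \<xi>\<bar> * (\<bar>x - y\<bar> * \<bar>x' - y'\<bar>) \<le> (1 + 2 * H0 * w) * \<bar>D b \<xi>'\<bar> * (\<bar>x - y\<bar> * \<bar>x' - y'\<bar>)"
    by (rule mult_right_mono) simp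
  thus ?thesis unfolding xi(3) xi'(3) by (simp add: mult_ac)
qed

lemma expanding_family_sub:
  assumes "p \<le> p'" "p' < q'" "q' \<le> q"
  shows "expanding_family p' q' T c lam Lam K (2 * H0)"
proof -
  have I: "a \<in> {p..q}" if "a \<in> {p'..q'}" for a using that assms by auto
  have "0 \<in> {0..1::real}" "0 \<noteq> c p" using unimodal_simps(3)[of p] p_less_q by auto
  hence "0 \<le> Lam" using deriv_le[of p 0] p_less_q by auto
  thus ?thesis
  proof unfold_locales
    fix a assume "a \<in> {p'..q'}"
    thus "c a \<in> {0..1}" using unimodal_simps(3,4)[OF I] by (auto intro: less_imp_le)
  next
    fix a b x y x' y' w
    assume "a \<in> {p'..q'}" "b \<in> {p'..q'}" "x \<in> {0..1}" "y \<in> {0..1}" "x' \<in> {0..1}" "y' \<in> {0..1}"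
      "(x \<le> c a \<and> y \<le> c a \<and> x' \<le> c b \<and> y' \<le> c b) \<or> (c a \<le> x \<and> c a \<le> y \<and> c b \<le> x' \<and> c b \<le> y')"
      "\<bar>a - b\<bar> \<le> w" "\<bar>x - x'\<bar> \<le> w" "\<bar>x - y'\<bar> \<le> w" "\<bar>y - x'\<bar> \<le> w" "\<bar>y - y'\<bar> \<le> w"
    thus "\<bar>T a x - T a y\<bar> * \<bar>x' - y'\<bar> \<le> (1 + 2 * H0 * w) * (\<bar>T b x' - T b y'\<bar> * \<bar>x - y\<bar>)"
      using distortion I by blast
  qed (use assms lam K H0_nonneg unimodal_simps(1) expand(1) T_lipschitz param_lip c_lip I in \<open>simp_all\<close>)
qed

end

lemma lipschitz_vector_derivative_le:
  fixes f :: "real \<Rightarrow> real"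
  assumes "L-lipschitz_on {p..q} f" "p < q" "a \<in> {p..q}" "f differentiable (at a within {p..q})"
  shows "\<bar>vector_derivative f (at a within {p..q})\<bar> \<le> L"
proof -
  let ?D = "vector_derivative f (at a within {p..q})"
  have "(f has_vector_derivative ?D) (at a within {p..q})"
    using assms(4) by (simp add: vector_derivative_works)
  hence "((\<lambda>y. (f y - f a) / (y - a)) \<longlongrightarrow> ?D) (at a within {p..q})"
    by (simp add: has_real_derivative_iff_has_vector_derivative[symmetric] has_field_derivative_iff)
  hence lim: "((\<lambda>y. \<bar>(f y - f a) / (y - a)\<bar>) \<longlongrightarrow> \<bar>?D\<bar>) (at a within {p..q})" by (rule tendsto_rabs)
  have "\<bar>(f y - f a) / (y - a)\<bar> \<le> L" if "y \<in> {p..q}" "y \<noteq> a" for y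
    using lipschitz_onD[OF assms(1) that(1) assms(3)] that(2)
    by (simp add: dist_real_def abs_divide pos_divide_le_eq)
  hence ev: "\<forall>\<^sub>F y in at a within {p..q}. \<bar>(f y - f a) / (y - a)\<bar> \<le> L"
    unfolding eventually_at_filter by (intro always_eventually) blast
  have "at a within {p..q} \<noteq> bot" using assms(2,3) by (simp add: trivial_limit_within)
  thus ?thesis using tendsto_upperbound[OF lim ev] by blast
qed

lemma C1_on_interior:
  assumes "C1_on J f" "a \<in> interior J"
  shows "f differentiable (at a)"
proof -
  obtain f' where "\<forall>x\<in>J. (f has_real_derivative f' x) (at x within J)" using assms(1) unfolding C1_on_def by blast
  moreover have "a \<in> J" using assms(2) interior_subset by blast
  ultimately have "(f has_real_derivative f' a) (at a within J)" by blast
  hence "(f has_real_derivative f' a) (at a)" unfolding at_within_interior[OF assms(2)] .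
  thus ?thesis by (auto simp: differentiable_def has_field_derivative_def)
qed

section \<open>The supremum of parameter derivatives and the infimum of space derivatives\<close>

context
  fixes p q L :: real and T :: "real \<Rightarrow> real \<Rightarrow> real" and c :: "real \<Rightarrow> real"
  assumes pq: "p < q" and fam: "pe_unimodal_family L {p..q} T c"
begin

lemma fam_unimodal: "a \<in> {p..q} \<Longrightarrow> pe_unimodal L (T a) (c a)"
  using fam by (simp add: pe_unimodal_family_def)

lemma fam_lipschitz: "x \<in> {0..1} \<Longrightarrow> L-lipschitz_on {p..q} (\<lambda>a. T a x)"
  using fam by (simp add: pe_unimodal_family_def)

lemma fam_c_lipschitz: "L-lipschitz_on {p..q} c"
  using fam by (simp add: pe_unimodal_family_def)

lemma fam_C1: "x \<in> {0..1} \<Longrightarrow> J \<subseteq> {p..q} \<Longrightarrow> is_interval J \<Longrightarrow> (\<And>a. a \<in> J \<Longrightarrow> x \<noteq> c a) \<Longrightarrow> C1_on J (\<lambda>a. T a x)"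
  using fam unfolding pe_unimodal_family_def by blast

lemma fam_c: "a \<in> {p..q} \<Longrightarrow> 0 < c a \<and> c a < 1 \<and> T a (c a) = 1"
  using fam_unimodal by (simp add: pe_unimodal_def)

lemma turning_ne_0: "a \<in> {p..q} \<Longrightarrow> 0 \<noteq> c a"
  using fam_c[of a] by simp

text \<open>A supremum of reals bounds its elements only if the set is bounded, here by
  \<open>L\<close>. The outer one also needs nonempty inner sets, supplied by \<open>x = 0\<close>,
  which is never a turning point.\<close>

lemma param_deriv_le:
  assumes a: "a \<in> {p..q}" and x: "x \<in> {0..1}" and d: "(\<lambda>b. T b x) differentiable (at a within {p..q})"
  shows "\<bar>vector_derivative (\<lambda>b. T b x) (at a within {p..q})\<bar> \<le> sup_param_deriv {p..q} T"
proof -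
  define S where "S a = {x\<in>{0..1}. (\<lambda>b. T b x) differentiable (at a within {p..q})}" for a
  define d where "d a x = \<bar>vector_derivative (\<lambda>b. T b x) (at a within {p..q})\<bar>" for a x
  have le: "d a x \<le> L" if "a \<in> {p..q}" "x \<in> S a" for a x
    using that pq fam_lipschitz[of x] unfolding d_def S_def by (intro lipschitz_vector_derivative_le) auto
  hence bdd: "bdd_above (d a ` S a)" if "a \<in> {p..q}" for a using that by (auto intro: bdd_aboveI[of _ L])
  have ne: "S a \<noteq> {}" if a: "a \<in> {p..q}" for a
  proof -
    have "C1_on {p..q} (\<lambda>b. T b 0)" by (intro fam_C1) (use turning_ne_0 in \<open>auto simp: is_interval_cc\<close>)
    hence "\<exists>D. ((\<lambda>b. T b 0) has_real_derivative D) (at a within {p..q})" using a unfolding C1_on_def by blast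
    hence "(\<lambda>b. T b 0) differentiable (at a within {p..q})"
      by (auto simp: differentiable_def has_field_derivative_def)
    hence "0 \<in> S a" by (simp add: S_def)
    thus ?thesis by blast
  qed
  have "d a x \<le> (SUP x\<in>S a. d a x)"
    using bdd[OF a] x d by (intro cSUP_upper) (auto simp: S_def)
  also have "\<dots> \<le> (SUP a\<in>{p..q}. SUP x\<in>S a. d a x)"
  proof (rule cSUP_upper[OF a])
    have "(SUP x\<in>S a. d a x) \<le> L" if "a \<in> {p..q}" for a
      using ne[OF that] le[OF that] by (intro cSUP_least)
    thus "bdd_above ((\<lambda>a. SUP x\<in>S a. d a x) ` {p..q})" by (auto intro: bdd_aboveI[of _ L])
  qed
  also have "\<dots> = sup_param_deriv {p..q} T" by (simp add: sup_param_deriv_def S_def d_def)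
  finally show ?thesis by (simp add: d_def)
qed

lemma sup_param_deriv_nonneg: "0 \<le> sup_param_deriv {p..q} T"
proof -
  have "C1_on {p..q} (\<lambda>b. T b 0)" by (intro fam_C1) (use turning_ne_0 in \<open>auto simp: is_interval_cc\<close>)
  hence "\<exists>D. ((\<lambda>b. T b 0) has_real_derivative D) (at p within {p..q})" using pq unfolding C1_on_def by auto
  hence "(\<lambda>b. T b 0) differentiable (at p within {p..q})"
    by (auto simp: differentiable_def has_field_derivative_def)
  from param_deriv_le[OF _ _ this] show ?thesis using pq by auto
qed

lemma param_lip_aux:
  assumes ab: "p \<le> a" "a < b" "b \<le> q" and x: "x \<in> {0..1}" and ne: "\<And>\<alpha>. a < \<alpha> \<Longrightarrow> \<alpha> < b \<Longrightarrow> x \<noteq> c \<alpha>"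
  shows "\<bar>T a x - T b x\<bar> \<le> sup_param_deriv {p..q} T * (b - a)"
proof -
  have C1: "C1_on {a<..<b} (\<lambda>a. T a x)" using ab ne by (intro fam_C1 x) (auto simp: is_interval_oo)
  let ?D = "\<lambda>\<alpha>. vector_derivative (\<lambda>b. T b x) (at \<alpha>)"
  have co: "continuous_on {a..b} (\<lambda>a. T a x)"
    by (rule continuous_on_subset[OF lipschitz_on_continuous_on[OF fam_lipschitz[OF x]]]) (use ab in auto)
  have df: "(\<lambda>b. T b x) differentiable (at \<alpha>)" if "a < \<alpha>" "\<alpha> < b" for \<alpha>
    by (rule C1_on_interior[OF C1]) (use that in \<open>simp add: interior_open\<close>)
  obtain \<xi> where xi: "a < \<xi>" "\<xi> < b" "T b x - T a x = ?D \<xi> * (b - a)"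
  proof (rule mvt[OF ab(2) co, of "\<lambda>\<alpha>. (*) (?D \<alpha>)"])
    fix \<alpha> assume "a < \<alpha>" "\<alpha> < b"
    from df[OF this] have "((\<lambda>b. T b x) has_vector_derivative ?D \<alpha>) (at \<alpha>)" by (simp add: vector_derivative_works)
    thus "((\<lambda>b. T b x) has_derivative (*) (?D \<alpha>)) (at \<alpha>)"
      by (simp add: has_real_derivative_iff_has_vector_derivative[symmetric] has_field_derivative_def)
  qed auto
  have at: "at \<xi> within {p..q} = at \<xi>" using xi ab by (intro at_within_interior) auto
  have "\<bar>?D \<xi>\<bar> \<le> sup_param_deriv {p..q} T"
    using param_deriv_le[of \<xi> x] df[OF xi(1,2)] xi ab x unfolding at by auto
  hence "\<bar>?D \<xi>\<bar> * (b - a) \<le> sup_param_deriv {p..q} T * (b - a)" using ab by (intro mult_right_mono) auto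
  moreover have "\<bar>T a x - T b x\<bar> = \<bar>?D \<xi>\<bar> * (b - a)"
  proof -
    have "\<bar>T a x - T b x\<bar> = \<bar>T b x - T a x\<bar>" by simp
    thus ?thesis unfolding xi(3) using ab by (simp add: abs_mult)
  qed
  ultimately show ?thesis by simp
qed

text \<open>Where \<open>a \<mapsto> T a x\<close> may fail to be differentiable, it takes the value \<open>1\<close>; so only the
  parameters before the first and after the last such point matter.\<close>

lemma param_lip_sup:
  assumes "a \<in> {p..q}" "b \<in> {p..q}" and x: "x \<in> {0..1}"
  shows "\<bar>T a x - T b x\<bar> \<le> sup_param_deriv {p..q} T * \<bar>a - b\<bar>"
proof -
  let ?K = "sup_param_deriv {p..q} T"
  have K0: "0 \<le> ?K" by (rule sup_param_deriv_nonneg)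
  have main: "\<bar>T a x - T b x\<bar> \<le> ?K * (b - a)" if ab: "p \<le> a" "a < b" "b \<le> q" for a b
  proof (cases "{\<alpha> \<in> {a..b}. c \<alpha> = x} = {}")
    case True
    have "x \<noteq> c \<alpha>" if "a < \<alpha>" "\<alpha> < b" for \<alpha>
    proof
      assume "x = c \<alpha>"
      hence "\<alpha> \<in> {\<alpha> \<in> {a..b}. c \<alpha> = x}" using that by simp
      thus False using True by blast
    qed
    thus ?thesis using ab by (intro param_lip_aux x) auto
  next
    case False
    let ?S = "{\<alpha> \<in> {a..b}. c \<alpha> = x}"
    have "continuous_on {a..b} c"
      by (rule continuous_on_subset[OF lipschitz_on_continuous_on[OF fam_c_lipschitz]]) (use ab in auto)
    hence "closed ({a..b} \<inter> c -` {x})" by (intro continuous_closed_preimage) auto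
    moreover have "?S = {a..b} \<inter> c -` {x}" by auto
    ultimately have "compact ({a..b} \<inter> ?S)" by (intro compact_Int_closed) auto
    moreover have "{a..b} \<inter> ?S = ?S" by auto
    ultimately have S: "compact ?S" by simp
    obtain s where s: "s \<in> ?S" "\<And>y. y \<in> ?S \<Longrightarrow> s \<le> y" using compact_attains_inf[OF S False] by blast
    obtain t where t: "t \<in> ?S" "\<And>y. y \<in> ?S \<Longrightarrow> y \<le> t" using compact_attains_sup[OF S False] by blast
    have st: "s \<le> t" "a \<le> s" "t \<le> b" using s t by auto
    have 1: "T s x = 1" "T t x = 1" using fam_c[of s] fam_c[of t] s t ab by auto
    have "\<bar>T a x - T s x\<bar> \<le> ?K * (s - a)"
    proof (cases "a = s")
      case False
      have "x \<noteq> c \<alpha>" if "a < \<alpha>" "\<alpha> < s" for \<alpha> using s(2)[of \<alpha>] that st by auto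
      thus ?thesis using False ab st by (intro param_lip_aux x) auto
    qed simp
    moreover have "\<bar>T t x - T b x\<bar> \<le> ?K * (b - t)"
    proof (cases "t = b")
      case False
      have "x \<noteq> c \<alpha>" if "t < \<alpha>" "\<alpha> < b" for \<alpha> using t(2)[of \<alpha>] that st by auto
      thus ?thesis using False ab st by (intro param_lip_aux x) auto
    qed simp
    ultimately have "\<bar>T a x - T b x\<bar> \<le> ?K * (s - a) + ?K * (b - t)" using 1 by linarith
    also have "\<dots> \<le> ?K * (b - a)" using mult_left_mono[OF st(1) K0] by (simp add: algebra_simps)
    finally show ?thesis .
  qed
  consider "a = b" | "a < b" | "b < a" by linarith
  thus ?thesis
  proof cases
    case 2 thus ?thesis using main[of a b] assms by simp
  next
    case 3 thus ?thesis using main[of b a] assms by (simp add: abs_minus_commute)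
  qed simp
qed

lemma fam_deriv_bounds:
  obtains l u where "1 < l" "\<And>a x. a \<in> {p..q} \<Longrightarrow> x \<in> {0..1} \<Longrightarrow> x \<noteq> c a \<Longrightarrow>
    l \<le> \<bar>space_deriv (T a) x\<bar> \<and> \<bar>space_deriv (T a) x\<bar> \<le> u"
proof -
  have "\<exists>l u. 1 < l \<and> l \<le> u \<and> (\<forall>a\<in>{p..q}. \<forall>x\<in>{0..1}. x \<noteq> c a \<longrightarrow>
      l \<le> \<bar>space_deriv (T a) x\<bar> \<and> \<bar>space_deriv (T a) x\<bar> \<le> u)"
    using fam unfolding pe_unimodal_family_def space_deriv_def by (elim conjE)
  then obtain l u where "1 < l" "\<forall>a\<in>{p..q}. \<forall>x\<in>{0..1}. x \<noteq> c a \<longrightarrow>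
      l \<le> \<bar>space_deriv (T a) x\<bar> \<and> \<bar>space_deriv (T a) x\<bar> \<le> u" by (elim exE conjE)
  thus ?thesis using that by blast
qed

text \<open>The infimum ranges over all points of differentiability, in form also over the turning
  point; a derivative there is the left-hand one, hence a limit of slopes on the left.\<close>

lemma space_deriv_at_turning:
  assumes a: "a \<in> {p..q}" and l: "\<And>x. x \<in> {0..1} \<Longrightarrow> x \<noteq> c a \<Longrightarrow> l \<le> \<bar>space_deriv (T a) x\<bar>"
    and d: "T a differentiable (at (c a) within {0..1})"
  shows "l \<le> \<bar>space_deriv (T a) (c a)\<bar>"
proof -
  let ?D = "space_deriv (T a) (c a)"
  obtain f' where f': "\<And>x. x \<in> {0..c a} \<Longrightarrow> (T a has_real_derivative f' x) (at x within {0..c a})"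
    "L-lipschitz_on {0..c a} f'"
    "\<And>x. x \<in> {0..<c a} \<Longrightarrow> (T a has_real_derivative space_deriv (T a) x) (at x within {0..1})"
    "\<And>x. x \<in> {0..<c a} \<Longrightarrow> space_deriv (T a) x = f' x"
    using left_branch[OF fam_unimodal[OF a]] by metis
  have c: "0 < c a" "c a < 1" using fam_c[OF a] by auto
  have "(T a has_vector_derivative ?D) (at (c a) within {0..1})"
    using d by (simp add: vector_derivative_works space_deriv_def)
  hence "(T a has_vector_derivative ?D) (at (c a) within {0..c a})"
    by (rule has_vector_derivative_within_subset) (use c in auto)
  moreover have "(T a has_vector_derivative f' (c a)) (at (c a) within {0..c a})"
    using f'(1)[of "c a"] c by (simp add: has_real_derivative_iff_has_vector_derivative)
  ultimately have D: "?D = f' (c a)"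
    using vector_derivative_within_cbox[of 0 "c a" "c a" "T a"] c by (metis atLeastAtMost_iff box_real(2) less_imp_le order_refl)
  have "continuous_on {0..c a} f'" by (rule lipschitz_on_continuous_on[OF f'(2)])
  hence "(f' \<longlongrightarrow> f' (c a)) (at (c a) within {0..c a})" using c by (simp add: continuous_on_def)
  hence lim: "((\<lambda>x. \<bar>f' x\<bar>) \<longlongrightarrow> \<bar>f' (c a)\<bar>) (at (c a) within {0..c a})" by (rule tendsto_rabs)
  have "l \<le> \<bar>f' x\<bar>" if "x \<in> {0..c a}" "x \<noteq> c a" for x
    using l[of x] f'(4)[of x] that c by auto
  hence ev: "\<forall>\<^sub>F x in at (c a) within {0..c a}. l \<le> \<bar>f' x\<bar>"
    unfolding eventually_at_filter by (intro always_eventually) blast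
  have "at (c a) within {0..c a} \<noteq> bot" using c by (simp add: trivial_limit_within)
  thus ?thesis unfolding D using tendsto_lowerbound[OF lim ev] by blast
qed

lemma inf_space_deriv_bounds:
  shows "1 < inf_space_deriv {p..q} T"
    and "a \<in> {p..q} \<Longrightarrow> x \<in> {0..1} \<Longrightarrow> x \<noteq> c a \<Longrightarrow> inf_space_deriv {p..q} T \<le> \<bar>space_deriv (T a) x\<bar>"
proof -
  obtain l u where lu: "1 < l" "\<And>a x. a \<in> {p..q} \<Longrightarrow> x \<in> {0..1} \<Longrightarrow> x \<noteq> c a \<Longrightarrow>
    l \<le> \<bar>space_deriv (T a) x\<bar> \<and> \<bar>space_deriv (T a) x\<bar> \<le> u" by (rule fam_deriv_bounds) blast
  define S where "S a = {x\<in>{0..1}. T a differentiable (at x within {0..1})}" for a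
  define d where "d a x = \<bar>space_deriv (T a) x\<bar>" for a x
  have eq: "inf_space_deriv {p..q} T = (INF a\<in>{p..q}. INF x\<in>S a. d a x)"
    by (simp add: inf_space_deriv_def S_def d_def space_deriv_def)
  have S: "x \<in> S a" if "a \<in> {p..q}" "x \<in> {0..1}" "x \<noteq> c a" for a x
  proof -
    have "\<exists>D. (T a has_real_derivative D) (at x within {0..1})"
    proof (cases "x < c a")
      case True
      thus ?thesis using left_branch[OF fam_unimodal[OF that(1)]] that(2) by (metis atLeastAtMost_iff atLeastLessThan_iff)
    next
      case False
      hence "c a < x" using that by auto
      thus ?thesis using right_branch[OF fam_unimodal[OF that(1)]] that(2) by (metis atLeastAtMost_iff greaterThanAtMost_iff)
    qed
    thus ?thesis using that by (auto simp: S_def differentiable_def has_field_derivative_def)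
  qed
  have ne: "S a \<noteq> {}" if "a \<in> {p..q}" for a using S[OF that, of 0] fam_c[OF that] by auto
  have ge: "l \<le> d a x" if "a \<in> {p..q}" "x \<in> S a" for a x
  proof (cases "x = c a")
    case True
    show ?thesis unfolding d_def True
      by (rule space_deriv_at_turning) (use that lu True in \<open>auto simp: S_def\<close>)
  qed (use lu(2)[OF that(1)] that(2) in \<open>auto simp: S_def d_def\<close>)
  have inner: "l \<le> (INF x\<in>S a. d a x)" if "a \<in> {p..q}" for a
    using ne[OF that] ge[OF that] by (intro cINF_greatest)
  have "l \<le> inf_space_deriv {p..q} T" unfolding eq by (rule cINF_greatest) (use pq inner in auto)
  thus "1 < inf_space_deriv {p..q} T" using lu by simp
  assume a: "a \<in> {p..q}" and x: "x \<in> {0..1}" "x \<noteq> c a"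
  have "inf_space_deriv {p..q} T \<le> (INF x\<in>S a. d a x)" unfolding eq
    by (rule cINF_lower[OF _ a]) (use inner in \<open>auto intro: bdd_belowI[of _ l]\<close>)
  also have "\<dots> \<le> d a x"
    by (rule cINF_lower[OF _ S[OF a x]]) (auto simp: d_def intro: bdd_belowI[of _ 0])
  finally show "inf_space_deriv {p..q} T \<le> \<bar>space_deriv (T a) x\<bar>" by (simp add: d_def)
qed

lemma unimodal_family_sup_inf:
  "\<exists>Lam. unimodal_family p q L T c (inf_space_deriv {p..q} T) Lam (sup_param_deriv {p..q} T)"
proof -
  obtain l u where lu: "1 < l" "\<And>a x. a \<in> {p..q} \<Longrightarrow> x \<in> {0..1} \<Longrightarrow> x \<noteq> c a \<Longrightarrow>
    l \<le> \<bar>space_deriv (T a) x\<bar> \<and> \<bar>space_deriv (T a) x\<bar> \<le> u" by (rule fam_deriv_bounds) blast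
  have "unimodal_family p q L T c (inf_space_deriv {p..q} T) u (sup_param_deriv {p..q} T)"
    by unfold_locales (use pq fam lu inf_space_deriv_bounds sup_param_deriv_nonneg param_lip_sup in auto)
  thus ?thesis by blast
qed

end

context unimodal_family begin

text \<open>A single map, viewed as a constant family: its points play the role of the parameters.\<close>

lemma constant_family:
  assumes a: "a \<in> {p..q}"
  shows "unimodal_family 0 1 L (\<lambda>_. T a) (\<lambda>_. c a) lam Lam 0"
proof -
  have L0: "0 \<le> L" by (rule L_nonneg)
  have "pe_unimodal_family L {0..1} (\<lambda>_. T a) (\<lambda>_. c a)"
    unfolding pe_unimodal_family_def
  proof (intro conjI ballI allI impI)
    show "pe_unimodal L (T a) (c a)" by (rule unimodal[OF a])
    have "lam \<le> Lam"
      using deriv_ge[OF a, of 0] deriv_le[OF a, of 0] unimodal_simps(3)[OF a] by simp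
    thus "\<exists>l u. 1 < l \<and> l \<le> u \<and> (\<forall>a'\<in>{0..1::real}. \<forall>x\<in>{0..1}. x \<noteq> c a \<longrightarrow>
      l \<le> \<bar>vector_derivative (T a) (at x within {0..1})\<bar> \<and> \<bar>vector_derivative (T a) (at x within {0..1})\<bar> \<le> u)"
      by (intro exI[of _ lam] exI[of _ Lam]) (use lam deriv_ge[OF a] deriv_le[OF a] in \<open>simp add: space_deriv_def\<close>)
    show "\<exists>\<delta>>0. \<forall>a'\<in>{0..1::real}. \<delta> \<le> c a \<and> \<delta> \<le> 1 - c a"
      using unimodal_simps(3,4)[OF a] by (intro exI[of _ "min (c a) (1 - c a)"]) auto
    show "C1_on J (\<lambda>_. T a x)" for J x
      unfolding C1_on_def by (intro exI[of _ "\<lambda>_. 0"]) auto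
  qed (use L0 in \<open>auto intro!: lipschitz_onI\<close>)
  thus ?thesis
    by unfold_locales (use lam deriv_ge deriv_le a in auto)
qed

end

text \<open>Strict differentiability at a point bounds the difference quotients of all nearby pairs, as is
  needed for a parameter interval; and it passes through compositions without assuming that
  \<open>T a x\<close> is jointly \<open>C\<^sup>1\<close>.\<close>

definition strict_deriv :: "(real \<Rightarrow> real) \<Rightarrow> real \<Rightarrow> real \<Rightarrow> bool" where
  "strict_deriv f a D \<longleftrightarrow>
     (\<forall>e>0. \<exists>r>0. \<forall>s t. \<bar>s - a\<bar> < r \<longrightarrow> \<bar>t - a\<bar> < r \<longrightarrow> \<bar>f s - f t - D * (s - t)\<bar> \<le> e * \<bar>s - t\<bar>)"

lemma strict_deriv_has_real_derivative:
  assumes "strict_deriv f a D"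
  shows "(f has_real_derivative D) (at a)"
  unfolding has_field_derivative_iff Lim_at
proof (intro allI impI)
  fix e :: real assume e: "0 < e"
  hence "0 < e / 2" by simp
  then obtain r where r: "0 < r"
    "\<And>s t. \<bar>s - a\<bar> < r \<Longrightarrow> \<bar>t - a\<bar> < r \<Longrightarrow> \<bar>f s - f t - D * (s - t)\<bar> \<le> e / 2 * \<bar>s - t\<bar>"
    using assms unfolding strict_deriv_def by metis
  show "\<exists>d>0. \<forall>x. 0 < dist x a \<and> dist x a < d \<longrightarrow> dist ((f x - f a) / (x - a)) D < e"
  proof (intro exI[of _ r] conjI allI impI r(1))
    fix x assume x: "0 < dist x a \<and> dist x a < r"
    hence ne: "x - a \<noteq> 0" by (simp add: dist_real_def)
    have "(f x - f a) / (x - a) - D = (f x - f a - D * (x - a)) / (x - a)" using ne by (simp add: field_simps)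
    also have "\<bar>\<dots>\<bar> = \<bar>f x - f a - D * (x - a)\<bar> / \<bar>x - a\<bar>" by (rule abs_divide)
    also have "\<dots> \<le> e / 2" using r(2)[of x a] r(1) x ne by (simp add: dist_real_def pos_divide_le_eq)
    finally show "dist ((f x - f a) / (x - a)) D < e" using e by (simp add: dist_real_def)
  qed
qed

text \<open>The form in which a curve enters \<open>expanding_curve\<close>: a lower bound
  \<open>sg\<close> just below the derivative keeps the strict inequality of the hypothesis.\<close>

lemma strict_deriv_bounds:
  assumes "strict_deriv f a D" "sg < \<bar>D\<bar>"
  obtains r where "0 < r" "\<And>s t. \<bar>s - a\<bar> < r \<Longrightarrow> \<bar>t - a\<bar> < r \<Longrightarrow>
    sg * \<bar>s - t\<bar> \<le> \<bar>f s - f t\<bar> \<and> \<bar>f s - f t\<bar> \<le> (\<bar>D\<bar> + 1) * \<bar>s - t\<bar>"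
proof -
  define e where "e = min 1 (\<bar>D\<bar> - sg)"
  have e: "0 < e" "e \<le> 1" "e \<le> \<bar>D\<bar> - sg" using assms by (auto simp: e_def)
  obtain r where r: "0 < r"
    "\<And>s t. \<bar>s - a\<bar> < r \<Longrightarrow> \<bar>t - a\<bar> < r \<Longrightarrow> \<bar>f s - f t - D * (s - t)\<bar> \<le> e * \<bar>s - t\<bar>"
    using assms(1) e(1) unfolding strict_deriv_def by metis
  have "sg * \<bar>s - t\<bar> \<le> \<bar>f s - f t\<bar> \<and> \<bar>f s - f t\<bar> \<le> (\<bar>D\<bar> + 1) * \<bar>s - t\<bar>" if "\<bar>s - a\<bar> < r" "\<bar>t - a\<bar> < r" for s t
  proof -
    have 1: "\<bar>f s - f t - D * (s - t)\<bar> \<le> e * \<bar>s - t\<bar>" using r(2) that by blast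
    have 2: "\<bar>D * (s - t)\<bar> = \<bar>D\<bar> * \<bar>s - t\<bar>" by (rule abs_mult)
    have 3: "e * \<bar>s - t\<bar> \<le> 1 * \<bar>s - t\<bar>" "e * \<bar>s - t\<bar> \<le> (\<bar>D\<bar> - sg) * \<bar>s - t\<bar>"
      by (rule mult_right_mono[OF e(2) abs_ge_zero], rule mult_right_mono[OF e(3) abs_ge_zero])
    from 3 have "e * \<bar>s - t\<bar> \<le> \<bar>s - t\<bar>" "e * \<bar>s - t\<bar> \<le> \<bar>D\<bar> * \<bar>s - t\<bar> - sg * \<bar>s - t\<bar>"
      by (simp_all only: left_diff_distrib mult_1)
    moreover have "(\<bar>D\<bar> + 1) * \<bar>s - t\<bar> = \<bar>D\<bar> * \<bar>s - t\<bar> + \<bar>s - t\<bar>" by (simp add: distrib_right)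
    ultimately show ?thesis using 1 2 by linarith
  qed
  thus ?thesis using that r(1) by blast
qed

section \<open>Strict derivatives under composition with the family\<close>

context unimodal_family begin

lemma slope_bound:
  assumes s: "s \<in> {p..q}" and xy: "x \<in> {0..1}" "y \<in> {0..1}"
    and ne: "\<And>z. min x y \<le> z \<Longrightarrow> z \<le> max x y \<Longrightarrow> z \<noteq> c s"
    and le: "\<And>z. min x y \<le> z \<Longrightarrow> z \<le> max x y \<Longrightarrow> \<bar>D s z - A\<bar> \<le> B"
  shows "\<bar>T s x - T s y - A * (x - y)\<bar> \<le> B * \<bar>x - y\<bar>"
proof -
  let ?S = "{min x y..max x y}"
  have "norm ((T s x - A * x) - (T s y - A * y)) \<le> B * norm (x - y)"
  proof (rule field_differentiable_bound[where S = ?S and f' = "\<lambda>z. D s z - A"])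
    fix z assume z: "z \<in> ?S"
    have "(T s has_real_derivative D s z) (at z within {0..1})" using z xy ne by (intro has_deriv s) auto
    hence "(T s has_real_derivative D s z) (at z within ?S)" by (rule DERIV_subset) (use xy in auto)
    thus "((\<lambda>z. T s z - A * z) has_real_derivative D s z - A) (at z within ?S)"
      by (auto intro!: derivative_eq_intros)
    show "norm (D s z - A) \<le> B" using le[of z] z by simp
  qed auto
  thus ?thesis by (simp add: algebra_simps)
qed

text \<open>A mixed second difference, estimated by the mean value inequality for
  \<open>T s - T t\<close> in the space variable, since the slopes are \<open>L\<close>-Lipschitz in
  the parameter.\<close>

lemma param_slope_bound:
  assumes st: "s \<in> {p..q}" "t \<in> {p..q}" and xy: "x \<in> {0..1}" "y \<in> {0..1}"
    and ne: "\<And>\<alpha> z. min s t \<le> \<alpha> \<Longrightarrow> \<alpha> \<le> max s t \<Longrightarrow> min x y \<le> z \<Longrightarrow> z \<le> max x y \<Longrightarrow> z \<noteq> c \<alpha>"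
  shows "\<bar>(T s x - T t x) - (T s y - T t y)\<bar> \<le> L * \<bar>s - t\<bar> * \<bar>x - y\<bar>"
proof -
  let ?S = "{min x y..max x y}"
  have "norm ((T s x - T t x) - (T s y - T t y)) \<le> L * \<bar>s - t\<bar> * norm (x - y)"
  proof (rule field_differentiable_bound[where S = ?S and f' = "\<lambda>z. D s z - D t z"])
    fix z assume z: "z \<in> ?S"
    have z01: "z \<in> {0..1}" using z xy by auto
    have "(T s has_real_derivative D s z) (at z within {0..1})" "(T t has_real_derivative D t z) (at z within {0..1})"
      using z ne[of s z] ne[of t z] by (auto intro!: has_deriv st z01)
    hence "(T s has_real_derivative D s z) (at z within ?S)" "(T t has_real_derivative D t z) (at z within ?S)"
      by (auto elim!: DERIV_subset) (use xy in auto)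
    thus "((\<lambda>z. T s z - T t z) has_real_derivative D s z - D t z) (at z within ?S)" by (rule DERIV_diff)
    show "norm (D s z - D t z) \<le> L * \<bar>s - t\<bar>"
      using deriv_param_lip[OF st z01] ne z by simp
  qed auto
  thus ?thesis by simp
qed

text \<open>The increment has four errors of \<open>e / 4\<close> each: changing the point at the
  fixed parameter \<open>s\<close>, linearising \<open>f\<close>, replacing \<open>f t\<close> by
  \<open>f a\<close> in the parameter increment, and linearising
  \<open>s \<mapsto> T s (f a)\<close>, which is \<open>C1_on\<close> near \<open>a\<close>.\<close>

lemma strict_deriv_step:
  assumes a: "p < a" "a < q" and f: "\<And>s. s \<in> {p..q} \<Longrightarrow> f s \<in> {0..1}"
    and sd: "strict_deriv f a f'" and ne: "f a \<noteq> c a"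
  shows "\<exists>B. strict_deriv (\<lambda>s. T s (f s)) a B"
proof -
  define x where "x = f a"
  have aI: "a \<in> {p..q}" using a by auto
  have x01: "x \<in> {0..1}" using f[OF aI] by (simp add: x_def)
  define F where "F = \<bar>f'\<bar> + 1"
  have F: "1 \<le> F" by (simp add: F_def)
  have L0: "0 \<le> L" by (rule L_nonneg)
  define d where "d = \<bar>x - c a\<bar>"
  have d: "0 < d" using ne by (simp add: d_def x_def)
  obtain r1 where r1: "0 < r1" "\<And>s t. \<bar>s - a\<bar> < r1 \<Longrightarrow> \<bar>t - a\<bar> < r1 \<Longrightarrow> \<bar>f s - f t\<bar> \<le> F * \<bar>s - t\<bar>"
  proof -
    obtain r where "0 < r" "\<And>s t. \<bar>s - a\<bar> < r \<Longrightarrow> \<bar>t - a\<bar> < r \<Longrightarrow>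
      (\<bar>f'\<bar> - 1) * \<bar>s - t\<bar> \<le> \<bar>f s - f t\<bar> \<and> \<bar>f s - f t\<bar> \<le> (\<bar>f'\<bar> + 1) * \<bar>s - t\<bar>"
      by (rule strict_deriv_bounds[OF sd, of "\<bar>f'\<bar> - 1"]) auto
    thus ?thesis using that unfolding F_def by blast
  qed
  \<comment> \<open>Within \<open>r0\<close> of \<open>a\<close> the points stay off the turning
    point: they move by at most \<open>F * r0\<close> and \<open>c\<close> by at most
    \<open>L * r0\<close>, together less than \<open>d\<close>.\<close>
  define r0 where "r0 = min r1 (min (min (a - p) (q - a)) (d / (F + L + 1)))"
  have r0: "0 < r0" "r0 \<le> r1" "r0 \<le> a - p" "r0 \<le> q - a" "r0 \<le> d / (F + L + 1)"
    using r1 a d F L0 by (auto simp: r0_def)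
  have "r0 * (F + L + 1) \<le> d" using r0(5) F L0 by (simp add: pos_le_divide_eq)
  hence dr: "F * r0 + L * r0 < d" using r0(1) by (simp add: algebra_simps)
  have I: "s \<in> {p..q}" if "\<bar>s - a\<bar> < r0" for s using that r0 by auto
  have side: "(x < c a \<and> y < c s) \<or> (c a < x \<and> c s < y)" if "\<bar>s - a\<bar> < r0" "\<bar>y - x\<bar> \<le> F * r0" for s y
  proof -
    have "\<bar>c s - c a\<bar> \<le> L * \<bar>s - a\<bar>" by (rule c_lip_L[OF I[OF that(1)] aI])
    also have "\<dots> \<le> L * r0" using that L0 by (intro mult_left_mono) auto
    finally show ?thesis using that(2) dr unfolding d_def by linarith
  qed
  let ?J = "{a - r0 / 2..a + r0 / 2}"
  have "C1_on ?J (\<lambda>s. T s x)"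
  proof -
    have "x \<noteq> c s" if "s \<in> ?J" for s
    proof -
      have "\<bar>s - a\<bar> < r0" using that r0(1) by (auto simp: abs_less_iff)
      thus ?thesis using side[of s x] r0(1) F by auto
    qed
    moreover have "?J \<subseteq> {p..q}" using r0 by auto
    ultimately show ?thesis using fam x01 unfolding pe_unimodal_family_def by (meson is_interval_cc)
  qed
  then obtain g' where g': "\<And>s. s \<in> ?J \<Longrightarrow> ((\<lambda>s. T s x) has_real_derivative g' s) (at s within ?J)"
    "continuous_on ?J g'" unfolding C1_on_def by blast
  have "strict_deriv (\<lambda>s. T s (f s)) a (D a x * f' + g' a)"
    unfolding strict_deriv_def
  proof (intro allI impI)
    fix e :: real assume e: "0 < e"
    have xc: "x \<noteq> c a" using ne by (simp add: x_def)
    have Lam: "\<bar>D a x\<bar> \<le> Lam" by (rule deriv_le[OF aI x01 xc])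
    hence Lam0: "0 \<le> Lam" by simp
    have "0 < e / (4 * (Lam + 1))" using e Lam0 by simp
    then obtain r4 where r4: "0 < r4" "\<And>s t. \<bar>s - a\<bar> < r4 \<Longrightarrow> \<bar>t - a\<bar> < r4 \<Longrightarrow>
        \<bar>f s - f t - f' * (s - t)\<bar> \<le> e / (4 * (Lam + 1)) * \<bar>s - t\<bar>"
      using sd unfolding strict_deriv_def by metis
    have "a \<in> ?J" using r0 by auto
    then obtain r5 where r5: "0 < r5" "\<And>s. s \<in> ?J \<Longrightarrow> \<bar>s - a\<bar> < r5 \<Longrightarrow> \<bar>g' s - g' a\<bar> < e / 4"
      using g'(2) e unfolding continuous_on_iff dist_real_def by (metis zero_less_divide_iff zero_less_numeral)
    define r6 where "r6 = e / (4 * (H0 * (1 + F) * F + 1))"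
    define r7 where "r7 = e / (4 * (L * F + 1))"
    have HF: "0 \<le> H0 * (1 + F) * F" "0 \<le> L * F" using H0_nonneg F L0 by auto
    have r67: "0 < r6" "0 < r7" using e HF by (auto simp: r6_def r7_def)
    have "(H0 * (1 + F) * F + 1) * r6 = e / 4" "(L * F + 1) * r7 = e / 4"
      using HF by (auto simp: r6_def r7_def divide_simps)
    hence e67: "H0 * (1 + F) * F * r6 \<le> e / 4" "L * F * r7 \<le> e / 4" using r67 by (auto simp: algebra_simps)
    define r where "r = min (r0 / 2) (min r4 (min (r5 / 2) (min r6 r7)))"
    have r: "0 < r" "r \<le> r0 / 2" "r \<le> r4" "r \<le> r5 / 2" "r \<le> r6" "r \<le> r7"
      using r0 r4 r5 r67 by (auto simp: r_def)
    have er: "H0 * (1 + F) * F * r \<le> e / 4" "L * F * r \<le> e / 4"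
      using mult_left_mono[OF r(5) HF(1)] mult_left_mono[OF r(6) HF(2)] e67 by linarith+
    show "\<exists>r>0. \<forall>s t. \<bar>s - a\<bar> < r \<longrightarrow> \<bar>t - a\<bar> < r \<longrightarrow>
        \<bar>T s (f s) - T t (f t) - (D a x * f' + g' a) * (s - t)\<bar> \<le> e * \<bar>s - t\<bar>"
    proof (intro exI[of _ r] conjI allI impI r(1))
      fix s t assume s: "\<bar>s - a\<bar> < r" and t: "\<bar>t - a\<bar> < r"
      have s0: "\<bar>s - a\<bar> < r0" and t0: "\<bar>t - a\<bar> < r0" using s t r r0 by auto
      have sI: "s \<in> {p..q}" and tI: "t \<in> {p..q}" using I s0 t0 by auto
      have fx: "\<bar>f u - x\<bar> \<le> F * r" if "\<bar>u - a\<bar> < r" for u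
      proof -
        have "\<bar>f u - x\<bar> \<le> F * \<bar>u - a\<bar>" unfolding x_def by (rule r1(2)) (use that r r0 r1 in auto)
        also have "\<dots> \<le> F * r" using that F by (intro mult_left_mono) auto
        finally show ?thesis .
      qed
      have Fr: "F * r \<le> F * r0" using r r0 F by (intro mult_left_mono) auto
      have near: "\<bar>z - x\<bar> \<le> F * r" if "min (f s) (f t) \<le> z" "z \<le> max (f s) (f t)" for z
        using fx[OF s] fx[OF t] that by (auto simp: min_def max_def split: if_splits)
      have A1: "\<bar>T s (f s) - T s (f t) - D a x * (f s - f t)\<bar> \<le> (H0 * (1 + F) * r) * \<bar>f s - f t\<bar>"
      proof (rule slope_bound[OF sI f[OF sI] f[OF tI]])
        fix z assume z: "min (f s) (f t) \<le> z" "z \<le> max (f s) (f t)"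
        have zx: "\<bar>z - x\<bar> \<le> F * r" by (rule near[OF z])
        have sd: "(x < c a \<and> z < c s) \<or> (c a < x \<and> c s < z)" using side[OF s0, of z] zx Fr by simp
        thus "z \<noteq> c s" by auto
        have z01: "z \<in> {0..1}" using z f[OF sI] f[OF tI] by auto
        have "\<bar>D s z - D a x\<bar> \<le> H0 * (\<bar>s - a\<bar> + \<bar>z - x\<bar>)"
          by (rule deriv_joint_lip[OF sI aI z01 x01]) (use sd in auto)
        also have "\<dots> \<le> H0 * (r + F * r)" using s zx H0_nonneg by (intro mult_left_mono add_mono) auto
        also have "\<dots> = H0 * (1 + F) * r" by (simp add: algebra_simps)
        finally show "\<bar>D s z - D a x\<bar> \<le> H0 * (1 + F) * r" .
      qed
      have "(H0 * (1 + F) * r) * \<bar>f s - f t\<bar> \<le> (H0 * (1 + F) * r) * (F * \<bar>s - t\<bar>)"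
        using r1(2)[of s t] s0 t0 r0 H0_nonneg F r(1) by (intro mult_left_mono) auto
      also have "\<dots> = (H0 * (1 + F) * F * r) * \<bar>s - t\<bar>" by simp
      also have "\<dots> \<le> e / 4 * \<bar>s - t\<bar>" by (intro mult_right_mono er) simp
      finally have B1: "\<bar>T s (f s) - T s (f t) - D a x * (f s - f t)\<bar> \<le> e / 4 * \<bar>s - t\<bar>" using A1 by linarith
      have B2: "\<bar>D a x * (f s - f t) - D a x * f' * (s - t)\<bar> \<le> e / 4 * \<bar>s - t\<bar>"
      proof -
        have "\<bar>D a x * (f s - f t) - D a x * f' * (s - t)\<bar> = \<bar>D a x\<bar> * \<bar>f s - f t - f' * (s - t)\<bar>"
          by (simp add: abs_mult[symmetric] algebra_simps)
        also have "\<dots> \<le> (Lam + 1) * (e / (4 * (Lam + 1)) * \<bar>s - t\<bar>)"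
          using Lam r4(2)[of s t] s t r by (intro mult_mono) auto
        also have "\<dots> = e / 4 * \<bar>s - t\<bar>"
        proof -
          have "(Lam + 1) * (e / (4 * (Lam + 1)) * u) = e / 4 * u" for u
            using Lam0 by (simp add: divide_simps)
          thus ?thesis .
        qed
        finally show ?thesis .
      qed
      have B3: "\<bar>(T s (f t) - T t (f t)) - (T s x - T t x)\<bar> \<le> e / 4 * \<bar>s - t\<bar>"
      proof -
        have "\<bar>(T s (f t) - T t (f t)) - (T s x - T t x)\<bar> \<le> L * \<bar>s - t\<bar> * \<bar>f t - x\<bar>"
        proof (rule param_slope_bound[OF sI tI f[OF tI] x01])
          fix \<alpha> z assume "min s t \<le> \<alpha>" "\<alpha> \<le> max s t" and z: "min (f t) x \<le> z" "z \<le> max (f t) x"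
          hence "\<bar>\<alpha> - a\<bar> < r0" using s0 t0 by (auto simp: min_def max_def split: if_splits)
          moreover have "\<bar>z - x\<bar> \<le> F * r0" using fx[OF t] Fr z by (auto simp: min_def max_def split: if_splits)
          ultimately show "z \<noteq> c \<alpha>" using side[of \<alpha> z] by auto
        qed
        also have "\<dots> \<le> L * \<bar>s - t\<bar> * (F * r)" using fx[OF t] L0 by (intro mult_left_mono) auto
        also have "\<dots> = (L * F * r) * \<bar>s - t\<bar>" by simp
        also have "\<dots> \<le> e / 4 * \<bar>s - t\<bar>" by (intro mult_right_mono er) simp
        finally show ?thesis .
      qed
      have B4: "\<bar>T s x - T t x - g' a * (s - t)\<bar> \<le> e / 4 * \<bar>s - t\<bar>"
      proof -
        let ?S = "{a - r..a + r}"
        have SJ: "?S \<subseteq> ?J" using r by auto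
        have "norm ((T s x - g' a * s) - (T t x - g' a * t)) \<le> e / 4 * norm (s - t)"
        proof (rule field_differentiable_bound[where S = ?S and f' = "\<lambda>u. g' u - g' a"])
          fix u assume u: "u \<in> ?S"
          have "((\<lambda>s. T s x) has_real_derivative g' u) (at u within ?S)"
            by (rule DERIV_subset[OF g'(1) SJ]) (use u SJ in blast)
          thus "((\<lambda>u. T u x - g' a * u) has_real_derivative g' u - g' a) (at u within ?S)"
            by (auto intro!: derivative_eq_intros)
          have "\<bar>u - a\<bar> < r5" using u r r5 by auto
          thus "norm (g' u - g' a) \<le> e / 4" using r5(2)[of u] u SJ by fastforce
        qed (use s t in auto)
        thus ?thesis by (simp add: algebra_simps)
      qed
      have "T s (f s) - T t (f t) - (D a x * f' + g' a) * (s - t) =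
          (T s (f s) - T s (f t) - D a x * (f s - f t)) + (D a x * (f s - f t) - D a x * f' * (s - t)) +
          ((T s (f t) - T t (f t)) - (T s x - T t x)) + (T s x - T t x - g' a * (s - t))"
        by (simp add: algebra_simps)
      moreover have "e * \<bar>s - t\<bar> = e / 4 * \<bar>s - t\<bar> + e / 4 * \<bar>s - t\<bar> + e / 4 * \<bar>s - t\<bar> + e / 4 * \<bar>s - t\<bar>" by simp
      ultimately show "\<bar>T s (f s) - T t (f t) - (D a x * f' + g' a) * (s - t)\<bar> \<le> e * \<bar>s - t\<bar>"
        using B1 B2 B3 B4 by linarith
    qed
  qed
  thus ?thesis by blast
qed

end

section \<open>The critical orbit\<close>

context unimodal_family begin

sublocale exp: expanding_family p q T c lam Lam K "2 * H0"
  by (rule expanding_family_sub) (use p_less_q in auto)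

definition orb :: "nat \<Rightarrow> real \<Rightarrow> real" where "orb j a = (T a ^^ j) (c a)"

lemma orb_Suc: "orb (Suc j) a = T a (orb j a)"
  by (simp add: orb_def)

lemma orb_0: "orb 0 a = c a"
  by (simp add: orb_def)

lemma c_in: "a \<in> {p..q} \<Longrightarrow> c a \<in> {0..1}"
  using unimodal_simps(3,4) by (auto intro: less_imp_le)

lemma orb_in: "a \<in> {p..q} \<Longrightarrow> orb j a \<in> {0..1}"
  by (induction j) (simp_all only: orb_0 orb_Suc c_in unimodal_simps(1))

lemma continuous_orb: "continuous_on {p..q} (orb j)"
proof (induction j)
  case 0 show ?case using exp.continuous_c by (simp add: orb_0)
next
  case (Suc j)
  show ?case unfolding orb_Suc by (rule exp.continuous_step[OF Suc orb_in])
qed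

lemma orb_2: "a \<in> {p..q} \<Longrightarrow> orb 2 a = 0"
  using unimodal_simps(5,6) by (simp add: numeral_2_eq_2 orb_Suc orb_0)

text \<open>The induction starts at time 2, where the orbit is constantly 0; at time 0 it is the
  turning point, which is only known to be Lipschitz in the parameter.\<close>

lemma strict_deriv_orb:
  assumes a: "p < a" "a < q" and j: "2 \<le> j" and ne: "\<And>k. 1 \<le> k \<Longrightarrow> k < j \<Longrightarrow> orb k a \<noteq> c a"
  shows "\<exists>B. strict_deriv (orb j) a B"
  using j ne
proof (induction j rule: dec_induct)
  case base
  have "strict_deriv (orb 2) a 0" unfolding strict_deriv_def
  proof (intro allI impI exI[of _ "min (a - p) (q - a)"] conjI)
    fix e s t :: real assume "0 < e" "\<bar>s - a\<bar> < min (a - p) (q - a)" "\<bar>t - a\<bar> < min (a - p) (q - a)"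
    hence "s \<in> {p..q}" "t \<in> {p..q}" by auto
    thus "\<bar>orb 2 s - orb 2 t - 0 * (s - t)\<bar> \<le> e * \<bar>s - t\<bar>" using \<open>0 < e\<close> by (simp add: orb_2)
  qed (use a in auto)
  thus ?case by blast
next
  case (step j)
  then obtain B where "strict_deriv (orb j) a B" by auto
  from strict_deriv_step[OF a orb_in this] step
  show ?case unfolding orb_Suc[abs_def] by auto
qed

definition returns :: "nat \<Rightarrow> real set" where "returns k = {a \<in> {p..q}. orb k a = c a}"

lemma closed_returns: "closed (returns k)"
proof -
  have "closed ({p..q} \<inter> (\<lambda>a. orb k a - c a) -` {0})"
    by (intro continuous_closed_preimage continuous_on_diff continuous_orb exp.continuous_c) auto
  moreover have "returns k = {p..q} \<inter> (\<lambda>a. orb k a - c a) -` {0}" by (auto simp: returns_def)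
  ultimately show ?thesis by simp
qed

lemma orb_mult:
  assumes "a \<in> returns k"
  shows "orb (k * m) a = c a"
proof (induction m)
  case (Suc m)
  have "orb (k * Suc m) a = (T a ^^ k) (orb (k * m) a)"
    by (simp add: orb_def funpow_add)
  also have "\<dots> = orb k a" unfolding Suc by (simp add: orb_def)
  also have "\<dots> = c a" using assms by (simp add: returns_def)
  finally show ?case .
qed (simp add: orb_0)

text \<open>The critical orbit moves faster in the parameter than the turning point does, and this
  persists along the orbit, also when it passes through the turning point. A parameter that is a
  limit of parameters with a periodic turning point would contradict this after a multiple of the
  period.\<close>

lemma returns_no_limit_point:
  assumes a0: "a0 \<in> {p..q}" and dv: "(orb j0 has_real_derivative dv) (at a0 within {p..q})"
    and big: "K / (lam - 1) < \<bar>dv\<bar>" and k: "1 \<le> k"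
  shows "\<not> a0 islimpt returns k"
proof
  assume lp: "a0 islimpt returns k"
  hence mem: "a0 \<in> returns k" using closed_returns closed_limpt by blast
  obtain sg where sg: "K / (lam - 1) < sg" "sg < \<bar>dv\<bar>" using dense[OF big] by blast
  have Ksg: "K \<le> (lam - 1) * sg" using sg(1) lam by (simp add: pos_divide_less_eq mult.commute)
  define P where "P i \<longleftrightarrow> (\<forall>\<^sub>F a in at a0 within {p..q}. sg * \<bar>a - a0\<bar> \<le> \<bar>orb i a - orb i a0\<bar>)" for i
  have "P j0"
  proof -
    have "((\<lambda>a. \<bar>(orb j0 a - orb j0 a0) / (a - a0)\<bar>) \<longlongrightarrow> \<bar>dv\<bar>) (at a0 within {p..q})"
      using dv unfolding has_field_derivative_iff by (rule tendsto_rabs)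
    hence "\<forall>\<^sub>F a in at a0 within {p..q}. sg < \<bar>(orb j0 a - orb j0 a0) / (a - a0)\<bar>"
      by (rule order_tendstoD(1)[OF _ sg(2)])
    moreover have "\<forall>\<^sub>F a in at a0 within {p..q}. a \<noteq> a0" by (simp add: eventually_at_filter)
    ultimately show ?thesis unfolding P_def
    proof eventually_elim
      case (elim a)
      thus ?case by (simp add: abs_divide pos_less_divide_eq less_imp_le)
    qed
  qed
  have ev_in: "\<forall>\<^sub>F a in at a0 within {p..q}. a \<in> {p..q}" by (simp add: eventually_at_filter)
  have step: "P (Suc i)" if "P i" for i
  proof -
    have grow: "sg * \<bar>a - a0\<bar> \<le> \<bar>orb (Suc i) a - orb (Suc i) a0\<bar>"
      if "sg * \<bar>a - a0\<bar> \<le> \<bar>orb i a - orb i a0\<bar>"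
        "lam * \<bar>orb i a - orb i a0\<bar> - K * \<bar>a - a0\<bar> \<le> \<bar>orb (Suc i) a - orb (Suc i) a0\<bar>" for a
    proof -
      have "lam * (sg * \<bar>a - a0\<bar>) \<le> lam * \<bar>orb i a - orb i a0\<bar>" using that(1) lam by (intro mult_left_mono) auto
      moreover have "K * \<bar>a - a0\<bar> \<le> (lam - 1) * sg * \<bar>a - a0\<bar>" by (intro mult_right_mono Ksg) simp
      ultimately show ?thesis using that(2) by (simp add: algebra_simps)
    qed
    show ?thesis
    proof (cases "orb i a0 = c a0")
      case True
      \<comment> \<open>Here \<open>orb (Suc i) a0\<close> is 1, which is also
        \<open>T a (c a)\<close>. So the comparison is made at the parameter \<open>a\<close> alone,
        and the only loss is the movement of \<open>c\<close>, of slope at most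
        \<open>K / lam\<close>, which amounts to \<open>K\<close> after expansion.\<close>
      from that[unfolded P_def] ev_in show ?thesis unfolding P_def
      proof eventually_elim
        case (elim a)
        have c1: "lam * \<bar>orb i a - c a\<bar> \<le> \<bar>T a (orb i a) - T a (c a)\<bar>"
          using linear[of "orb i a" "c a"] by (intro expand(1) elim orb_in c_in) auto
        have "T a (c a) = orb (Suc i) a0"
          using unimodal_simps(5)[OF elim(2)] unimodal_simps(5)[OF a0] True by (simp add: orb_Suc)
        hence c2: "lam * \<bar>orb i a - c a\<bar> \<le> \<bar>orb (Suc i) a - orb (Suc i) a0\<bar>" using c1 by (simp add: orb_Suc)
        have "\<bar>orb i a - orb i a0\<bar> \<le> \<bar>orb i a - c a\<bar> + K / lam * \<bar>a - a0\<bar>"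
          using c_lip[OF elim(2) a0] True by linarith
        hence "lam * \<bar>orb i a - orb i a0\<bar> \<le> lam * (\<bar>orb i a - c a\<bar> + K / lam * \<bar>a - a0\<bar>)"
          using lam by (intro mult_left_mono) auto
        also have "\<dots> = lam * \<bar>orb i a - c a\<bar> + K * \<bar>a - a0\<bar>" using lam by (simp add: distrib_left)
        finally show ?case using c2 by (intro grow elim) linarith
      qed
    next
      case False
      have lim: "((\<lambda>a. orb i a - c a) \<longlongrightarrow> orb i a0 - c a0) (at a0 within {p..q})"
        using continuous_on_diff[OF continuous_orb exp.continuous_c] a0 by (simp add: continuous_on_def)
      have "\<forall>\<^sub>F a in at a0 within {p..q}. (orb i a \<le> c a \<and> orb i a0 \<le> c a0) \<or> (c a \<le> orb i a \<and> c a0 \<le> orb i a0)"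
      proof (cases "orb i a0 < c a0")
        case True
        hence "\<forall>\<^sub>F a in at a0 within {p..q}. orb i a - c a < 0" by (intro order_tendstoD(2)[OF lim]) simp
        thus ?thesis by eventually_elim (use True in auto)
      next
        case F: False
        hence "\<forall>\<^sub>F a in at a0 within {p..q}. 0 < orb i a - c a" using False by (intro order_tendstoD(1)[OF lim]) simp
        thus ?thesis by eventually_elim (use F in auto)
      qed
      with that[unfolded P_def] ev_in show ?thesis unfolding P_def
      proof eventually_elim
        case (elim a)
        from exp.two_point_growth[OF elim(2) a0 orb_in[OF elim(2)] orb_in[OF a0] elim(3)] elim(1)
        show ?case by (intro grow) (simp_all add: orb_Suc)
      qed
    qed
  qed
  \<comment> \<open>The estimate is carried from \<open>j0\<close> to the multiple
    \<open>k * j0\<close> of the period, where returning parameters have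
    \<open>orb (k * j0) a = c a\<close>; there \<open>c\<close> would move faster than its Lipschitz
    constant allows.\<close>
  have "P (j0 + n)" for n using \<open>P j0\<close> step by (induction n) auto
  moreover have "j0 \<le> k * j0" using k by simp
  ultimately have "P (k * j0)" by (metis le_add_diff_inverse)
  then obtain d where d: "0 < d" "\<And>a. a \<in> {p..q} \<Longrightarrow> a \<noteq> a0 \<Longrightarrow> dist a a0 < d \<Longrightarrow>
      sg * \<bar>a - a0\<bar> \<le> \<bar>orb (k * j0) a - orb (k * j0) a0\<bar>"
    unfolding P_def eventually_at by blast
  obtain a where a: "a \<in> returns k" "a \<noteq> a0" "dist a a0 < d"
    using lp d(1) unfolding islimpt_approachable by blast
  have aI: "a \<in> {p..q}" using a by (simp add: returns_def)
  have "sg * \<bar>a - a0\<bar> \<le> \<bar>c a - c a0\<bar>" using d(2)[OF aI a(2,3)] orb_mult[OF a(1)] orb_mult[OF mem] by simp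
  also have "\<dots> \<le> K / lam * \<bar>a - a0\<bar>" by (rule c_lip[OF aI a0])
  finally have "sg \<le> K / lam" using a(2) by (simp only: mult_le_cancel_right_pos zero_less_abs_iff right_minus_eq not_False_eq_True)
  moreover have "K / lam \<le> K / (lam - 1)" using K lam by (intro divide_left_mono) auto
  ultimately show False using sg(1) by linarith
qed

lemma eventually_nonreturning:
  assumes a0: "a0 \<in> {p..q}" and ne: "\<And>k. 1 \<le> k \<Longrightarrow> orb k a0 \<noteq> c a0"
  obtains h r where "0 < h" "0 < r"
    "\<And>a j. a \<in> {p..q} \<Longrightarrow> \<bar>a - a0\<bar> < r \<Longrightarrow> 1 \<le> j \<Longrightarrow> j \<le> N \<Longrightarrow> h \<le> \<bar>orb j a - c a\<bar>"
proof -
  define d where "d j a = \<bar>orb j a - c a\<bar>" for j a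
  \<comment> \<open>The 1 keeps the set nonempty when \<open>N = 0\<close>.\<close>
  define h where "h = Min (insert 1 ((\<lambda>j. d j a0 / 2) ` {1..N}))"
  have h: "0 < h" using ne by (auto simp: h_def d_def)
  have "\<forall>\<^sub>F a in at a0 within {p..q}. h < d j a" if "j \<in> {1..N}" for j
  proof (rule order_tendstoD(1))
    show "(d j \<longlongrightarrow> d j a0) (at a0 within {p..q})"
      using continuous_on_rabs[OF continuous_on_diff[OF continuous_orb[of j] exp.continuous_c]] a0
      by (simp add: continuous_on_def d_def[abs_def])
    have "h \<le> d j a0 / 2" unfolding h_def using that by (intro Min_le) auto
    moreover have "0 < d j a0" using ne that by (simp add: d_def)
    ultimately show "h < d j a0" by simp
  qed
  hence "\<forall>\<^sub>F a in at a0 within {p..q}. \<forall>j\<in>{1..N}. h < d j a" by (intro eventually_ball_finite) auto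
  then obtain r where r: "0 < r" "\<And>a. a \<in> {p..q} \<Longrightarrow> a \<noteq> a0 \<Longrightarrow> dist a a0 < r \<Longrightarrow> \<forall>j\<in>{1..N}. h < d j a"
    unfolding eventually_at by blast
  have "h \<le> d j a" if "a \<in> {p..q}" "\<bar>a - a0\<bar> < r" "1 \<le> j" "j \<le> N" for a j
  proof (cases "a = a0")
    case True
    have "h \<le> d j a0 / 2" unfolding h_def using that by (intro Min_le) auto
    thus ?thesis using True by (simp add: d_def)
  next
    case False
    thus ?thesis using r(2)[OF that(1)] that by (auto simp: dist_real_def less_imp_le)
  qed
  thus ?thesis using that[OF h r(1)] by (simp add: d_def)
qed

section \<open>Visit frequencies near a parameter with nonperiodic turning point\<close>

definition good_freq :: "real \<Rightarrow> bool" where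
  "good_freq a \<longleftrightarrow> (\<exists>C>0. \<forall>r\<in>\<rat>. \<forall>t\<in>\<rat>. r < t \<longrightarrow>
     (\<forall>\<^sub>F n in sequentially. real (card {i. i < n \<and> orb i a \<in> {r..t}}) \<le> C * (t - r) * n))"

text \<open>The first \<open>j0\<close> times add at most \<open>j0\<close> visits, which the
  doubled constant absorbs for large \<open>n\<close>.\<close>

lemma good_freq_shift:
  assumes "0 < C" and f: "\<forall>r\<in>\<rat>. \<forall>t\<in>\<rat>. r < t \<longrightarrow>
     (\<forall>\<^sub>F n in sequentially. real (card {i. i < n \<and> orb (i + j0) a \<in> {r..t}}) \<le> C * (t - r) * n)"
  shows "good_freq a"
  unfolding good_freq_def
proof (intro exI[of _ "2 * C"] conjI ballI impI)
  fix r t :: real assume rt: "r \<in> \<rat>" "t \<in> \<rat>" "r < t"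
  have "\<forall>\<^sub>F n in sequentially. real j0 / (C * (t - r)) \<le> real n"
    using filterlim_real_sequentially by (simp add: filterlim_at_top)
  moreover have "\<forall>\<^sub>F n in sequentially. real (card {i. i < n \<and> orb (i + j0) a \<in> {r..t}}) \<le> C * (t - r) * n"
    using f rt by blast
  ultimately show "\<forall>\<^sub>F n in sequentially. real (card {i. i < n \<and> orb i a \<in> {r..t}}) \<le> 2 * C * (t - r) * n"
  proof eventually_elim
    case (elim n)
    have "{i. i < n \<and> orb i a \<in> {r..t}} \<subseteq> {..<j0} \<union> (\<lambda>i. i + j0) ` {i. i < n \<and> orb (i + j0) a \<in> {r..t}}"
    proof
      fix i assume i: "i \<in> {i. i < n \<and> orb i a \<in> {r..t}}"
      show "i \<in> {..<j0} \<union> (\<lambda>i. i + j0) ` {i. i < n \<and> orb (i + j0) a \<in> {r..t}}"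
      proof (cases "i < j0")
        case False
        hence "i = (i - j0) + j0" by simp
        thus ?thesis using i by (intro UnI2 image_eqI[of _ _ "i - j0"]) auto
      qed simp
    qed
    hence "card {i. i < n \<and> orb i a \<in> {r..t}} \<le> card ({..<j0} \<union> (\<lambda>i. i + j0) ` {i. i < n \<and> orb (i + j0) a \<in> {r..t}})"
      by (intro card_mono) auto
    also have "\<dots> \<le> card {..<j0} + card ((\<lambda>i. i + j0) ` {i. i < n \<and> orb (i + j0) a \<in> {r..t}})" by (rule card_Un_le)
    also have "\<dots> \<le> j0 + card {i. i < n \<and> orb (i + j0) a \<in> {r..t}}" by (simp add: card_image_le)
    finally have "real (card {i. i < n \<and> orb i a \<in> {r..t}}) \<le> j0 + C * (t - r) * n" using elim(2) by linarith
    moreover have "real j0 \<le> C * (t - r) * n" using elim(1) assms(1) rt by (simp add: pos_divide_le_eq mult.commute)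
    ultimately show ?case by (simp add: algebra_simps)
  qed
qed (use assms(1) in simp)

lemma local_good_freq:
  assumes a0: "p < a0" "a0 < q" and dv: "(orb j0 has_real_derivative dv) (at a0 within {p..q})"
    and big: "K / (lam - 1) < \<bar>dv\<bar>" and ne: "\<And>k. 1 \<le> k \<Longrightarrow> orb k a0 \<noteq> c a0" and j0: "2 \<le> j0"
  shows "\<exists>r>0. AE a in lborel. \<bar>a - a0\<bar> < r \<longrightarrow> good_freq a"
proof -
  have a0I: "a0 \<in> {p..q}" using a0 by auto
  \<comment> \<open>The hypothesis only gives a derivative at \<open>a0\<close>. As the orbit never
    returns to the turning point, a strict derivative exists too; the two coincide, so all nearby
    difference quotients are controlled.\<close>
  obtain B where B: "strict_deriv (orb j0) a0 B" using strict_deriv_orb[OF a0 j0 ne] by blast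
  have at: "at a0 within {p..q} = at a0" using a0 by (intro at_within_interior) auto
  have "B = dv" using DERIV_unique[OF strict_deriv_has_real_derivative[OF B]] dv unfolding at by blast
  with B have sD: "strict_deriv (orb j0) a0 dv" by simp
  obtain s0 where s0: "K / (lam - 1) < s0" "s0 < \<bar>dv\<bar>" using dense[OF big] by blast
  obtain r0 where r0: "0 < r0" "\<And>s t. \<bar>s - a0\<bar> < r0 \<Longrightarrow> \<bar>t - a0\<bar> < r0 \<Longrightarrow>
    s0 * \<bar>s - t\<bar> \<le> \<bar>orb j0 s - orb j0 t\<bar> \<and> \<bar>orb j0 s - orb j0 t\<bar> \<le> (\<bar>dv\<bar> + 1) * \<bar>s - t\<bar>"
    using strict_deriv_bounds[OF sD s0(2)] by metis
  define X where "X n a = orb (n + j0) a" for n a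
  have curve: "expanding_curve (a0 - e) (a0 + e) T c lam Lam K (2 * H0) X s0 (\<bar>dv\<bar> + 1)"
    if e: "0 < e" "e < r0" "p \<le> a0 - e" "a0 + e \<le> q" for e
  proof -
    interpret E: expanding_family "a0 - e" "a0 + e" T c lam Lam K "2 * H0"
      by (rule expanding_family_sub) (use e in auto)
    show ?thesis
    proof unfold_locales
      fix a b assume "a \<in> {a0 - e..a0 + e}" "b \<in> {a0 - e..a0 + e}"
      hence "\<bar>a - a0\<bar> < r0" "\<bar>b - a0\<bar> < r0" using e by auto
      from r0(2)[OF this] show "s0 * \<bar>a - b\<bar> \<le> \<bar>X 0 a - X 0 b\<bar>" "\<bar>X 0 a - X 0 b\<bar> \<le> (\<bar>dv\<bar> + 1) * \<bar>a - b\<bar>"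
        by (simp_all add: X_def)
    next
      fix a assume "a \<in> {a0 - e..a0 + e}"
      hence "a \<in> {p..q}" using e by auto
      thus "X 0 a \<in> {0..1}" unfolding X_def by (rule orb_in)
    qed (simp_all add: s0 X_def orb_Suc)
  qed
  define e0 where "e0 = min (r0 / 2) (min (a0 - p) (q - a0))"
  have e0: "0 < e0" "e0 < r0" "p \<le> a0 - e0" "a0 + e0 \<le> q" using r0 a0 by (auto simp: e0_def)
  interpret E0: expanding_curve "a0 - e0" "a0 + e0" T c lam Lam K "2 * H0" X s0 "\<bar>dv\<bar> + 1"
    by (rule curve[OF e0])
  \<comment> \<open>\<open>N\<close> is fixed on the larger interval. As \<open>dist_const\<close>
    and \<open>growth_const\<close> do not involve the end points, \<open>N'\<close> remains valid
    after shrinking to \<open>e\<close>, which depends on \<open>N\<close>.\<close>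
  obtain N where N: "4 * E0.dist_const / E0.growth_const < lam ^ N" using real_arch_pow[OF lam] by blast
  hence N': "4 * E0.dist_const \<le> E0.growth_const * lam ^ N" using E0.growth_const_pos by (simp add: pos_divide_less_eq mult.commute)
  obtain h r1 where h: "0 < h" "0 < r1"
    "\<And>a j. a \<in> {p..q} \<Longrightarrow> \<bar>a - a0\<bar> < r1 \<Longrightarrow> 1 \<le> j \<Longrightarrow> j \<le> N \<Longrightarrow> h \<le> \<bar>orb j a - c a\<bar>"
    using eventually_nonreturning[OF a0I ne] by metis
  define e where "e = min e0 (r1 / 2)"
  have e: "0 < e" "e < r0" "p \<le> a0 - e" "a0 + e \<le> q" "e < r1" using e0 h by (auto simp: e_def)
  interpret E: expanding_curve "a0 - e" "a0 + e" T c lam Lam K "2 * H0" X s0 "\<bar>dv\<bar> + 1"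
    by (rule curve[OF e(1-4)])
  interpret E: nonrecurrent_curve "a0 - e" "a0 + e" T c lam Lam K "2 * H0" X s0 "\<bar>dv\<bar> + 1" N h
  proof unfold_locales
    show "4 * E.dist_const \<le> E.growth_const * lam ^ N" by (rule N')
    show "0 < h" by (rule h)
    fix a j assume "a \<in> {a0 - e..a0 + e}" "1 \<le> j" "j \<le> N"
    moreover from this have "a \<in> {p..q}" "\<bar>a - a0\<bar> < r1" using e by auto
    ultimately show "h \<le> \<bar>(T a ^^ j) (c a) - c a\<bar>" using h(3)[of a j] by (simp add: orb_def)
  qed
  obtain C where C: "0 < C" "AE a in lborel. a \<in> {a0 - e..a0 + e} \<longrightarrow>
     (\<forall>r\<in>\<rat>. \<forall>t\<in>\<rat>. r < t \<longrightarrow>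
        (\<forall>\<^sub>F n in sequentially. real (card {i. i < n \<and> X i a \<in> {r..t}}) \<le> C * (t - r) * n))"
    using E.frequency_AE by blast
  have "AE a in lborel. \<bar>a - a0\<bar> < e \<longrightarrow> good_freq a"
    using C(2)
  proof eventually_elim
    case (elim a)
    show ?case
    proof
      assume "\<bar>a - a0\<bar> < e"
      hence "a \<in> {a0 - e..a0 + e}" by auto
      with elim show "good_freq a" unfolding X_def by (intro good_freq_shift[OF C(1)]) blast
    qed
  qed
  thus ?thesis using e(1) by blast
qed

text \<open>The curves are \<open>y \<mapsto> (S ^^ n) y\<close> on the whole unit interval, with
  \<open>K = 0\<close> and initial slope 1. The nonperiodic turning point again supplies
  \<open>h\<close> for any \<open>N\<close>, now without shrinking the interval because the map is
  the same for all \<open>y\<close>.\<close>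

lemma ergodic_if_mixing:
  assumes a: "a \<in> {p..q}" and mix: "topologically_mixing (T a)" and ne: "\<And>k. 1 \<le> k \<Longrightarrow> orb k a \<noteq> c a"
  shows "nonsingular_ergodic (T a)"
proof -
  define S where "S = T a"
  have cont: "continuous_on {0..1} S" and range: "S ` {0..1} \<subseteq> {0..1}"
    using unimodal_simps(1,2)[OF a] by (auto simp: S_def)
  interpret cf: unimodal_family 0 1 L "\<lambda>_. S" "\<lambda>_. c a" lam Lam 0
    unfolding S_def by (rule constant_family[OF a])
  define X where "X n y = (S ^^ n) y" for n and y :: real
  interpret E: expanding_curve 0 1 "\<lambda>_. S" "\<lambda>_. c a" lam Lam 0 "2 * cf.H0" X 1 1
    by unfold_locales (use lam in \<open>auto simp: X_def\<close>)
  obtain N where N: "4 * E.dist_const / E.growth_const < lam ^ N" using real_arch_pow[OF lam] by blast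
  obtain h r where h: "0 < h" "\<And>j. 1 \<le> j \<Longrightarrow> j \<le> N \<Longrightarrow> h \<le> \<bar>orb j a - c a\<bar>"
    using eventually_nonreturning[OF a ne, of N] a by (metis abs_zero diff_self)
  interpret E: nonrecurrent_curve 0 1 "\<lambda>_. S" "\<lambda>_. c a" lam Lam 0 "2 * cf.H0" X 1 1 N h
  proof unfold_locales
    show "4 * E.dist_const \<le> E.growth_const * lam ^ N" using N E.growth_const_pos by (simp add: pos_divide_less_eq mult.commute)
    show "0 < h" by (rule h)
    fix j assume "1 \<le> j" "j \<le> N"
    thus "h \<le> \<bar>(S ^^ j) (c a) - c a\<bar>" using h(2)[of j] by (simp add: orb_def S_def)
  qed
  have ns: "S -` M \<inter> {0..1} \<in> null_sets lebesgue01" if "M \<in> null_sets lebesgue01" for M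
  proof (rule expanding_nonsingular[OF cont range _ that, of "c a"])
    fix x y assume "x \<in> {0..1}" "y \<in> {0..1}" "(x \<le> c a \<and> y \<le> c a) \<or> (c a \<le> x \<and> c a \<le> y)"
    hence "lam * \<bar>x - y\<bar> \<le> \<bar>S x - S y\<bar>" unfolding S_def by (rule expand(1)[OF a])
    moreover have "\<bar>x - y\<bar> \<le> lam * \<bar>x - y\<bar>" using mult_right_mono[of 1 lam "\<bar>x - y\<bar>"] lam by simp
    ultimately show "\<bar>x - y\<bar> \<le> \<bar>S x - S y\<bar>" by (rule order_trans[rotated])
  qed
  note ns_n = nonsingular_funpow[OF range ns]
  have interval: "\<exists>x y. 0 \<le> x \<and> x < y \<and> y \<le> 1 \<and> {x..y} - A \<in> null_sets lebesgue01"
    if A: "A \<in> sets lebesgue01" "A \<notin> null_sets lebesgue01"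
      and inv: "\<And>x. x \<in> {0..1} \<Longrightarrow> S x \<in> A \<longleftrightarrow> x \<in> A" for A
  proof (rule ccontr)
    assume no: "\<not> ?thesis"
    have Ab: "A \<in> sets borel" "A \<subseteq> {0..1}" using A by (auto simp: sets_lebesgue01)
    have "emeasure lborel (A \<inter> {0..1}) = 0"
    proof (rule E.invariant_set_null[OF Ab(1)])
      fix m y assume y: "y \<in> {0..1::real}"
      show "X m y \<in> A \<longleftrightarrow> y \<in> A" unfolding X_def
        by (induction m) (use inv funpow_mem[OF range y] in auto)
    next
      fix x y :: real assume xy: "0 \<le> x" "x < y" "y \<le> 1"
      have "{x..y} - A \<notin> null_sets lebesgue01" using no xy by blast
      hence "emeasure lborel ({x..y} - A) \<noteq> 0" using xy Ab by (auto simp: null_sets_lebesgue01)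
      thus "0 < measure lborel ({x..y} - A)"
        using Icc_Diff_fmeasurable[OF Ab(1), of x y] by (simp add: emeasure_eq_measure2 zero_less_measure_iff)
    qed
    hence "A \<in> null_sets lebesgue01" using Ab by (auto simp: null_sets_lebesgue01 Int_absorb2)
    thus False using A by blast
  qed
  have erg: "A \<in> null_sets lebesgue01 \<or> {0..1} - A \<in> null_sets lebesgue01"
    if A: "A \<in> sets lebesgue01" and inv: "\<And>x. x \<in> {0..1} \<Longrightarrow> S x \<in> A \<longleftrightarrow> x \<in> A" for A
  proof (rule ccontr)
    assume no: "\<not> ?thesis"
    have A': "{0..1} - A \<in> sets lebesgue01" using A by (auto simp: sets_lebesgue01)
    have inv': "S x \<in> {0..1} - A \<longleftrightarrow> x \<in> {0..1} - A" if "x \<in> {0..1}" for x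
      using inv[OF that] range that by blast
    obtain x y where xy: "0 \<le> x" "x < y" "y \<le> 1" "{x..y} - A \<in> null_sets lebesgue01"
      using interval[OF A _ inv] no by blast
    obtain x' y' where xy': "0 \<le> x'" "x' < y'" "y' \<le> 1" "{x'..y'} - ({0..1} - A) \<in> null_sets lebesgue01"
      using interval[OF A' _ inv'] no by blast
    have sub: "{x<..<y} \<subseteq> {0..1}" "{x'<..<y'} \<subseteq> {0..1}" using xy xy' by auto
    have op: "openin (top_of_set {0..1}) {x<..<y}" "openin (top_of_set {0..1}) {x'<..<y'}"
      using sub by (auto intro: open_subset)
    moreover have "{x<..<y} \<noteq> {}" "{x'<..<y'} \<noteq> {}" using xy(2) xy'(2) by auto
    ultimately have "\<exists>N. \<forall>n\<ge>N. (S ^^ n) ` {x<..<y} \<inter> {x'<..<y'} \<noteq> {}"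
      using mix[folded S_def, unfolded topologically_mixing_def] by (elim allE impE) auto
    then obtain n where n: "(S ^^ n) ` {x<..<y} \<inter> {x'<..<y'} \<noteq> {}" by blast
    \<comment> \<open>Points of the first interval that are sent into the second: open and nonempty.
      Yet \<open>W\<close> is null, since almost all of its points lie in \<open>A\<close> while
      their images at time \<open>n\<close> almost all lie outside, against invariance.\<close>
    define W where "W = {x<..<y} \<inter> (S ^^ n) -` {x'<..<y'}"
    have "open W" unfolding W_def
      by (intro continuous_open_preimage continuous_on_subset[OF continuous_on_funpow[OF cont range] sub(1)]) auto
    moreover have "W \<noteq> {}" using n by (auto simp: W_def)
    ultimately have "\<not> negligible W" using open_not_negligible by blast
    moreover have "W \<in> null_sets lebesgue01"
    proof (rule null_sets_subset)
      show "({x..y} - A) \<union> ((S ^^ n) -` ({x'..y'} - ({0..1} - A)) \<inter> {0..1}) \<in> null_sets lebesgue01"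
        by (intro null_sets.Un xy ns_n xy')
      show "W \<in> sets lebesgue01" using \<open>open W\<close> sub by (auto simp: sets_lebesgue01 W_def)
      show "W \<subseteq> ({x..y} - A) \<union> ((S ^^ n) -` ({x'..y'} - ({0..1} - A)) \<inter> {0..1})"
      proof
        fix z assume z: "z \<in> W"
        hence z01: "z \<in> {0..1}" using sub by (auto simp: W_def)
        have "(S ^^ m) z \<in> A \<longleftrightarrow> z \<in> A" for m
          by (induction m) (use inv funpow_mem[OF range z01] in auto)
        from this[of n] show "z \<in> ({x..y} - A) \<union> ((S ^^ n) -` ({x'..y'} - ({0..1} - A)) \<inter> {0..1})"
          using z z01 by (auto simp: W_def)
      qed
    qed
    hence "negligible W" by (simp add: null_sets_lebesgue01 negligible_iff_null_sets null_sets_completionI)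
    ultimately show False by blast
  qed
  show ?thesis unfolding S_def[symmetric]
    by unfold_locales (use cont range ns erg in auto)
qed

lemma typical_turning_point:
  assumes a: "a \<in> {p..q}" and mix: "topologically_mixing (T a)" and ne: "\<And>k. 1 \<le> k \<Longrightarrow> orb k a \<noteq> c a"
    and good: "good_freq a"
  shows "\<exists>\<mu>. acip (T a) \<mu> \<and> (\<forall>\<nu>. acip (T a) \<nu> \<longrightarrow> \<nu> = \<mu>) \<and> typical (T a) \<mu> (c a)"
proof -
  interpret ne: nonsingular_ergodic "T a" by (rule ergodic_if_mixing[OF a mix ne])
  obtain C where C: "0 < C" "\<And>r t. r \<in> \<rat> \<Longrightarrow> t \<in> \<rat> \<Longrightarrow> r < t \<Longrightarrow>
     \<forall>\<^sub>F n in sequentially. real (card {i. i < n \<and> orb i a \<in> {r..t}}) \<le> C * (t - r) * n"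
    using good unfolding good_freq_def by blast
  interpret orbit_frequency "T a" "c a" C
    by unfold_locales (use ne.cont ne.range c_in[OF a] C in \<open>auto simp: orb_def\<close>)
  show ?thesis by (rule typical_if_acip_unique) (rule ne.acip_unique)
qed

end

theorem theorem1p2:
  fixes p q L :: real
    and T :: "real \<Rightarrow> real \<Rightarrow> real"
    and c :: "real \<Rightarrow> real"
    and j0 :: nat
  assumes "p < q"
    and "pe_unimodal_family L {p..q} T c"
    and "\<And>a. a \<in> {p..q} \<Longrightarrow> topologically_mixing (T a)"
    and "j0 \<ge> 3"
    and "finite {a \<in> {p..q}.
           \<not> ((\<lambda>b. (T b ^^ j0) (c b)) differentiable (at a within {p..q}) \<and>
              \<bar>vector_derivative (\<lambda>b. (T b ^^ j0) (c b)) (at a within {p..q})\<bar> >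
                sup_param_deriv {p..q} T / (inf_space_deriv {p..q} T - 1))}"
  shows "AE a in lebesgue. a \<in> {p..q} \<longrightarrow>
           (\<exists>\<mu>. acip (T a) \<mu> \<and> (\<forall>\<nu>. acip (T a) \<nu> \<longrightarrow> \<nu> = \<mu>) \<and> typical (T a) \<mu> (c a))"
proof -
  obtain Lam where "unimodal_family p q L T c (inf_space_deriv {p..q} T) Lam (sup_param_deriv {p..q} T)"
    using unimodal_family_sup_inf[OF assms(1,2)] by blast
  then interpret unimodal_family p q L T c "inf_space_deriv {p..q} T" Lam "sup_param_deriv {p..q} T" .
  let ?M = "sup_param_deriv {p..q} T / (inf_space_deriv {p..q} T - 1)"
  define Ex where "Ex = {a \<in> {p..q}. \<not> (orb j0 differentiable (at a within {p..q}) \<and>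
      \<bar>vector_derivative (orb j0) (at a within {p..q})\<bar> > ?M)}"
  have finE: "finite Ex" using assms(5) by (simp add: Ex_def orb_def[abs_def])
  have deriv: "\<exists>dv. (orb j0 has_real_derivative dv) (at a within {p..q}) \<and> ?M < \<bar>dv\<bar>" if "a \<in> {p..q} - Ex" for a
  proof (intro exI conjI)
    have d: "orb j0 differentiable (at a within {p..q})" using that by (auto simp: Ex_def)
    thus "(orb j0 has_real_derivative vector_derivative (orb j0) (at a within {p..q})) (at a within {p..q})"
      by (simp add: has_real_derivative_iff_has_vector_derivative vector_derivative_works)
    show "?M < \<bar>vector_derivative (orb j0) (at a within {p..q})\<bar>" using that by (auto simp: Ex_def)
  qed
  define U where "U = {p<..<q} - Ex"
  have U: "open U" unfolding U_def using finE by (intro open_Diff finite_imp_closed) auto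
  \<comment> \<open>For each period the returning parameters have no limit point in the open set
    \<open>U\<close>, hence are countable there.\<close>
  have cZ: "countable (U \<inter> returns k)" if k: "1 \<le> k" for k
  proof (rule sparse_imp_countable[OF U])
    show "returns k sparse_in U"
      unfolding sparse_in_open[OF U]
    proof
      fix a assume "a \<in> U"
      hence a: "a \<in> {p..q} - Ex" by (auto simp: U_def)
      obtain dv where "(orb j0 has_real_derivative dv) (at a within {p..q})" "?M < \<bar>dv\<bar>" using deriv[OF a] by blast
      with a k show "\<not> a islimpt returns k" by (intro returns_no_limit_point[of a j0 dv k]) auto
    qed
  qed
  \<comment> \<open>The end points are included because strict derivatives need a two-sided
    neighbourhood. The whole set is countable, hence null.\<close>
  define Bad where "Bad = {p, q} \<union> Ex \<union> (\<Union>k\<in>{1..}. U \<inter> returns k)"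
  have "countable (\<Union>k\<in>{1..}. U \<inter> returns k)" using cZ by (intro countable_UN) auto
  hence cBad: "countable Bad" unfolding Bad_def using countable_finite[OF finE] by (intro countable_Un) auto
  have nonret: "orb k a \<noteq> c a" if "a \<in> {p..q} - Bad" "1 \<le> k" for a k
    using that by (auto simp: Bad_def U_def returns_def)
  define \<F> where "\<F> = {S. open S \<and> (AE a in lborel. a \<in> S \<longrightarrow> good_freq a)}"
  have cover: "a \<in> \<Union>\<F>" if a: "a \<in> {p..q} - Bad" for a
  proof -
    have a': "p < a" "a < q" "a \<in> {p..q} - Ex" using a by (auto simp: Bad_def)
    obtain dv where dv: "(orb j0 has_real_derivative dv) (at a within {p..q})" "?M < \<bar>dv\<bar>" using deriv[OF a'(3)] by blast
    obtain r where r: "0 < r" "AE b in lborel. \<bar>b - a\<bar> < r \<longrightarrow> good_freq b"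
      using local_good_freq[OF a'(1,2) dv nonret[OF a]] assms(4) by auto
    have "ball a r \<in> \<F>"
      using r(2) by (simp add: \<F>_def dist_real_def abs_minus_commute)
    thus ?thesis using r(1) by (intro UnionI[of "ball a r"]) auto
  qed
  \<comment> \<open>Every remaining parameter has a neighbourhood with its own exceptional null set;
    a countable subcover makes the union of these null.\<close>
  obtain \<G> where G: "\<G> \<subseteq> \<F>" "countable \<G>" "\<Union>\<G> = \<Union>\<F>"
    by (rule Lindelof[of \<F>]) (auto simp: \<F>_def)
  have "AE a in lborel. \<forall>S\<in>\<G>. a \<in> S \<longrightarrow> good_freq a"
    using G(1,2) by (subst AE_ball_countable) (auto simp: \<F>_def)
  moreover have "AE a in lborel. a \<notin> Bad"
    by (rule AE_not_in) (use cBad in \<open>simp add: countable_imp_null_set_lborel\<close>)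
  ultimately have "AE a in lborel. a \<in> {p..q} \<longrightarrow>
      (\<exists>\<mu>. acip (T a) \<mu> \<and> (\<forall>\<nu>. acip (T a) \<nu> \<longrightarrow> \<nu> = \<mu>) \<and> typical (T a) \<mu> (c a))"
  proof eventually_elim
    case (elim a)
    show ?case
    proof
      assume a: "a \<in> {p..q}"
      hence aB: "a \<in> {p..q} - Bad" using elim by blast
      have "good_freq a" using cover[OF aB] elim(1) G(3) by blast
      thus "\<exists>\<mu>. acip (T a) \<mu> \<and> (\<forall>\<nu>. acip (T a) \<nu> \<longrightarrow> \<nu> = \<mu>) \<and> typical (T a) \<mu> (c a)"
        by (intro typical_turning_point[OF a assms(3)[OF a]] nonret[OF aB])
    qed
  qed
  thus ?thesis by (rule AE_completion)
qed

end
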